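(* The extension of the viscosity semigroup $S^{(0)}$ (with coefficients $C$) to $L_\infty(\mathbb{R}^d)$ satisfies \[ S^{(0)}_t\mathbf 1=\mathbf 1 \] for all $t>0$, where $\mathbf 1$ is the constant function with value $1$.
   Context: Let $C=(c_{ij})$ be a $d\times d$ matrix of real-valued $L_\infty(\mathbb{R}^d)$ functions, symmetric and positive semidefinite almost everywhere. Let $L_{2;1}(\mathbb{R}^d)=W^{1,2}(\mathbb{R}^d)$ and define $h(\varphi)=\sum_{i,j=1}^d(\partial_i\varphi,c_{ij}\partial_j\varphi)$, $l(\varphi)=\sum_{i=1}^d\|\partial_i\varphi\|_2^2$, both with domain $L_{2;1}(\mathbb{R}^d)$. For $\varepsilon\in(0,1]$ the form $h_\varepsilon=h+\varepsilon l$ is closed; let $H_\varepsilon$ be the associated positive self-adjoint operator on $L_2(\mathbb{R}^d)$. As $\varepsilon\downarrow0$, $H_\varepsilon$ converges in the strong resolvent sense to a positive self-adjoint operator $H_0$, the viscosity operator with coefficients $C$. The viscosity semigroup is $S^{(0)}_t=e^{-tH_0}$. It is positivity preserving and satisfies $|(\varphi,S^{(0)}_t\psi)|\le\|\varphi\|_p\|\psi\|_q$ for $\varphi\in L_2\cap L_p$, $\psi\in L_2\cap L_q$ with $p,q$ conjugate, so it extends to a positivity preserving contraction semigroup on $L_p(\mathbb{R}^d)$ for every $p\in[1,\infty]$ (on $L_\infty$ the extension is the dual of the extension to $L_1$). *)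

theory Defs
  imports "HOL-Analysis.Analysis"
begin

section \<open>Lebesgue spaces\<close>

text \<open>
  Elements of the (complex) Lebesgue spaces over \<open>real ^ 'n\<close> are represented by functions;
  two functions represent the same element iff they agree almost everywhere.  All operators
  below are therefore only determined up to \<open>ae_eq\<close>.
\<close>

type_synonym 'n cfun = "(real ^ 'n) \<Rightarrow> complex"

abbreviation ae_eq :: "('n::finite) cfun \<Rightarrow> 'n cfun \<Rightarrow> bool" where
  "ae_eq f g \<equiv> (AE x in lebesgue. f x = g x)"

definition L1 :: "('n::finite) cfun set" where
  "L1 = {f. integrable lebesgue f}"

definition L1_norm :: "('n::finite) cfun \<Rightarrow> real" where
  "L1_norm f = (LINT x|lebesgue. cmod (f x))"

definition L2 :: "('n::finite) cfun set" where
  "L2 = {f \<in> borel_measurable lebesgue. integrable lebesgue (\<lambda>x. (cmod (f x))\<^sup>2)}"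

definition L2_norm :: "('n::finite) cfun \<Rightarrow> real" where
  "L2_norm f = sqrt (LINT x|lebesgue. (cmod (f x))\<^sup>2)"

definition Linfty :: "((real ^ 'n::finite) \<Rightarrow> 'b::real_normed_vector) set" where
  "Linfty = {f \<in> borel_measurable lebesgue. \<exists>K. AE x in lebesgue. norm (f x) \<le> K}"

text \<open>The pairing \<open>(f, g)\<close>, conjugate linear in the first argument; it serves both as the
  inner product of \<open>L2\<close> and as the duality between \<open>Linfty\<close> and \<open>L1\<close>.\<close>

definition pairing :: "('n::finite) cfun \<Rightarrow> 'n cfun \<Rightarrow> complex" where
  "pairing f g = (LINT x|lebesgue. cnj (f x) * g x)"


section \<open>Weak derivatives and the Sobolev space of order one\<close>

definition partial_deriv :: "'n \<Rightarrow> ((real ^ 'n::finite) \<Rightarrow> real) \<Rightarrow> (real ^ 'n) \<Rightarrow> real" where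
  "partial_deriv i \<phi> x = frechet_derivative \<phi> (at x) (axis i 1)"

fun C_diff :: "nat \<Rightarrow> ((real ^ 'n::finite) \<Rightarrow> real) \<Rightarrow> bool" where
  "C_diff 0 \<phi> \<longleftrightarrow> continuous_on UNIV \<phi>"
| "C_diff (Suc k) \<phi> \<longleftrightarrow>
     (\<forall>x. \<phi> differentiable (at x)) \<and> (\<forall>i. C_diff k (partial_deriv i \<phi>))"

definition test_functions :: "((real ^ 'n::finite) \<Rightarrow> real) set" where
  "test_functions = {\<phi>. (\<forall>k. C_diff k \<phi>) \<and> compact (closure {x. \<phi> x \<noteq> 0})}"

definition has_weak_deriv :: "'n \<Rightarrow> ('n::finite) cfun \<Rightarrow> 'n cfun \<Rightarrow> bool" where
  "has_weak_deriv i u g \<longleftrightarrow>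
     (\<forall>\<phi>\<in>test_functions.
        (LINT x|lebesgue. partial_deriv i \<phi> x *\<^sub>R u x) = - (LINT x|lebesgue. \<phi> x *\<^sub>R g x))"

definition W12 :: "('n::finite) cfun set" where
  "W12 = {u \<in> L2. \<forall>i. \<exists>g\<in>L2. has_weak_deriv i u g}"

text \<open>Meaningful for \<open>u \<in> W12\<close> only, where it is unique up to null sets.\<close>

definition weak_deriv :: "'n \<Rightarrow> ('n::finite) cfun \<Rightarrow> 'n cfun" where
  "weak_deriv i u = (SOME g. g \<in> L2 \<and> has_weak_deriv i u g)"


section \<open>Unbounded operators\<close>

text \<open>An operator \<open>H\<close> on \<open>L2\<close> is represented by its graph, which consists of all pairs
  \<open>(u, f)\<close> such that \<open>u\<close> represents an element of the domain and \<open>f\<close> represents its image.\<close>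

type_synonym 'n graph = "('n cfun \<times> 'n cfun) set"

definition adjoint :: "('n::finite) graph \<Rightarrow> 'n graph" where
  "adjoint H = {(v, g). v \<in> L2 \<and> g \<in> L2 \<and> (\<forall>(u, f)\<in>H. pairing v f = pairing g u)}"

definition densely_defined :: "('n::finite) graph \<Rightarrow> bool" where
  "densely_defined H \<longleftrightarrow> (\<forall>f\<in>L2. \<forall>e>0. \<exists>(u, g)\<in>H. L2_norm (\<lambda>x. f x - u x) < e)"

text \<open>Equality with the adjoint forces \<open>H\<close> to be a linear subspace, closed under \<open>ae_eq\<close>;
  together with density of the domain, it also forces \<open>H\<close> to be single-valued.\<close>

definition self_adjoint :: "('n::finite) graph \<Rightarrow> bool" where
  "self_adjoint H \<longleftrightarrow> densely_defined H \<and> adjoint H = H"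

definition positive_op :: "('n::finite) graph \<Rightarrow> bool" where
  "positive_op H \<longleftrightarrow> (\<forall>(u, f)\<in>H. Im (pairing u f) = 0 \<and> Re (pairing u f) \<ge> 0)"

text \<open>\<open>R\<close> is the bounded everywhere defined inverse of \<open>H - z\<close>.\<close>

definition is_resolvent :: "('n::finite) graph \<Rightarrow> complex \<Rightarrow> ('n cfun \<Rightarrow> 'n cfun) \<Rightarrow> bool" where
  "is_resolvent H z R \<longleftrightarrow>
     (\<forall>f\<in>L2. (R f, \<lambda>x. f x + z * R f x) \<in> H \<and>
              (\<forall>u. (u, \<lambda>x. f x + z * u x) \<in> H \<longrightarrow> ae_eq u (R f))) \<and>
     (\<exists>M. \<forall>f\<in>L2. L2_norm (R f) \<le> M * L2_norm f)"

text \<open>Strong resolvent convergence of positive self-adjoint operators as \<open>\<epsilon> \<down> 0\<close>: strong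
  convergence of the resolvents at every point outside \<open>[0, \<infinity>)\<close>, hence outside all the spectra.\<close>

definition strong_resolvent_limit :: "(real \<Rightarrow> ('n::finite) graph) \<Rightarrow> 'n graph \<Rightarrow> bool" where
  "strong_resolvent_limit H H0 \<longleftrightarrow>
     (\<forall>z. z \<notin> \<real>\<^sub>\<ge>\<^sub>0 \<longrightarrow>
       (\<exists>R R0. (\<forall>\<epsilon>\<in>{0<..1}. is_resolvent (H \<epsilon>) z (R \<epsilon>)) \<and> is_resolvent H0 z R0 \<and>
         (\<forall>f\<in>L2. ((\<lambda>\<epsilon>. L2_norm (\<lambda>x. R \<epsilon> f x - R0 f x)) \<longlongrightarrow> 0) (at_right 0))))"


section \<open>The viscosity operator\<close>

definition h_form ::
    "((real ^ 'n) \<Rightarrow> real ^ 'n ^ 'n) \<Rightarrow> ('n::finite) cfun \<Rightarrow> 'n cfun \<Rightarrow> complex" where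
  "h_form C u v =
     (\<Sum>i\<in>UNIV. \<Sum>j\<in>UNIV.
        pairing (weak_deriv i u) (\<lambda>x. complex_of_real (C x $ i $ j) * weak_deriv j v x))"

definition l_form :: "('n::finite) cfun \<Rightarrow> 'n cfun \<Rightarrow> complex" where
  "l_form u v = (\<Sum>i\<in>UNIV. pairing (weak_deriv i u) (weak_deriv i v))"

text \<open>The operator associated with a sesquilinear form \<open>a\<close> with domain \<open>D\<close>, as in the
  representation theorem for closed forms.\<close>

definition form_operator ::
    "('n::finite) cfun set \<Rightarrow> ('n cfun \<Rightarrow> 'n cfun \<Rightarrow> complex) \<Rightarrow> 'n graph" where
  "form_operator D a = {(u, f). u \<in> D \<and> f \<in> L2 \<and> (\<forall>v\<in>D. a v u = pairing v f)}"

definition H_eps :: "((real ^ 'n) \<Rightarrow> real ^ 'n ^ 'n) \<Rightarrow> real \<Rightarrow> ('n::finite) graph" where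
  "H_eps C \<epsilon> = form_operator W12 (\<lambda>u v. h_form C u v + complex_of_real \<epsilon> * l_form u v)"

definition viscosity_operator ::
    "((real ^ 'n) \<Rightarrow> real ^ 'n ^ 'n) \<Rightarrow> ('n::finite) graph \<Rightarrow> bool" where
  "viscosity_operator C H0 \<longleftrightarrow>
     self_adjoint H0 \<and> positive_op H0 \<and> strong_resolvent_limit (H_eps C) H0"


section \<open>Semigroups\<close>

definition linear_contraction ::
    "('n::finite) cfun set \<Rightarrow> ('n cfun \<Rightarrow> real) \<Rightarrow> ('n cfun \<Rightarrow> 'n cfun) \<Rightarrow> bool" where
  "linear_contraction V N T \<longleftrightarrow>
     (\<forall>f\<in>V. T f \<in> V \<and> N (T f) \<le> N f) \<and>
     (\<forall>f\<in>V. \<forall>g\<in>V. ae_eq (T (\<lambda>x. f x + g x)) (\<lambda>x. T f x + T g x)) \<and>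
     (\<forall>c. \<forall>f\<in>V. ae_eq (T (\<lambda>x. c * f x)) (\<lambda>x. c * T f x))"

definition contraction_semigroup ::
    "('n::finite) cfun set \<Rightarrow> ('n cfun \<Rightarrow> real) \<Rightarrow> (real \<Rightarrow> 'n cfun \<Rightarrow> 'n cfun) \<Rightarrow> bool" where
  "contraction_semigroup V N S \<longleftrightarrow>
     (\<forall>t\<ge>0. linear_contraction V N (S t)) \<and>
     (\<forall>f\<in>V. ae_eq (S 0 f) f) \<and>
     (\<forall>s\<ge>0. \<forall>t\<ge>0. \<forall>f\<in>V. ae_eq (S (s + t) f) (S s (S t f)))"

definition generator :: "(real \<Rightarrow> ('n::finite) cfun \<Rightarrow> 'n cfun) \<Rightarrow> 'n graph" where
  "generator S = {(u, f). u \<in> L2 \<and> f \<in> L2 \<and>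
     ((\<lambda>t. L2_norm (\<lambda>x. (S t u x - u x) / complex_of_real t - f x)) \<longlongrightarrow> 0) (at_right 0)}"

text \<open>\<open>S t = exp (- t H)\<close>: the strongly continuous contraction semigroup on \<open>L2\<close> whose
  generator is \<open>- H\<close>.\<close>

definition exp_semigroup ::
    "('n::finite) graph \<Rightarrow> (real \<Rightarrow> 'n cfun \<Rightarrow> 'n cfun) \<Rightarrow> bool" where
  "exp_semigroup H S \<longleftrightarrow>
     contraction_semigroup L2 L2_norm S \<and>
     (\<forall>f\<in>L2. ((\<lambda>t. L2_norm (\<lambda>x. S t f x - f x)) \<longlongrightarrow> 0) (at_right 0)) \<and>
     generator S = {(u, \<lambda>x. - f x) |u f. (u, f) \<in> H}"

definition L1_extension ::
    "(real \<Rightarrow> ('n::finite) cfun \<Rightarrow> 'n cfun) \<Rightarrow> (real \<Rightarrow> 'n cfun \<Rightarrow> 'n cfun) \<Rightarrow> bool" where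
  "L1_extension S S1 \<longleftrightarrow>
     contraction_semigroup L1 L1_norm S1 \<and>
     (\<forall>t\<ge>0. \<forall>f \<in> L1 \<inter> L2. ae_eq (S1 t f) (S t f))"

text \<open>The extension to \<open>Linfty\<close> is the dual of the extension to \<open>L1\<close>.\<close>

definition Linfty_extension ::
    "(real \<Rightarrow> ('n::finite) cfun \<Rightarrow> 'n cfun) \<Rightarrow> (real \<Rightarrow> 'n cfun \<Rightarrow> 'n cfun) \<Rightarrow> bool" where
  "Linfty_extension S Sinf \<longleftrightarrow>
     (\<exists>S1. L1_extension S S1 \<and>
       (\<forall>t\<ge>0. \<forall>f\<in>Linfty. Sinf t f \<in> Linfty \<and>
         (\<forall>g\<in>L1. pairing (Sinf t f) g = pairing f (S1 t g))))"

end

theory Submission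
  imports Defs "HOL-Real_Asymp.Real_Asymp"
begin

text \<open>
  Let \<open>\<chi>\<^sub>\<delta> x = (1 + \<delta> |x|\<^sup>2)\<^sup>-\<^sup>m\<close> with \<open>m\<close> so large that \<open>G = \<chi>\<^sub>1\<close> is integrable, let
  \<open>W\<^sub>\<delta> = \<chi>\<^sub>\<delta> / G\<close>, and let \<open>u\<^sub>\<epsilon> = (\<kappa> + H\<^sub>\<epsilon>)\<^sup>-\<^sup>1 G\<close> with \<open>\<kappa>\<close> large.  The gradient of \<open>W\<^sub>\<delta>\<close> is at most
  \<open>m W\<^sub>\<delta>\<close>, so testing the equation with \<open>W\<^sub>\<delta> u\<^sub>\<epsilon>\<close> bounds the energy of \<open>u\<^sub>\<epsilon>\<close> with weight \<open>W\<^sub>\<delta>\<close> by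
  \<open>2 \<integral> G\<close>, uniformly in \<open>\<delta>\<close> and \<open>\<epsilon>\<close>.  The gradient of \<open>\<chi>\<^sub>\<delta>\<close> is at most \<open>m \<surd>\<delta> \<chi>\<^sub>\<delta>\<close>, so testing with
  \<open>\<chi>\<^sub>\<delta>\<close> and Cauchy-Schwarz give \<open>\<kappa> (\<chi>\<^sub>\<delta>, u\<^sub>\<epsilon>) = (\<chi>\<^sub>\<delta>, G) + O(\<surd>\<delta>)\<close>, which passes to the limit
  \<open>\<epsilon> \<down> 0\<close>.  Since \<open>exp (- \<kappa> s) ((\<chi>\<^sub>\<delta>, S\<^sub>s u) - \<integral> G / \<kappa>)\<close> has derivative
  \<open>exp (- \<kappa> s) (\<integral> G - (\<chi>\<^sub>\<delta>, S\<^sub>s G)) \<ge> 0\<close>, vanishes as \<open>s \<rightarrow> \<infinity>\<close> and is \<open>O(\<surd>\<delta>) + o(1)\<close> at \<open>s = 0\<close>, Fatou's lemma yields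
  \<open>\<integral> S\<^sub>s G = \<integral> G\<close> for almost every \<open>s > 0\<close>.  As \<open>G\<close> is positive everywhere, contractivity forces
  \<open>S\<^sub>s 1 = 1\<close> for these \<open>s\<close>, and every \<open>t > 0\<close> is a sum of two of them.
\<close>

section \<open>Smooth functions\<close>

lemma partial_deriv_eqI:
  assumes "(\<phi> has_derivative D) (at x)"
  shows "partial_deriv i \<phi> x = D (axis i 1)"
  using frechet_derivative_at[OF assms] by (simp add: partial_deriv_def)

text \<open>\<open>C_diff (Suc k)\<close> asks for differentiability only, so at the bottom level
  continuity is recovered from it. The descent supports closure under products, where the product
  rule leaves one factor undifferentiated.\<close>

lemma C_diff_SucD: "C_diff (Suc k) \<phi> \<Longrightarrow> C_diff k \<phi>"
proof (induction k arbitrary: \<phi>)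
  case 0
  then show ?case
    by (auto intro!: continuous_at_imp_continuous_on differentiable_imp_continuous_within)
qed auto

lemma C_diff_const: "C_diff k (\<lambda>x. c)"
proof (induction k arbitrary: c)
  case (Suc k)
  have "partial_deriv i (\<lambda>x. c) = (\<lambda>x. 0)" for i :: 'a
    by (rule ext, subst partial_deriv_eqI[where D="\<lambda>_. 0"]) auto
  with Suc show ?case by auto
qed simp

lemma C_diff_nth: "C_diff k (\<lambda>x. x $ i)"
proof (cases k)
  case (Suc n)
  have D: "((\<lambda>x. x $ i) has_derivative (\<lambda>h. h $ i)) (at x)" for x :: "real ^ 'a"
    by (intro bounded_linear.has_derivative[OF bounded_linear_vec_nth] has_derivative_ident)
  have "partial_deriv j (\<lambda>x. x $ i) = (\<lambda>x. axis j 1 $ i)" for j :: 'a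
    by (rule ext, subst partial_deriv_eqI[OF D]) auto
  with D Suc show ?thesis by (auto simp: differentiable_def C_diff_const)
qed (auto intro: continuous_intros)

lemma partial_deriv_add:
  assumes "\<phi> differentiable (at x)" "\<psi> differentiable (at x)"
  shows "partial_deriv i (\<lambda>x. \<phi> x + \<psi> x) x = partial_deriv i \<phi> x + partial_deriv i \<psi> x"
proof -
  from assms obtain D E where D: "(\<phi> has_derivative D) (at x)" "(\<psi> has_derivative E) (at x)"
    by (auto simp: differentiable_def)
  show ?thesis
    using partial_deriv_eqI[OF has_derivative_add[OF D]] D[THEN partial_deriv_eqI] by simp
qed

lemma partial_deriv_mult:
  assumes "\<phi> differentiable (at x)" "\<psi> differentiable (at x)"
  shows "partial_deriv i (\<lambda>x. \<phi> x * \<psi> x) x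
           = \<phi> x * partial_deriv i \<psi> x + partial_deriv i \<phi> x * \<psi> x"
proof -
  from assms obtain D E where D: "(\<phi> has_derivative D) (at x)" "(\<psi> has_derivative E) (at x)"
    by (auto simp: differentiable_def)
  show ?thesis
    using partial_deriv_eqI[OF has_derivative_mult[OF D]] D[THEN partial_deriv_eqI] by simp
qed

lemma C_diff_add: "C_diff k \<phi> \<Longrightarrow> C_diff k \<psi> \<Longrightarrow> C_diff k (\<lambda>x. \<phi> x + \<psi> x)"
proof (induction k arbitrary: \<phi> \<psi>)
  case (Suc k)
  have "partial_deriv i (\<lambda>x. \<phi> x + \<psi> x) = (\<lambda>x. partial_deriv i \<phi> x + partial_deriv i \<psi> x)" for i
    using Suc.prems by (auto simp: partial_deriv_add)
  with Suc show ?case by auto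
qed (auto intro: continuous_intros)

lemma C_diff_mult: "C_diff k \<phi> \<Longrightarrow> C_diff k \<psi> \<Longrightarrow> C_diff k (\<lambda>x. \<phi> x * \<psi> x)"
proof (induction k arbitrary: \<phi> \<psi>)
  case (Suc k)
  have "partial_deriv i (\<lambda>x. \<phi> x * \<psi> x)
      = (\<lambda>x. \<phi> x * partial_deriv i \<psi> x + partial_deriv i \<phi> x * \<psi> x)" for i
    using Suc.prems by (auto simp: partial_deriv_mult)
  with Suc C_diff_SucD[OF Suc.prems(1)] C_diff_SucD[OF Suc.prems(2)] show ?case
    by (auto intro: C_diff_add)
qed (auto intro: continuous_intros)

lemma C_diff_sum: "(\<And>i. i \<in> I \<Longrightarrow> C_diff k (\<phi> i)) \<Longrightarrow> C_diff k (\<lambda>x. \<Sum>i\<in>I. \<phi> i x)"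
  by (induction I rule: infinite_finite_induct) (auto intro: C_diff_add C_diff_const)

lemma C_diff_prod: "(\<And>i. i \<in> I \<Longrightarrow> C_diff k (\<phi> i)) \<Longrightarrow> C_diff k (\<lambda>x. \<Prod>i\<in>I. \<phi> i x)"
  by (induction I rule: infinite_finite_induct) (auto intro: C_diff_mult C_diff_const)

lemma C_diff_power: "C_diff k \<phi> \<Longrightarrow> C_diff k (\<lambda>x. \<phi> x ^ n)"
  by (induction n) (auto intro: C_diff_mult C_diff_const)

lemma partial_deriv_compose:
  assumes "\<phi> differentiable (at x)" "(f has_real_derivative f') (at (\<phi> x))"
  shows "partial_deriv i (\<lambda>x. f (\<phi> x)) x = f' * partial_deriv i \<phi> x"
proof -
  from assms obtain D where D: "(\<phi> has_derivative D) (at x)"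
    by (auto simp: differentiable_def)
  show ?thesis
    using partial_deriv_eqI[OF has_derivative_compose[OF D has_field_derivative_imp_has_derivative[OF assms(2)]]]
      partial_deriv_eqI[OF D] by simp
qed

lemma differentiable_compose_real:
  fixes \<phi> :: "'a::real_normed_vector \<Rightarrow> real"
  assumes "\<phi> differentiable (at x)" "(f has_real_derivative f') (at (\<phi> x))"
  shows "(\<lambda>x. f (\<phi> x)) differentiable (at x)"
  using assms by (metis differentiable_def has_derivative_compose has_field_derivative_imp_has_derivative)

text \<open>\<open>F\<close> lists all successive derivatives of the outer function, and the
  induction generalizes over \<open>m\<close>: the chain rule replaces \<open>F m\<close> by
  \<open>F (Suc m)\<close> and uses up one order of differentiability.\<close>

lemma C_diff_compose:
  assumes "\<And>m t. t \<in> A \<Longrightarrow> (F m has_real_derivative F (Suc m) t) (at t)"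
    and "C_diff k \<phi>" and "\<And>x. \<phi> x \<in> A"
  shows "C_diff k (\<lambda>x. F m (\<phi> x))"
  using assms(2)
proof (induction k arbitrary: m)
  case 0
  have "continuous_on A (F m)"
    by (meson assms(1) DERIV_continuous continuous_at_imp_continuous_on)
  with 0 show ?case
    using continuous_on_compose2[of A "F m" UNIV \<phi>] assms(3) by auto
next
  case (Suc k)
  have d: "\<phi> differentiable (at x)" for x
    using Suc.prems by simp
  have "partial_deriv i (\<lambda>x. F m (\<phi> x)) = (\<lambda>x. F (Suc m) (\<phi> x) * partial_deriv i \<phi> x)" for i
    using partial_deriv_compose[OF d assms(1)[OF assms(3)]] by auto
  moreover have "C_diff k (\<lambda>x. F (Suc m) (\<phi> x))"
    using Suc.IH[OF C_diff_SucD[OF Suc.prems]] .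
  ultimately show ?case
    using Suc.prems differentiable_compose_real[OF d assms(1)[OF assms(3)]]
    by (auto intro: C_diff_mult)
qed

text \<open>The derivative of the reciprocal is a polynomial in the reciprocal times a derivative of
  \<phi>, so the induction hypothesis one order lower covers it.\<close>

lemma C_diff_inverse:
  assumes "C_diff k \<phi>" "\<And>x. \<phi> x > 0"
  shows "C_diff k (\<lambda>x. inverse (\<phi> x))"
  using assms(1)
proof (induction k)
  case 0
  then show ?case using assms(2) by (auto intro!: continuous_intros simp: less_le)
next
  case (Suc k)
  have d: "\<phi> differentiable (at x)" for x
    using Suc.prems by simp
  have I: "(inverse has_real_derivative - (inverse (\<phi> x) ^ 2)) (at (\<phi> x))" for x
    using DERIV_inverse[of "\<phi> x" UNIV] assms(2)[of x] by (simp add: numeral_2_eq_2)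
  have pd: "partial_deriv i (\<lambda>x. inverse (\<phi> x))
      = (\<lambda>x. (-1) * (inverse (\<phi> x) ^ 2) * partial_deriv i \<phi> x)" for i
    using partial_deriv_compose[OF d I] by auto
  have "C_diff k (\<lambda>x. (-1) * (inverse (\<phi> x) ^ 2))"
    using Suc.IH[OF C_diff_SucD[OF Suc.prems]] by (intro C_diff_mult C_diff_power C_diff_const)
  hence "C_diff k (partial_deriv i (\<lambda>x. inverse (\<phi> x)))" for i
    unfolding pd by (rule C_diff_mult) (use Suc.prems in auto)
  thus ?case
    using differentiable_compose_real[OF d I] by simp
qed

text \<open>The \<open>m\<close>-th derivative of \<open>exp (- 1 / t)\<close>, extended by \<open>0\<close> to \<open>t \<le> 0\<close>.\<close>

fun bump_poly :: "nat \<Rightarrow> real poly" where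
  "bump_poly 0 = 1"
| "bump_poly (Suc m) = [:0, 0, 1:] * (bump_poly m - pderiv (bump_poly m))"

definition bump :: "nat \<Rightarrow> real \<Rightarrow> real" where
  "bump m t = (if t > 0 then poly (bump_poly m) (inverse t) * exp (- inverse t) else 0)"

lemma poly_times_exp_minus_tendsto_0:
  "((\<lambda>y::real. poly p y * exp (- y)) \<longlongrightarrow> 0) at_top"
proof -
  have "((\<lambda>y::real. coeff p i * (y ^ i * exp (- y))) \<longlongrightarrow> coeff p i * 0) at_top" for i
    using tendsto_power_div_exp_0[of i] by (intro tendsto_intros) (simp add: exp_minus divide_inverse)
  hence "((\<lambda>y::real. \<Sum>i\<le>degree p. coeff p i * (y ^ i * exp (- y))) \<longlongrightarrow> (\<Sum>i\<le>degree p. 0)) at_top"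
    by (intro tendsto_sum) simp
  thus ?thesis by (simp add: poly_altdef sum_distrib_right mult.assoc)
qed

text \<open>With y = 1/t one has d/dt = - y^2 d/dy, which takes p(y) exp(- y) to y^2 (p - p')(y)
  exp(- y); this is the recursion of \<open>bump_poly\<close>. At t = 0 the right difference
  quotient is y p(y) exp(- y) with y = 1/h, and the exponential beats every polynomial.\<close>

lemma has_real_derivative_bump: "(bump m has_real_derivative bump (Suc m) t) (at t)"
proof -
  consider "t > 0" | "t < 0" | "t = 0" by linarith
  thus ?thesis
  proof cases
    case 1
    let ?p = "bump_poly m"
    have "((\<lambda>t. poly ?p (inverse t) * exp (- inverse t)) has_real_derivative
            bump (Suc m) t) (at t)"
      using 1
      by (auto intro!: derivative_eq_intros simp: bump_def power2_eq_square algebra_simps)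
    moreover have "\<forall>\<^sub>F s in nhds t. bump m s = poly ?p (inverse s) * exp (- inverse s)"
      using eventually_nhds_in_open[of "{0<..}" t] 1
      by (auto elim!: eventually_mono simp: bump_def)
    ultimately show ?thesis by (rule DERIV_cong_ev[OF refl _ refl, THEN iffD2, rotated])
  next
    case 2
    have "\<forall>\<^sub>F s in nhds t. bump m s = 0"
      using eventually_nhds_in_open[of "{..<0}" t] 2
      by (auto elim!: eventually_mono simp: bump_def)
    moreover have "((\<lambda>_. 0) has_real_derivative bump (Suc m) t) (at t)"
      using 2 by (auto simp: bump_def)
    ultimately show ?thesis by (rule DERIV_cong_ev[OF refl _ refl, THEN iffD2])
  next
    case 3
    have "((\<lambda>h. poly ([:0,1:] * bump_poly m) (inverse h) * exp (- inverse h)) \<longlongrightarrow> 0) (at_right (0::real))"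
      by (rule filterlim_compose[OF poly_times_exp_minus_tendsto_0 filterlim_inverse_at_top_right])
    hence "((\<lambda>h. bump m h / h) \<longlongrightarrow> 0) (at_right 0)"
      by (rule Lim_transform_eventually,
          use eventually_at_right_less[of "0::real"] in eventually_elim)
         (simp add: bump_def divide_inverse mult_ac)
    moreover have "((\<lambda>h. bump m h / h) \<longlongrightarrow> 0) (at_left 0)"
      by (rule tendsto_eventually)
         (auto simp: bump_def eventually_at_filter)
    ultimately have "((\<lambda>h. bump m h / h) \<longlongrightarrow> 0) (at 0)"
      by (simp add: filterlim_at_split)
    moreover have "bump (Suc m) 0 = 0" "bump m 0 = 0" by (auto simp: bump_def)
    ultimately show ?thesis using 3 by (simp add: DERIV_def)
  qed
qed

lemma bump_0_bounds: "0 \<le> bump 0 t" "bump 0 t \<le> 1"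
  by (auto simp: bump_def)

text \<open>Approximating the indicator of the positive half-line in this way lets products of bumps
  approximate indicators of boxes.\<close>

lemma bump_0_scaled_tendsto:
  "(\<lambda>n. bump 0 (real n * t)) \<longlonglongrightarrow> (if t > 0 then 1 else 0)"
proof (cases "t > 0")
  case True
  have "filterlim (\<lambda>n. real n * t) at_top sequentially"
    using True by real_asymp
  hence "(\<lambda>n. exp (- inverse (real n * t))) \<longlonglongrightarrow> exp (-0)"
    by (intro tendsto_intros tendsto_inverse_0_at_top)
  moreover have "\<forall>\<^sub>F n in sequentially. exp (- inverse (real n * t)) = bump 0 (real n * t)"
    using eventually_gt_at_top[of 0] by eventually_elim (use True in \<open>simp add: bump_def\<close>)
  ultimately show ?thesis using True by (simp add: Lim_transform_eventually)
next
  case False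
  hence "\<not> real n * t > 0" for n by (simp add: zero_less_mult_iff)
  thus ?thesis using False by (simp add: bump_def)
qed

section \<open>Test functions\<close>

definition smooth :: "((real ^ 'n::finite) \<Rightarrow> real) \<Rightarrow> bool" where
  "smooth \<phi> \<longleftrightarrow> (\<forall>k. C_diff k \<phi>)"

lemma smooth_differentiable: "smooth \<phi> \<Longrightarrow> \<phi> differentiable (at x)"
  unfolding smooth_def by (metis C_diff.simps(2))

lemma smooth_partial_deriv: "smooth \<phi> \<Longrightarrow> smooth (partial_deriv i \<phi>)"
  unfolding smooth_def by (metis C_diff.simps(2))

lemma smooth_continuous: "smooth \<phi> \<Longrightarrow> continuous_on UNIV \<phi>"
  unfolding smooth_def by (metis C_diff.simps(1))

lemma smooth_measurable_borel: "smooth \<phi> \<Longrightarrow> \<phi> \<in> borel_measurable borel"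
  by (intro borel_measurable_continuous_onI smooth_continuous)

lemma smooth_measurable [measurable_dest]: "smooth \<phi> \<Longrightarrow> \<phi> \<in> borel_measurable lebesgue"
  by (intro measurable_completion) (simp add: smooth_measurable_borel)

lemma smooth_mult: "smooth \<phi> \<Longrightarrow> smooth \<psi> \<Longrightarrow> smooth (\<lambda>x. \<phi> x * \<psi> x)"
  by (simp add: smooth_def C_diff_mult)

text \<open>In finite dimension, compactness of the closed support amounts to boundedness of the set
  where \<phi> is nonzero, a form that passes to smaller sets at once.\<close>

lemma test_functions_iff: "\<phi> \<in> test_functions \<longleftrightarrow> smooth \<phi> \<and> bounded {x. \<phi> x \<noteq> 0}"
  by (simp add: test_functions_def smooth_def)

lemma test_function_smooth: "\<phi> \<in> test_functions \<Longrightarrow> smooth \<phi>"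
  by (simp add: test_functions_iff)

lemma test_function_mult:
  assumes "\<phi> \<in> test_functions" "smooth \<eta>"
  shows "(\<lambda>x. \<phi> x * \<eta> x) \<in> test_functions"
proof -
  have "{x. \<phi> x * \<eta> x \<noteq> 0} \<subseteq> {x. \<phi> x \<noteq> 0}" by auto
  thus ?thesis using assms by (auto simp: test_functions_iff smooth_mult intro: bounded_subset)
qed

lemma partial_deriv_eq_0_outside_support:
  assumes "x \<notin> closure {x. \<phi> x \<noteq> 0}"
  shows "partial_deriv i \<phi> x = 0"
proof -
  have "(\<phi> has_derivative (\<lambda>_. 0)) (at x)"
  proof (rule has_derivative_transform_within_open)
    show "((\<lambda>_. 0) has_derivative (\<lambda>_. 0)) (at x)" by simp
    show "open (- closure {x. \<phi> x \<noteq> 0})" by (intro open_Compl closed_closure)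
    show "x \<in> - closure {x. \<phi> x \<noteq> 0}" using assms by simp
    show "0 = \<phi> y" if "y \<in> - closure {x. \<phi> x \<noteq> 0}" for y
      using that closure_subset[of "{x. \<phi> x \<noteq> 0}"] by auto
  qed
  thus ?thesis by (simp add: partial_deriv_eqI)
qed

text \<open>Off the closed support \<phi> vanishes locally, and so does its derivative; the closure
  of a bounded set is bounded.\<close>

lemma test_function_partial_deriv:
  assumes "\<phi> \<in> test_functions"
  shows "partial_deriv i \<phi> \<in> test_functions"
proof -
  have "{x. partial_deriv i \<phi> x \<noteq> 0} \<subseteq> closure {x. \<phi> x \<noteq> 0}"
    using partial_deriv_eq_0_outside_support by blast
  thus ?thesis using assms
    by (auto simp: test_functions_iff smooth_partial_deriv intro: bounded_subset)
qed

lemma test_function_bounded: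
  assumes "\<phi> \<in> test_functions"
  obtains M where "M \<ge> 0" "\<And>x. \<bar>\<phi> x\<bar> \<le> M"
proof -
  let ?S = "closure {x. \<phi> x \<noteq> 0}"
  have "compact (\<phi> ` ?S)"
    using assms
    by (intro compact_continuous_image continuous_on_subset[OF smooth_continuous])
      (simp_all add: test_functions_iff)
  hence "\<exists>M. \<forall>x\<in>?S. \<bar>\<phi> x\<bar> \<le> M"
    by (auto dest!: compact_imp_bounded simp: bounded_iff)
  then obtain M where M: "\<And>x. x \<in> ?S \<Longrightarrow> \<bar>\<phi> x\<bar> \<le> M"
    by blast
  have "\<bar>\<phi> x\<bar> \<le> max M 0" for x
    using M[of x] closure_subset[of "{x. \<phi> x \<noteq> 0}"] by (cases "\<phi> x = 0") auto
  thus ?thesis using that[of "max M 0"] by simp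
qed

section \<open>Square-integrable functions\<close>

lemma L2_measurable [measurable_dest]: "f \<in> L2 \<Longrightarrow> f \<in> borel_measurable lebesgue"
  by (simp add: L2_def)

lemma L2_integrable_square: "f \<in> L2 \<Longrightarrow> integrable lebesgue (\<lambda>x. (cmod (f x))\<^sup>2)"
  by (simp add: L2_def)

lemma mult_le_sum_squares: "a * b \<le> a\<^sup>2 + (b::real)\<^sup>2"
  using sum_squares_bound[of a b] zero_le_power2[of a] zero_le_power2[of b] by linarith

lemma L2_mult_integrable:
  assumes "f \<in> L2" "g \<in> L2"
  shows "integrable lebesgue (\<lambda>x. f x * g x)"
proof (rule Bochner_Integration.integrable_bound)
  show "integrable lebesgue (\<lambda>x. (cmod (f x))\<^sup>2 + (cmod (g x))\<^sup>2)"
    using assms by (intro Bochner_Integration.integrable_add L2_integrable_square)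
  show "(\<lambda>x. f x * g x) \<in> borel_measurable lebesgue"
    using assms by measurable
  show "AE x in lebesgue. norm (f x * g x) \<le> norm ((cmod (f x))\<^sup>2 + (cmod (g x))\<^sup>2)"
    by (simp add: norm_mult mult_le_sum_squares)
qed

lemma L2_bounded_mult:
  assumes "f \<in> L2" "w \<in> borel_measurable lebesgue" "AE x in lebesgue. cmod (w x) \<le> K"
  shows "(\<lambda>x. w x * f x) \<in> L2"
proof -
  have [measurable]: "w \<in> borel_measurable lebesgue" "f \<in> borel_measurable lebesgue"
    using assms by auto
  have "integrable lebesgue (\<lambda>x. (cmod (w x * f x))\<^sup>2)"
  proof (rule Bochner_Integration.integrable_bound)
    show "integrable lebesgue (\<lambda>x. K\<^sup>2 * (cmod (f x))\<^sup>2)"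
      using assms by (intro integrable_mult_right L2_integrable_square)
    show "AE x in lebesgue. norm ((cmod (w x * f x))\<^sup>2) \<le> norm (K\<^sup>2 * (cmod (f x))\<^sup>2)"
      using assms(3)
      by eventually_elim (auto simp: norm_mult power_mult_distrib intro!: mult_right_mono power_mono)
  qed measurable
  thus ?thesis by (simp add: L2_def)
qed

lemma L2_cmult: "f \<in> L2 \<Longrightarrow> (\<lambda>x. c * f x) \<in> L2"
  by (rule L2_bounded_mult[where K = "cmod c"]) auto

lemma L2_add:
  assumes "f \<in> L2" "g \<in> L2"
  shows "(\<lambda>x. f x + g x) \<in> L2"
proof -
  have [measurable]: "g \<in> borel_measurable lebesgue" "f \<in> borel_measurable lebesgue"
    using assms by auto
  have "integrable lebesgue (\<lambda>x. (cmod (f x + g x))\<^sup>2)"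
  proof (rule Bochner_Integration.integrable_bound)
    show "integrable lebesgue (\<lambda>x. 2 * (cmod (f x))\<^sup>2 + 2 * (cmod (g x))\<^sup>2)"
      using assms by (intro Bochner_Integration.integrable_add integrable_mult_right L2_integrable_square)
    have "(cmod (f x + g x))\<^sup>2 \<le> 2 * (cmod (f x))\<^sup>2 + 2 * (cmod (g x))\<^sup>2" for x
    proof -
      have "(cmod (f x + g x))\<^sup>2 \<le> (cmod (f x) + cmod (g x))\<^sup>2"
        by (intro power_mono norm_triangle_ineq) auto
      thus ?thesis using sum_squares_bound[of "cmod (f x)" "cmod (g x)"]
        by (simp add: power2_sum)
    qed
    thus "AE x in lebesgue. norm ((cmod (f x + g x))\<^sup>2)
        \<le> norm (2 * (cmod (f x))\<^sup>2 + 2 * (cmod (g x))\<^sup>2)"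
      by (simp add: abs_of_nonneg)
  qed measurable
  thus ?thesis by (simp add: L2_def)
qed

lemma L2_diff: "f \<in> L2 \<Longrightarrow> g \<in> L2 \<Longrightarrow> (\<lambda>x. f x - g x) \<in> L2"
  using L2_add[of f "\<lambda>x. (-1) * g x"] L2_cmult[of g "-1"] by simp

lemma borel_measurable_cnj [measurable]: "cnj \<in> borel_measurable borel"
  by (intro borel_measurable_continuous_onI continuous_intros)

lemma L2_cnj: "f \<in> L2 \<Longrightarrow> (\<lambda>x. cnj (f x)) \<in> L2"
  using measurable_compose[OF _ borel_measurable_cnj] by (auto simp: L2_def)

lemma bounded_imp_L2:
  fixes f :: "'n::finite cfun"
  assumes "f \<in> borel_measurable lebesgue" "\<And>x. cmod (f x) \<le> M" "bounded {x. f x \<noteq> 0}"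
  shows "f \<in> L2"
proof -
  obtain r where r: "\<And>x. f x \<noteq> 0 \<Longrightarrow> norm x \<le> r"
    using assms(3) unfolding bounded_iff by auto
  have i: "integrable lebesgue (indicat_real (cball (0::real^'n) r))"
    using emeasure_bounded_finite[OF bounded_cball[of "0::real^'n" r]]
    by (intro integrable_real_indicator) (simp_all add: top.not_eq_extremum)
  have "(\<lambda>x. indicator (cball (0::real^'n) r) x :: complex) \<in> L2"
  proof -
    have "(cmod (indicator (cball (0::real^'n) r) x))\<^sup>2 = indicat_real (cball 0 r) x" for x
      by (simp add: indicator_def)
    hence "integrable lebesgue (\<lambda>x. (cmod (indicator (cball (0::real^'n) r) x))\<^sup>2)"
      using i by simp
    thus ?thesis by (simp add: L2_def borel_measurable_indicator)
  qed
  hence "(\<lambda>x. f x * indicator (cball 0 r) x) \<in> L2"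
    by (rule L2_bounded_mult[where K = M]) (use assms in auto)
  moreover have "(\<lambda>x. f x * indicator (cball 0 r) x) = f"
    using r by (auto simp: indicator_def fun_eq_iff)
  ultimately show ?thesis by simp
qed

lemma test_function_L2:
  assumes "\<phi> \<in> test_functions"
  shows "(\<lambda>x. complex_of_real (\<phi> x)) \<in> L2"
proof -
  from assms obtain M where M: "\<And>x. \<bar>\<phi> x\<bar> \<le> M"
    using test_function_bounded by metis
  have [measurable]: "\<phi> \<in> borel_measurable lebesgue"
    using assms by (auto simp: test_functions_iff)
  show ?thesis
    by (rule bounded_imp_L2[where M = M]) (use assms M in \<open>auto simp: test_functions_iff\<close>)
qed

lemma test_function_mult_integrable:
  "\<phi> \<in> test_functions \<Longrightarrow> f \<in> L2 \<Longrightarrow> integrable lebesgue (\<lambda>x. \<phi> x *\<^sub>R f x)"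
  using L2_mult_integrable[OF test_function_L2] by (simp add: scaleR_conv_of_real)

section \<open>The fundamental lemma of the calculus of variations\<close>

lemma sigma_finite_lebesgue: "sigma_finite_measure (lebesgue :: 'a::euclidean_space measure)"
proof
  obtain A :: "'a set set" where "countable A" "A \<subseteq> sets lborel" "\<Union>A = space lborel"
      "\<forall>a\<in>A. emeasure lborel a \<noteq> \<infinity>"
    using lborel.sigma_finite_countable by blast
  thus "\<exists>A. countable A \<and> A \<subseteq> sets (lebesgue :: 'a measure) \<and> \<Union>A = space lebesgue \<and>
      (\<forall>a\<in>A. emeasure lebesgue a \<noteq> \<infinity>)"
    by (intro exI[of _ A]) (simp add: subset_iff sets_completionI_sets)
qed

text \<open>After a cut-off to a box \<open>f\<close> is integrable, and the sets over which its
  integral vanishes form a Dynkin system containing the intersection-stable family of boxes, hence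
  all Borel sets.\<close>

lemma integral_boxes_zero_imp_AE_zero:
  fixes f :: "'a::euclidean_space \<Rightarrow> 'b::{banach, second_countable_topology}"
  assumes int: "\<And>a b. set_integrable lebesgue (box a b) f"
    and zero: "\<And>a b. (LINT x:box a b|lebesgue. f x) = 0"
  shows "AE x in lebesgue. f x = 0"
proof -
  let ?E = "range (\<lambda>(a, b). box a b :: 'a set)"
  interpret lebesgue: sigma_finite_measure "lebesgue :: 'a measure"
    by (rule sigma_finite_lebesgue)
  have *: "AE x in lebesgue. indicat_real (box u v) x *\<^sub>R f x = 0" for u v
  proof (rule lebesgue.density_zero)
    let ?g = "\<lambda>x. indicat_real (box u v) x *\<^sub>R f x"
    show g: "integrable lebesgue ?g"
      using int by (simp add: set_integrable_def)
    have gA: "set_integrable lebesgue A ?g" if "A \<in> sets lebesgue" for A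
      using that integrable_mult_indicator[OF that g] by (simp add: set_integrable_def)
    have borel: "(LINT x:A|lebesgue. ?g x) = 0" if "A \<in> sets borel" for A
    proof -
      have gs: "sigma_sets UNIV ?E = sets (borel :: 'a measure)"
        by (simp add: borel_eq_box)
      have "Int_stable ?E"
        by (auto simp: Int_stable_def box_Int_box)
      moreover have "?E \<subseteq> Pow UNIV" by simp
      moreover have "A \<in> sigma_sets UNIV ?E"
        using that gs by simp
      ultimately show ?thesis
      proof (induction rule: sigma_sets_induct_disjoint)
        case (basic A)
        then obtain a b where "A = box a b" by auto
        then obtain c d where "A \<inter> box u v = box c d"
          unfolding \<open>A = box a b\<close> box_Int_box by blast
        moreover have "(LINT x:A|lebesgue. ?g x) = (LINT x:A \<inter> box u v|lebesgue. f x)"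
          unfolding set_lebesgue_integral_def by (simp add: indicator_inter_arith)
        ultimately show ?case using zero by simp
      next
        case empty
        then show ?case by (simp add: set_lebesgue_integral_def)
      next
        case (compl A)
        have A: "A \<in> sets lebesgue" using compl(1) unfolding gs by auto
        have "(LINT x:UNIV - A|lebesgue. ?g x) = (LINT x|lebesgue. ?g x) - (LINT x:A|lebesgue. ?g x)"
        proof -
          have "indicat_real (UNIV - A) x *\<^sub>R ?g x = ?g x - indicat_real A x *\<^sub>R ?g x" for x
            by (cases "x \<in> A") simp_all
          thus ?thesis
            using g gA[OF A] by (simp add: set_lebesgue_integral_def set_integrable_def)
        qed
        with compl zero[of u v] show ?case by (simp add: set_lebesgue_integral_def)
      next
        case (union A)
        have A: "A i \<in> sets lebesgue" for i using union(2) unfolding gs by auto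
        have "(LINT x:(\<Union>i. A i)|lebesgue. ?g x) = (\<Sum>i. (LINT x:A i|lebesgue. ?g x))"
          using union(1) A
          by (intro lebesgue_integral_countable_add gA) (auto simp: disjoint_family_on_def)
        with union(3) show ?case by simp
      qed
    qed
    show "(LINT x:A|lebesgue. ?g x) = 0" if A: "A \<in> sets lebesgue" for A
    proof -
      \<comment> \<open>A Lebesgue set differs from a Borel set by a null set, which the integral
        does not see.\<close>
      obtain S N N' where S: "A = S \<union> N" "N \<subseteq> N'" "N' \<in> null_sets lborel" "S \<in> sets lborel"
        using sets_completionE[OF A] by metis
      have "AE x in lebesgue. x \<notin> N'"
        using AE_completion[OF AE_not_in[OF S(3)]] .
      hence "AE x in lebesgue. indicat_real A x *\<^sub>R ?g x = indicat_real S x *\<^sub>R ?g x"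
      proof eventually_elim
        case (elim x)
        hence "x \<in> A \<longleftrightarrow> x \<in> S" using S(1,2) by blast
        thus ?case by (simp add: indicator_def)
      qed
      hence "(LINT x:A|lebesgue. ?g x) = (LINT x:S|lebesgue. ?g x)"
        unfolding set_lebesgue_integral_def using gA[OF A] gA[of S] S(4)
        by (intro integral_cong_AE) (simp_all add: set_integrable_def borel_measurable_integrable)
      with borel[of S] S show ?thesis by simp
    qed
  qed
  \<comment> \<open>Countably many boxes exhaust the space, so the exceptional null sets can be
    united.\<close>
  have "AE x in lebesgue. \<forall>n::nat. indicat_real (box (- (real n *\<^sub>R One)) (real n *\<^sub>R One)) x *\<^sub>R f x = 0"
    by (subst AE_all_countable) (use * in blast)
  thus ?thesis
  proof eventually_elim
    case (elim x)
    obtain n :: nat where "x \<in> box (- (real n *\<^sub>R One)) (real n *\<^sub>R One)"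
      using UN_box_eq_UNIV by auto
    with elim show ?case by (auto simp: indicator_def split: if_splits)
  qed
qed

text \<open>For \<open>n > 0\<close> each factor is positive exactly when \<open>x\<close> lies
  strictly on the inner side of one face, so the product lives on the open box and tends to 1 there
  as \<open>n\<close> grows. Differences are spelled as sums so that the closure rules of
  \<open>C_diff\<close> apply literally.\<close>

definition box_bump :: "(real ^ 'n::finite) \<Rightarrow> real ^ 'n \<Rightarrow> nat \<Rightarrow> real ^ 'n \<Rightarrow> real" where
  "box_bump a b n x =
     (\<Prod>i\<in>UNIV. bump 0 (real n * (x $ i + (- (a $ i)))) * bump 0 (real n * (b $ i + (- 1) * (x $ i))))"

lemma box_bump_outside:
  assumes "x \<notin> box a b"
  shows "box_bump a b n x = 0"
proof -
  obtain i where "\<not> (a $ i < x $ i \<and> x $ i < b $ i)"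
    using assms by (auto simp: mem_box_cart)
  hence "bump 0 (real n * (x $ i + (- (a $ i)))) * bump 0 (real n * (b $ i + (- 1) * (x $ i))) = 0"
    by (auto simp: bump_def zero_less_mult_iff)
  thus ?thesis unfolding box_bump_def by (subst prod_zero_iff) auto
qed

lemma box_bump_test_function: "box_bump a b n \<in> test_functions"
proof -
  have "C_diff k (box_bump a b n)" for k
    unfolding box_bump_def[abs_def]
    by (intro C_diff_prod C_diff_mult C_diff_compose[of UNIV bump k _ 0] has_real_derivative_bump
        C_diff_const C_diff_add C_diff_nth) auto
  moreover have "{x. box_bump a b n x \<noteq> 0} \<subseteq> box a b"
    using box_bump_outside by blast
  ultimately show ?thesis
    using bounded_subset[OF bounded_box] by (auto simp: test_functions_iff smooth_def)
qed

lemma box_bump_bounds: "\<bar>box_bump a b n x\<bar> \<le> indicator (box a b) x"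
proof (cases "x \<in> box a b")
  case True
  have "0 \<le> box_bump a b n x" "box_bump a b n x \<le> 1"
    unfolding box_bump_def
    by (auto intro!: prod_nonneg prod_le_1 mult_nonneg_nonneg mult_le_one bump_0_bounds)
  thus ?thesis using True by simp
qed (simp add: box_bump_outside)

lemma box_bump_tendsto: "(\<lambda>n. box_bump a b n x) \<longlonglongrightarrow> indicator (box a b) x"
proof (cases "x \<in> box a b")
  case True
  have *: "(\<lambda>n. bump 0 (real n * t)) \<longlonglongrightarrow> 1" if "t > 0" for t
    using bump_0_scaled_tendsto[of t] that by simp
  have "(\<lambda>n. box_bump a b n x) \<longlonglongrightarrow> (\<Prod>i\<in>(UNIV::'a set). 1 * 1)"
    unfolding box_bump_def
    by (intro tendsto_prod tendsto_mult *) (use True in \<open>simp_all add: mem_box_cart\<close>)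
  thus ?thesis using True by simp
qed (simp add: box_bump_outside)

text \<open>Testing with \<open>box_bump a b n\<close> and dominated convergence make the integral
  of \<open>g\<close> over every box vanish, and these integrals determine \<open>g\<close> almost
  everywhere.\<close>

lemma fundamental_lemma:
  assumes g: "g \<in> L2" and 0: "\<And>\<phi>. \<phi> \<in> test_functions \<Longrightarrow> (LINT x|lebesgue. \<phi> x *\<^sub>R g x) = 0"
  shows "AE x in lebesgue. g x = 0"
proof (rule integral_boxes_zero_imp_AE_zero)
  fix a b :: "real ^ 'a"
  have "(\<lambda>x. indicator (box a b) x :: complex) \<in> L2"
  proof (rule bounded_imp_L2[where M = 1])
    show "(\<lambda>x. indicator (box a b) x :: complex) \<in> borel_measurable lebesgue"
      by (intro borel_measurable_indicator) simp
  qed (auto simp: indicator_def)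
  hence "integrable lebesgue (\<lambda>x. indicator (box a b) x * g x)"
    using L2_mult_integrable g by blast
  moreover have "(\<lambda>x. indicator (box a b) x * g x) = (\<lambda>x. indicat_real (box a b) x *\<^sub>R g x)"
    by (auto simp: indicator_def)
  ultimately have i: "integrable lebesgue (\<lambda>x. indicat_real (box a b) x *\<^sub>R g x)"
    by simp
  thus "set_integrable lebesgue (box a b) g"
    by (simp add: set_integrable_def)
  have m: "box_bump a b n \<in> borel_measurable lebesgue" for n
    by (intro smooth_measurable test_function_smooth box_bump_test_function)
  have "(\<lambda>n. LINT x|lebesgue. box_bump a b n x *\<^sub>R g x)
      \<longlonglongrightarrow> (LINT x|lebesgue. indicat_real (box a b) x *\<^sub>R g x)"
  proof (rule integral_dominated_convergence)
    show "integrable lebesgue (\<lambda>x. norm (indicat_real (box a b) x *\<^sub>R g x))"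
      using i by (rule integrable_norm)
    show "AE x in lebesgue. norm (box_bump a b n x *\<^sub>R g x) \<le> norm (indicat_real (box a b) x *\<^sub>R g x)" for n
      using box_bump_bounds[of a b n] by (auto intro!: mult_right_mono)
    show "AE x in lebesgue. (\<lambda>n. box_bump a b n x *\<^sub>R g x) \<longlonglongrightarrow> indicat_real (box a b) x *\<^sub>R g x"
      by (intro AE_I2 tendsto_scaleR box_bump_tendsto tendsto_const)
    show "(\<lambda>x. indicat_real (box a b) x *\<^sub>R g x) \<in> borel_measurable lebesgue"
      using i by (rule borel_measurable_integrable)
    show "(\<lambda>x. box_bump a b n x *\<^sub>R g x) \<in> borel_measurable lebesgue" for n
      by (intro borel_measurable_scaleR m L2_measurable g)
  qed
  moreover have "(LINT x|lebesgue. box_bump a b n x *\<^sub>R g x) = 0" for n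
    by (rule 0[OF box_bump_test_function])
  ultimately show "(LINT x:box a b|lebesgue. g x) = 0"
    by (simp add: set_lebesgue_integral_def LIMSEQ_const_iff)
qed

section \<open>Integration by parts\<close>

lemma has_real_derivative_along_axis:
  assumes "\<And>x. \<psi> differentiable (at x)"
  shows "((\<lambda>t. \<psi> (x + t *\<^sub>R axis i 1)) has_real_derivative partial_deriv i \<psi> (x + t *\<^sub>R axis i 1)) (at t)"
proof -
  let ?y = "x + t *\<^sub>R axis i 1"
  obtain D where D: "(\<psi> has_derivative D) (at ?y)"
    using assms by (auto simp: differentiable_def)
  have "((\<lambda>t. x + t *\<^sub>R axis i 1) has_derivative (\<lambda>h. h *\<^sub>R axis i 1)) (at t)"
    by (auto intro!: derivative_eq_intros)
  hence "((\<lambda>t. \<psi> (x + t *\<^sub>R axis i 1)) has_derivative (\<lambda>h. D (h *\<^sub>R axis i 1))) (at t)"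
    using has_derivative_compose D by blast
  moreover have "(\<lambda>h. D (h *\<^sub>R axis i 1)) = (*) (D (axis i 1))"
    using linear_scale[OF has_derivative_linear[OF D]] by (auto simp: fun_eq_iff mult.commute)
  ultimately show ?thesis
    by (simp add: has_field_derivative_def partial_deriv_eqI[OF D])
qed

text \<open>Instead of iterated integrals: each difference quotient has integral zero by translation
  invariance of Lebesgue measure, and the quotients converge to the partial derivative, dominated by
  a multiple of the indicator of a ball.\<close>

lemma integral_partial_deriv_eq_0:
  fixes \<psi> :: "real ^ 'n::finite \<Rightarrow> real"
  assumes \<psi>: "\<psi> \<in> test_functions"
  shows "(LINT x|lebesgue. partial_deriv i \<psi> x) = 0"
proof -
  let ?e = "axis i 1 :: real ^ 'n"
  let ?h = "\<lambda>n. inverse (real (Suc n))"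
  let ?s = "\<lambda>n x. (\<psi> (?h n *\<^sub>R ?e + x) - \<psi> x) / ?h n"
  note d = has_real_derivative_along_axis[OF smooth_differentiable[OF test_function_smooth[OF \<psi>]]]
  obtain r where r: "\<And>x. \<psi> x \<noteq> 0 \<Longrightarrow> norm x \<le> r"
    using \<psi> unfolding test_functions_iff bounded_iff by auto
  obtain M where M: "M \<ge> 0" "\<And>x. \<bar>partial_deriv i \<psi> x\<bar> \<le> M"
    using test_function_bounded[OF test_function_partial_deriv[OF \<psi>]] by metis
  have m: "\<psi> \<in> borel_measurable borel" "partial_deriv i \<psi> \<in> borel_measurable borel"
    using \<psi> by (auto intro!: smooth_measurable_borel test_function_smooth test_function_partial_deriv)
  have ms: "(\<lambda>x. \<psi> (c + x)) \<in> borel_measurable borel" for c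
    using m(1) by (intro measurable_compose[OF _ m(1)]) simp
  have "(\<lambda>n. LINT x|lborel. ?s n x) \<longlonglongrightarrow> (LINT x|lborel. partial_deriv i \<psi> x)"
  proof (rule integral_dominated_convergence)
    \<comment> \<open>The mean value theorem bounds the quotients by \<open>M\<close>; the shifts
      have length at most 1, which enlarges the radius from \<open>r\<close> to
      \<open>r + 1\<close>.\<close>
    show "integrable lborel (\<lambda>x. M * indicator (cball (0::real^'n) (r + 1)) x)"
      using emeasure_bounded_finite[OF bounded_cball[of "0::real^'n" "r + 1"]]
      by (intro integrable_mult_right integrable_real_indicator) (simp_all add: top.not_eq_extremum)
    show "AE x in lborel. norm (?s n x) \<le> M * indicator (cball (0::real^'n) (r + 1)) x" for n
    proof (rule AE_I2)
      fix x
      show "norm (?s n x) \<le> M * indicator (cball (0::real^'n) (r + 1)) x"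
      proof (cases "norm x \<le> r + 1")
        case True
        obtain z where "\<psi> (x + ?h n *\<^sub>R ?e) - \<psi> (x + 0 *\<^sub>R ?e)
            = (?h n - 0) * partial_deriv i \<psi> (x + z *\<^sub>R ?e)"
          using MVT2[of 0 "?h n" "\<lambda>t. \<psi> (x + t *\<^sub>R ?e)" "\<lambda>t. partial_deriv i \<psi> (x + t *\<^sub>R ?e)"] d
          by auto
        hence "?s n x = partial_deriv i \<psi> (x + z *\<^sub>R ?e)"
          by (simp add: add.commute)
        thus ?thesis using True M by simp
      next
        case False
        have "norm (?h n *\<^sub>R ?e) \<le> 1"
          by (simp add: norm_axis_1 inverse_le_1_iff)
        hence "norm (?h n *\<^sub>R ?e + x) > r"
          using False norm_triangle_ineq4[of "?h n *\<^sub>R ?e + x" "?h n *\<^sub>R ?e"] by simp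
        hence "\<psi> (?h n *\<^sub>R ?e + x) = 0" "\<psi> x = 0"
          using r[of "?h n *\<^sub>R ?e + x"] r[of x] False by linarith+
        thus ?thesis using M by simp
      qed
    qed
    show "AE x in lborel. (\<lambda>n. ?s n x) \<longlonglongrightarrow> partial_deriv i \<psi> x"
    proof (rule AE_I2)
      fix x
      have "((\<lambda>h. (\<psi> (x + h *\<^sub>R ?e) - \<psi> x) / h) \<longlongrightarrow> partial_deriv i \<psi> x) (at 0)"
        using d[of x i 0] by (simp add: DERIV_def)
      moreover have "filterlim ?h (at 0) sequentially"
        using LIMSEQ_inverse_real_of_nat by (auto simp: filterlim_at)
      ultimately show "(\<lambda>n. ?s n x) \<longlonglongrightarrow> partial_deriv i \<psi> x"
        using filterlim_compose[of "\<lambda>h. (\<psi> (x + h *\<^sub>R ?e) - \<psi> x) / h"] by (simp add: add.commute)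
    qed
    show "?s n \<in> borel_measurable lborel" for n
      using ms[of "?h n *\<^sub>R ?e"] m(1) by simp
    show "partial_deriv i \<psi> \<in> borel_measurable lborel"
      using m(2) by simp
  qed
  moreover have "(LINT x|lborel. ?s n x) = 0" for n
  proof -
    have i: "integrable lborel \<psi>"
    proof -
      obtain K where K: "K \<ge> 0" "\<And>x. \<bar>\<psi> x\<bar> \<le> K"
        using test_function_bounded[OF \<psi>] by metis
      have "integrable lborel (\<lambda>x. K * indicator (cball (0::real^'n) r) x)"
        using emeasure_bounded_finite[OF bounded_cball[of "0::real^'n" "r"]]
        by (intro integrable_mult_right integrable_real_indicator) (simp_all add: top.not_eq_extremum)
      thus ?thesis
      proof (rule Bochner_Integration.integrable_bound)
        have "norm (\<psi> x) \<le> norm (K * indicat_real (cball (0::real^'n) r) x)" for x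
          using K r[of x] by (cases "\<psi> x = 0") (auto simp: indicator_def)
        thus "AE x in lborel. norm (\<psi> x) \<le> norm (K * indicat_real (cball (0::real^'n) r) x)" by simp
      qed (use m in simp)
    qed
    have "integrable (distr lborel borel ((+) (?h n *\<^sub>R ?e))) \<psi>"
      using i by (simp add: lborel_distr_plus)
    hence i': "integrable lborel (\<lambda>x. \<psi> (?h n *\<^sub>R ?e + x))"
      by (rule integrable_distr[rotated]) simp
    have "(LINT x|distr lborel borel ((+) (?h n *\<^sub>R ?e)). \<psi> x) = (LINT x|lborel. \<psi> (?h n *\<^sub>R ?e + x))"
      using m by (intro integral_distr) auto
    thus ?thesis using i i' by (simp add: lborel_distr_plus)
  qed
  ultimately have "(LINT x|lborel. partial_deriv i \<psi> x) = 0"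
    by (simp add: LIMSEQ_const_iff)
  thus ?thesis using m by (simp add: integral_completion)
qed

section \<open>Weak derivatives\<close>

lemma has_weak_deriv_unique:
  assumes "f \<in> L2" "g \<in> L2" "has_weak_deriv i u f" "has_weak_deriv i u g"
  shows "AE x in lebesgue. f x = g x"
proof -
  have "AE x in lebesgue. f x - g x = 0"
  proof (rule fundamental_lemma)
    show "(\<lambda>x. f x - g x) \<in> L2" using assms L2_diff by blast
    fix \<phi> :: "real ^ 'a \<Rightarrow> real" assume \<phi>: "\<phi> \<in> test_functions"
    hence "(LINT x|lebesgue. \<phi> x *\<^sub>R f x) = (LINT x|lebesgue. \<phi> x *\<^sub>R g x)"
      using assms(3,4) unfolding has_weak_deriv_def by (metis minus_minus)
    thus "(LINT x|lebesgue. \<phi> x *\<^sub>R (f x - g x)) = 0"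
      using test_function_mult_integrable[OF \<phi>] assms
      by (simp add: scaleR_diff_right)
  qed
  thus ?thesis by simp
qed

lemma weak_deriv:
  assumes "u \<in> W12"
  shows weak_deriv_L2: "weak_deriv i u \<in> L2"
    and has_weak_deriv_weak_deriv: "has_weak_deriv i u (weak_deriv i u)"
proof -
  have "\<exists>g. g \<in> L2 \<and> has_weak_deriv i u g"
    using assms by (auto simp: W12_def)
  hence "weak_deriv i u \<in> L2 \<and> has_weak_deriv i u (weak_deriv i u)"
    unfolding weak_deriv_def by (rule someI_ex)
  thus "weak_deriv i u \<in> L2" "has_weak_deriv i u (weak_deriv i u)" by auto
qed

text \<open>\<open>weak_deriv\<close> is an arbitrary choice; uniqueness lets any explicit candidate
  stand in for it almost everywhere.\<close>

lemma weak_deriv_eqI: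
  assumes "g \<in> L2" "has_weak_deriv i u g"
  shows "AE x in lebesgue. weak_deriv i u x = g x"
proof -
  have "weak_deriv i u \<in> L2 \<and> has_weak_deriv i u (weak_deriv i u)"
    unfolding weak_deriv_def by (rule someI[of _ g]) (use assms in auto)
  thus ?thesis using has_weak_deriv_unique assms by blast
qed

lemma W12_L2: "u \<in> W12 \<Longrightarrow> u \<in> L2"
  by (simp add: W12_def)

text \<open>The product of a test function with \<eta> is again a test function, so the weak
  derivative of \<open>u\<close> can be tested with it; the product rule then moves the term with
  the derivative of \<eta> to the other side.\<close>

lemma has_weak_deriv_mult:
  assumes u: "u \<in> L2" "g \<in> L2" "has_weak_deriv i u g" and \<eta>: "smooth \<eta>"
  shows "has_weak_deriv i (\<lambda>x. of_real (\<eta> x) * u x)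
           (\<lambda>x. of_real (\<eta> x) * g x + of_real (partial_deriv i \<eta> x) * u x)"
  unfolding has_weak_deriv_def
proof
  fix \<phi> :: "real ^ 'a \<Rightarrow> real" assume \<phi>: "\<phi> \<in> test_functions"
  let ?P = "partial_deriv i"
  have t: "(\<lambda>x. \<phi> x * \<eta> x) \<in> test_functions" "(\<lambda>x. \<phi> x * ?P \<eta> x) \<in> test_functions"
    using \<phi> \<eta> by (auto intro: test_function_mult smooth_partial_deriv)
  have t2: "?P (\<lambda>x. \<phi> x * \<eta> x) \<in> test_functions"
    by (rule test_function_partial_deriv[OF t(1)])
  have P: "?P (\<lambda>x. \<phi> x * \<eta> x) x = \<phi> x * ?P \<eta> x + ?P \<phi> x * \<eta> x" for x
    by (intro partial_deriv_mult smooth_differentiable test_function_smooth[OF \<phi>] \<eta>)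
  have "?P \<phi> x *\<^sub>R (of_real (\<eta> x) * u x)
      = ?P (\<lambda>x. \<phi> x * \<eta> x) x *\<^sub>R u x - (\<phi> x * ?P \<eta> x) *\<^sub>R u x" for x
    unfolding P by (simp add: scaleR_conv_of_real algebra_simps)
  hence "(LINT x|lebesgue. ?P \<phi> x *\<^sub>R (of_real (\<eta> x) * u x))
      = (LINT x|lebesgue. ?P (\<lambda>x. \<phi> x * \<eta> x) x *\<^sub>R u x) - (LINT x|lebesgue. (\<phi> x * ?P \<eta> x) *\<^sub>R u x)"
    using test_function_mult_integrable[OF t2 u(1)] test_function_mult_integrable[OF t(2) u(1)] by simp
  also have "(LINT x|lebesgue. ?P (\<lambda>x. \<phi> x * \<eta> x) x *\<^sub>R u x)
      = - (LINT x|lebesgue. (\<phi> x * \<eta> x) *\<^sub>R g x)"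
    using u(3) t(1) by (simp add: has_weak_deriv_def)
  also have "- (LINT x|lebesgue. (\<phi> x * \<eta> x) *\<^sub>R g x) - (LINT x|lebesgue. (\<phi> x * ?P \<eta> x) *\<^sub>R u x)
      = - (LINT x|lebesgue. (\<phi> x * \<eta> x) *\<^sub>R g x + (\<phi> x * ?P \<eta> x) *\<^sub>R u x)"
    using test_function_mult_integrable[OF t(1) u(2)] test_function_mult_integrable[OF t(2) u(1)] by simp
  also have "(\<lambda>x. (\<phi> x * \<eta> x) *\<^sub>R g x + (\<phi> x * ?P \<eta> x) *\<^sub>R u x)
      = (\<lambda>x. \<phi> x *\<^sub>R (of_real (\<eta> x) * g x + of_real (?P \<eta> x) * u x))"
    by (simp add: scaleR_conv_of_real algebra_simps)
  finally show "(LINT x|lebesgue. ?P \<phi> x *\<^sub>R (of_real (\<eta> x) * u x))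
      = - (LINT x|lebesgue. \<phi> x *\<^sub>R (of_real (\<eta> x) * g x + of_real (?P \<eta> x) * u x))" .
qed

text \<open>The derivative of the test function \<phi> \<eta> integrates to zero, which is
  integration by parts without boundary terms.\<close>

lemma has_weak_deriv_smooth:
  assumes \<eta>: "smooth \<eta>" "(\<lambda>x. of_real (\<eta> x)) \<in> L2" "(\<lambda>x. of_real (partial_deriv i \<eta> x)) \<in> L2"
  shows "has_weak_deriv i (\<lambda>x. of_real (\<eta> x)) (\<lambda>x. of_real (partial_deriv i \<eta> x))"
  unfolding has_weak_deriv_def
proof
  fix \<phi> :: "real ^ 'a \<Rightarrow> real" assume \<phi>: "\<phi> \<in> test_functions"
  let ?P = "partial_deriv i"
  have t: "(\<lambda>x. \<phi> x * \<eta> x) \<in> test_functions"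
    using \<phi> \<eta> by (auto intro: test_function_mult)
  have P: "?P (\<lambda>x. \<phi> x * \<eta> x) x = \<phi> x * ?P \<eta> x + ?P \<phi> x * \<eta> x" for x
    by (intro partial_deriv_mult smooth_differentiable test_function_smooth[OF \<phi>] \<eta>)
  have i: "integrable lebesgue (\<lambda>x. \<phi> x *\<^sub>R complex_of_real (?P \<eta> x))"
      "integrable lebesgue (\<lambda>x. ?P \<phi> x *\<^sub>R complex_of_real (\<eta> x))"
    using test_function_mult_integrable \<phi> \<eta> test_function_partial_deriv by blast+
  have "0 = complex_of_real (LINT x|lebesgue. ?P (\<lambda>x. \<phi> x * \<eta> x) x)"
    using integral_partial_deriv_eq_0[OF t] by simp
  also have "\<dots> = (LINT x|lebesgue. complex_of_real (?P (\<lambda>x. \<phi> x * \<eta> x) x))"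
    by simp
  also have "(\<lambda>x. complex_of_real (?P (\<lambda>x. \<phi> x * \<eta> x) x))
      = (\<lambda>x. \<phi> x *\<^sub>R complex_of_real (?P \<eta> x) + ?P \<phi> x *\<^sub>R complex_of_real (\<eta> x))"
    by (simp add: P scaleR_conv_of_real)
  also have "(LINT x|lebesgue. \<dots> x)
      = (LINT x|lebesgue. \<phi> x *\<^sub>R complex_of_real (?P \<eta> x)) + (LINT x|lebesgue. ?P \<phi> x *\<^sub>R complex_of_real (\<eta> x))"
    using i by (rule Bochner_Integration.integral_add)
  finally show "(LINT x|lebesgue. ?P \<phi> x *\<^sub>R complex_of_real (\<eta> x))
      = - (LINT x|lebesgue. \<phi> x *\<^sub>R complex_of_real (?P \<eta> x))"
    by (simp add: eq_neg_iff_add_eq_0 add.commute)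
qed

text \<open>This makes the weighted solution admissible as a test element of the form. One constant
  \<open>K\<close> serves for the multiplier and all its partial derivatives.\<close>

lemma W12_mult:
  assumes u: "u \<in> W12" and \<eta>: "smooth \<eta>" "\<And>x. \<bar>\<eta> x\<bar> \<le> K" "\<And>i x. \<bar>partial_deriv i \<eta> x\<bar> \<le> K"
  shows "(\<lambda>x. of_real (\<eta> x) * u x) \<in> W12"
    and "AE x in lebesgue. weak_deriv i (\<lambda>x. of_real (\<eta> x) * u x) x
           = of_real (\<eta> x) * weak_deriv i u x + of_real (partial_deriv i \<eta> x) * u x"
proof -
  let ?g = "\<lambda>i x. of_real (\<eta> x) * weak_deriv i u x + of_real (partial_deriv i \<eta> x) * u x"
  have m: "(\<lambda>x. complex_of_real (\<eta> x)) \<in> borel_measurable lebesgue"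
      "(\<lambda>x. complex_of_real (partial_deriv i \<eta> x)) \<in> borel_measurable lebesgue" for i
    using smooth_measurable[OF \<eta>(1)] smooth_measurable[OF smooth_partial_deriv[OF \<eta>(1), of i]]
    by (simp_all add: borel_measurable_of_real)
  have L: "(\<lambda>x. of_real (\<eta> x) * u x) \<in> L2"
    by (rule L2_bounded_mult[where K = K]) (use W12_L2[OF u] m \<eta> in auto)
  have g: "?g i \<in> L2" for i
    by (intro L2_add L2_bounded_mult[where K = K] weak_deriv_L2 W12_L2 m u) (use \<eta> in auto)
  have h: "has_weak_deriv i (\<lambda>x. of_real (\<eta> x) * u x) (?g i)" for i
    by (intro has_weak_deriv_mult W12_L2 weak_deriv_L2 has_weak_deriv_weak_deriv u \<eta>)
  show "(\<lambda>x. of_real (\<eta> x) * u x) \<in> W12"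
    using L g h by (auto simp: W12_def)
  show "AE x in lebesgue. weak_deriv i (\<lambda>x. of_real (\<eta> x) * u x) x = ?g i x"
    by (rule weak_deriv_eqI[OF g h])
qed

lemma W12_smooth:
  assumes "smooth \<eta>" "(\<lambda>x. of_real (\<eta> x)) \<in> L2" "\<And>i. (\<lambda>x. of_real (partial_deriv i \<eta> x)) \<in> L2"
  shows "(\<lambda>x. of_real (\<eta> x)) \<in> W12"
    and "AE x in lebesgue. weak_deriv i (\<lambda>x. of_real (\<eta> x)) x = of_real (partial_deriv i \<eta> x)"
proof -
  have h: "has_weak_deriv i (\<lambda>x. of_real (\<eta> x)) (\<lambda>x. of_real (partial_deriv i \<eta> x))" for i
    by (rule has_weak_deriv_smooth) (use assms in auto)
  show "(\<lambda>x. of_real (\<eta> x)) \<in> W12"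
    using assms h by (auto simp: W12_def)
  show "AE x in lebesgue. weak_deriv i (\<lambda>x. of_real (\<eta> x)) x = of_real (partial_deriv i \<eta> x)"
    by (rule weak_deriv_eqI[OF assms(3) h])
qed

section \<open>Polynomial weights\<close>

text \<open>This is \<open>\<chi>\<^sub>\<delta>\<close>, and \<open>decay m 1\<close> is
  \<open>G\<close>. The squared norm is written as a sum of products, to which the closure rules of
  \<open>C_diff\<close> apply; \<open>decay_alt\<close> restores the inner product.\<close>

definition decay :: "nat \<Rightarrow> real \<Rightarrow> (real ^ 'n::finite) \<Rightarrow> real" where
  "decay m \<delta> x = inverse (1 + \<delta> * (\<Sum>i\<in>UNIV. x $ i * x $ i)) ^ m"

text \<open>This is the weight \<open>W\<^sub>\<delta>\<close>, the quotient of
  \<open>decay m \<delta>\<close> by \<open>decay m 1\<close>. It is bounded for each fixed \<delta>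
  in (0, 1], which allows it as a multiplier on \<open>W12\<close>.\<close>

definition growth :: "nat \<Rightarrow> real \<Rightarrow> (real ^ 'n::finite) \<Rightarrow> real" where
  "growth m \<delta> x = (1 + (\<Sum>i\<in>UNIV. x $ i * x $ i)) ^ m * decay m \<delta> x"

lemma sum_nth_sq: "(\<Sum>i\<in>UNIV. x $ i * x $ i) = x \<bullet> (x :: real ^ 'n::finite)"
  by (simp add: inner_vec_def)

lemma decay_alt: "decay m \<delta> x = inverse (1 + \<delta> * (x \<bullet> x)) ^ m"
  by (simp add: decay_def sum_nth_sq)

lemma growth_alt: "growth m \<delta> x = ((1 + x \<bullet> x) * inverse (1 + \<delta> * (x \<bullet> x))) ^ m"
  by (simp add: growth_def decay_alt sum_nth_sq power_mult_distrib)

lemma one_plus_pos: "\<delta> \<ge> 0 \<Longrightarrow> 1 + \<delta> * (x \<bullet> x) > 0"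
  by (simp add: add_pos_nonneg)

lemma decay_pos: "\<delta> \<ge> 0 \<Longrightarrow> decay m \<delta> x > 0"
  by (simp add: decay_alt one_plus_pos)

lemma decay_nonneg: "\<delta> \<ge> 0 \<Longrightarrow> decay m \<delta> x \<ge> 0"
  by (rule less_imp_le[OF decay_pos])

lemma decay_le_1: "\<delta> \<ge> 0 \<Longrightarrow> decay m \<delta> x \<le> 1"
  by (simp add: decay_alt power_le_one inverse_le_1_iff)

lemma smooth_decay: "\<delta> \<ge> 0 \<Longrightarrow> smooth (decay m \<delta>)"
  unfolding smooth_def decay_def[abs_def]
  by (intro allI C_diff_power C_diff_inverse C_diff_add C_diff_mult C_diff_sum C_diff_const C_diff_nth)
    (simp add: sum_nth_sq one_plus_pos)

lemma smooth_growth: "\<delta> \<ge> 0 \<Longrightarrow> smooth (growth m \<delta>)"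
proof -
  assume "\<delta> \<ge> 0"
  have "smooth (\<lambda>x :: real ^ 'a. (1 + (\<Sum>i\<in>UNIV. x $ i * x $ i)) ^ m)"
    unfolding smooth_def
    by (intro allI C_diff_power C_diff_add C_diff_mult C_diff_sum C_diff_const C_diff_nth)
  thus ?thesis unfolding growth_def[abs_def] using smooth_decay[OF \<open>\<delta> \<ge> 0\<close>] by (rule smooth_mult)
qed

section \<open>Logarithmic gradients of the weights\<close>

lemma has_real_derivative_power_log:
  assumes "(f has_real_derivative f') (at t)" "f t \<noteq> 0"
  shows "((\<lambda>t. f t ^ m) has_real_derivative f t ^ m * (real m * f' / f t)) (at t)"
  using DERIV_power[OF assms(1), of m] assms(2)
  by (cases m) (auto simp: mult_ac)

lemma partial_deriv_radial:
  assumes "(f has_real_derivative f') (at (x \<bullet> x))"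
  shows "partial_deriv i (\<lambda>x. f (x \<bullet> x)) x = f' * (2 * x $ i)"
proof -
  have "((\<lambda>x :: real ^ 'a. x \<bullet> x) has_derivative (\<lambda>h. x \<bullet> h + h \<bullet> x)) (at x)"
    by (intro has_derivative_inner has_derivative_ident)
  hence p: "partial_deriv i (\<lambda>x. x \<bullet> x) x = 2 * x $ i" and d: "(\<lambda>x. x \<bullet> x) differentiable (at x)"
    by (auto simp: partial_deriv_eqI inner_axis inner_commute differentiable_def)
  show ?thesis using partial_deriv_compose[OF d assms, of i] p by simp
qed

text \<open>The gradient of the logarithm of \<open>decay m \<delta>\<close>. Gradients are measured
  relative to the weight because the estimates rest on bounds of the form |grad w| \<le> c
  w.\<close>

definition decay_log_grad :: "nat \<Rightarrow> real \<Rightarrow> (real ^ 'n::finite) \<Rightarrow> real ^ 'n" where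
  "decay_log_grad m \<delta> x = (- (2 * real m * \<delta> / (1 + \<delta> * (x \<bullet> x)))) *\<^sub>R x"

text \<open>The gradient of m log ((1 + t) / (1 + \<delta> t)) with t = |x|^2, simplified by (1 +
  \<delta> t) - \<delta> (1 + t) = 1 - \<delta>.\<close>

definition growth_log_grad :: "nat \<Rightarrow> real \<Rightarrow> (real ^ 'n::finite) \<Rightarrow> real ^ 'n" where
  "growth_log_grad m \<delta> x =
     (2 * real m * (1 - \<delta>) / ((1 + x \<bullet> x) * (1 + \<delta> * (x \<bullet> x)))) *\<^sub>R x"

lemma partial_deriv_decay:
  assumes "\<delta> \<ge> 0"
  shows "partial_deriv i (decay m \<delta>) x = decay m \<delta> x * decay_log_grad m \<delta> x $ i"
proof -
  let ?t = "x \<bullet> x"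
  note p = one_plus_pos[OF assms, of x]
  have "((\<lambda>t. inverse (1 + \<delta> * t)) has_real_derivative - (\<delta> * (inverse (1 + \<delta> * ?t))\<^sup>2)) (at ?t)"
    using p by (auto intro!: derivative_eq_intros simp: power2_eq_square)
  from has_real_derivative_power_log[OF this, of m]
  have "((\<lambda>t. inverse (1 + \<delta> * t) ^ m) has_real_derivative inverse (1 + \<delta> * ?t) ^ m *
      (real m * - (\<delta> * (inverse (1 + \<delta> * ?t))\<^sup>2) / inverse (1 + \<delta> * ?t))) (at ?t)"
    using p by simp
  moreover have "real m * - (\<delta> * (inverse (1 + \<delta> * ?t))\<^sup>2) / inverse (1 + \<delta> * ?t)
      = - (real m * \<delta> / (1 + \<delta> * ?t))"
    using p by (simp add: divide_simps power2_eq_square)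
  ultimately have "((\<lambda>t. inverse (1 + \<delta> * t) ^ m) has_real_derivative
      inverse (1 + \<delta> * ?t) ^ m * - (real m * \<delta> / (1 + \<delta> * ?t))) (at ?t)"
    by (metis times_divide_eq_right)
  from partial_deriv_radial[OF this, of i] show ?thesis
    by (simp add: decay_alt[abs_def] decay_log_grad_def)
qed

lemma partial_deriv_growth:
  assumes "\<delta> \<ge> 0"
  shows "partial_deriv i (growth m \<delta>) x = growth m \<delta> x * growth_log_grad m \<delta> x $ i"
proof -
  let ?t = "x \<bullet> x"
  note p = one_plus_pos[OF assms, of x]
  have t: "1 + ?t > 0" by (simp add: add_pos_nonneg)
  have "((\<lambda>t. (1 + t) * inverse (1 + \<delta> * t)) has_real_derivative
      (1 - \<delta>) * (inverse (1 + \<delta> * ?t))\<^sup>2) (at ?t)"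
    using p by (auto intro!: derivative_eq_intros simp: field_simps power2_eq_square)
  from has_real_derivative_power_log[OF this, of m]
  have *: "((\<lambda>t. ((1 + t) * inverse (1 + \<delta> * t)) ^ m) has_real_derivative
      ((1 + ?t) * inverse (1 + \<delta> * ?t)) ^ m *
      (real m * ((1 - \<delta>) * (inverse (1 + \<delta> * ?t))\<^sup>2) / ((1 + ?t) * inverse (1 + \<delta> * ?t)))) (at ?t)"
    using p t by simp
  have "real m * ((1 - \<delta>) * (inverse (1 + \<delta> * ?t))\<^sup>2) / ((1 + ?t) * inverse (1 + \<delta> * ?t))
      = real m * (1 - \<delta>) / ((1 + ?t) * (1 + \<delta> * ?t))"
    using p t by (simp add: divide_simps power2_eq_square)
  with * partial_deriv_radial[of "\<lambda>t. ((1 + t) * inverse (1 + \<delta> * t)) ^ m" _ x i] show ?thesis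
    by (simp add: growth_alt[abs_def] growth_log_grad_def)
qed

lemma four_mult_le_sq: "4 * t \<le> (1 + t :: real)\<^sup>2"
proof -
  have "0 \<le> (1 - t)\<^sup>2" by simp
  thus ?thesis by (simp add: power2_eq_square algebra_simps)
qed

text \<open>With s = \<delta> |x|^2 the squared norm is m^2 \<delta> times 4 s / (1 + s)^2, and the
  last factor is at most 1. The surviving \<delta> makes the flux through the cut-off vanish in the
  limit.\<close>

lemma decay_log_grad_bound:
  assumes "\<delta> \<ge> 0"
  shows "(norm (decay_log_grad m \<delta> x))\<^sup>2 \<le> (real m)\<^sup>2 * \<delta>"
proof -
  note p = one_plus_pos[OF assms, of x]
  have "(norm (decay_log_grad m \<delta> x))\<^sup>2
      = (real m)\<^sup>2 * \<delta> * (4 * (\<delta> * (x \<bullet> x)) / (1 + \<delta> * (x \<bullet> x))\<^sup>2)"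
    unfolding decay_log_grad_def norm_scaleR power_mult_distrib power2_norm_eq_inner power2_abs
    by (simp add: power_divide power_mult_distrib power2_eq_square mult_ac)
  also have "\<dots> \<le> (real m)\<^sup>2 * \<delta> * 1"
    using assms p four_mult_le_sq[of "\<delta> * (x \<bullet> x)"] by (intro mult_left_mono) (auto simp: divide_simps)
  finally show ?thesis by simp
qed

text \<open>The factor (1 - \<delta>) / (1 + \<delta> |x|^2) is at most 1 and the remaining one is
  again of the form 4 t / (1 + t)^2. The bound is free of \<delta>, so one \<kappa> works for all
  weights.\<close>

lemma growth_log_grad_bound:
  assumes "0 \<le> \<delta>" "\<delta> \<le> 1"
  shows "(norm (growth_log_grad m \<delta> x))\<^sup>2 \<le> (real m)\<^sup>2"
proof -
  note p = one_plus_pos[OF assms(1), of x]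
  have "\<bar>(1 - \<delta>) / (1 + \<delta> * (x \<bullet> x))\<bar> \<le> 1"
  proof -
    have "1 - \<delta> \<le> 1 + \<delta> * (x \<bullet> x)"
      using mult_nonneg_nonneg[OF assms(1) inner_ge_zero[of x]] assms by linarith
    thus ?thesis using p assms by (simp add: abs_divide)
  qed
  hence le: "((1 - \<delta>) / (1 + \<delta> * (x \<bullet> x)))\<^sup>2 \<le> 1"
    by (simp add: abs_square_le_1)
  have "(norm (growth_log_grad m \<delta> x))\<^sup>2
      = (real m)\<^sup>2 * (((1 - \<delta>) / (1 + \<delta> * (x \<bullet> x)))\<^sup>2 * (4 * (x \<bullet> x) / (1 + x \<bullet> x)\<^sup>2))"
    unfolding growth_log_grad_def norm_scaleR power_mult_distrib power2_norm_eq_inner power2_abs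
    by (simp add: power_divide power_mult_distrib power2_eq_square mult_ac) (auto simp: algebra_simps)
  also have "\<dots> \<le> (real m)\<^sup>2 * (1 * 1)"
    using four_mult_le_sq[of "x \<bullet> x"] le
    by (intro mult_left_mono mult_mono) (auto simp: divide_simps add_pos_nonneg)
  finally show ?thesis by simp
qed

section \<open>Size and integrability of the weights\<close>

lemma ratio_le:
  assumes "0 < \<delta>" "\<delta> \<le> 1"
  shows "(1 + x \<bullet> x) * inverse (1 + \<delta> * (x \<bullet> x)) \<le> inverse \<delta>"
  using assms one_plus_pos[of \<delta> x] by (simp add: field_simps)

lemma growth_pos: "\<delta> \<ge> 0 \<Longrightarrow> growth m \<delta> x > 0"
  by (simp add: growth_alt one_plus_pos add_pos_nonneg)

lemma growth_le:
  assumes "0 < \<delta>" "\<delta> \<le> 1"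
  shows "growth m \<delta> x \<le> inverse \<delta> ^ m"
  unfolding growth_alt using ratio_le[OF assms, of x] one_plus_pos[of \<delta> x] assms
  by (intro power_mono) auto

lemma growth_times_decay_1: "growth m \<delta> x * decay m 1 x = decay m \<delta> x"
proof -
  have "1 + x \<bullet> x \<noteq> 0" using one_plus_pos[of 1 x] by simp
  hence "(1 + x \<bullet> x) ^ m * inverse (1 + x \<bullet> x) ^ m = 1"
    by (simp add: power_mult_distrib[symmetric])
  thus ?thesis by (simp add: growth_def decay_alt sum_nth_sq mult_ac)
qed

text \<open>From s \<le> 1 + |x| and (1 + |x|)^2 \<le> 2 (1 + |x|^2) the base of the power is at
  most 2 / s^2.\<close>

lemma decay_1_le:
  assumes "0 < s" "s \<le> 1 + norm x"
  shows "decay m 1 x \<le> 2 ^ m * inverse s ^ (2 * m)"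
proof -
  have *: "inverse a \<le> 2 * (inverse s)\<^sup>2" if "a > 0" "s\<^sup>2 \<le> 2 * a" for a
    using that assms(1) by (simp add: field_simps)
  have "s\<^sup>2 \<le> (1 + norm x)\<^sup>2"
    using assms by (intro power_mono) auto
  also have "\<dots> \<le> 2 * (1 + x \<bullet> x)"
    using sum_squares_bound[of 1 "norm x"] by (simp add: power2_sum power2_norm_eq_inner)
  finally have "inverse (1 + x \<bullet> x) \<le> 2 * (inverse s)\<^sup>2"
    using one_plus_pos[of 1 x] by (intro *) simp_all
  hence "decay m 1 x \<le> (2 * (inverse s)\<^sup>2) ^ m"
    using one_plus_pos[of 1 x] unfolding decay_alt by (intro power_mono) simp_all
  thus ?thesis by (simp only: power_mult_distrib power_mult)
qed

text \<open>The function is dominated by a series of multiples of indicators of balls of radius k +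
  1. In dimension d with m = d + 1, the coefficient of order (k + 1)^(- 2 m) times a volume of order
  (k + 1)^d leaves (k + 1)^(- d - 2), which is summable.\<close>

lemma integrable_decay_1:
  "integrable lebesgue (decay (CARD('n) + 1) 1 :: real ^ 'n::finite \<Rightarrow> real)"
proof -
  let ?d = "CARD('n)" let ?m = "?d + 1"
  define f :: "nat \<Rightarrow> real ^ 'n \<Rightarrow> real" where
    "f k x = 2 ^ ?m * inverse (real (Suc k)) ^ (2 * ?m) * indicator (ball 0 (real (Suc k))) x" for k x
  have le: "inverse (real (Suc k)) ^ n \<le> inverse (real (Suc k)) ^ 2" if "n \<ge> 2" for k n
    using that by (intro power_decreasing) (auto simp: inverse_le_1_iff)
  have f_nonneg: "0 \<le> f k x" for k x
    by (simp add: f_def)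
  have f_le: "f k x \<le> 2 ^ ?m * inverse (real (Suc k)) ^ 2" for k x
  proof -
    have "f k x \<le> 2 ^ ?m * inverse (real (Suc k)) ^ (2 * ?m) * 1"
      unfolding f_def by (intro mult_left_mono) (auto simp: indicator_def)
    also have "\<dots> \<le> 2 ^ ?m * inverse (real (Suc k)) ^ 2"
      using le[of "2 * ?m" k] by simp
    finally show ?thesis .
  qed
  have int: "integrable lebesgue (f k)" for k
    using emeasure_bounded_finite[OF bounded_ball[of "0::real^'n" "real (Suc k)"]]
    unfolding f_def
    by (intro integrable_mult_right integrable_real_indicator) (simp_all add: top.not_eq_extremum)
  have summable2: "summable (\<lambda>k. c * inverse (real (Suc k)) ^ 2)" for c
    using inverse_power_summable[of 2, where 'a = real]
    by (intro summable_mult, subst summable_Suc_iff) (simp add: power_inverse)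
  have f_summable: "summable (\<lambda>k. f k x)" for x
    using f_nonneg f_le by (intro summable_comparison_test'[OF summable2]) simp
  have f_integral: "(LINT x|lebesgue. f k x) \<le> 2 ^ ?m * unit_ball_vol ?d * inverse (real (Suc k)) ^ 2" for k
  proof -
    have "(LINT x|lebesgue. f k x)
        = 2 ^ ?m * inverse (real (Suc k)) ^ (2 * ?m) * (unit_ball_vol ?d * real (Suc k) ^ ?d)"
      unfolding f_def by (simp add: content_ball measure_completion)
    also have "inverse (real (Suc k)) ^ (2 * ?m) * real (Suc k) ^ ?d
        = inverse (real (Suc k)) ^ (?d + 2) * (inverse (real (Suc k)) * real (Suc k)) ^ ?d"
      unfolding power_mult_distrib mult_2 by (simp add: power_add mult_ac)
    hence "2 ^ ?m * inverse (real (Suc k)) ^ (2 * ?m) * (unit_ball_vol ?d * real (Suc k) ^ ?d)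
        = 2 ^ ?m * unit_ball_vol ?d * inverse (real (Suc k)) ^ (?d + 2)"
      by (simp add: mult_ac)
    also have "\<dots> \<le> 2 ^ ?m * unit_ball_vol ?d * inverse (real (Suc k)) ^ 2"
      using le[of "?d + 2" k] by (intro mult_left_mono) auto
    finally show ?thesis .
  qed
  have "integrable lebesgue (\<lambda>x. \<Sum>k. f k x)"
  proof (rule integrable_suminf[OF int])
    show "AE x in lebesgue. summable (\<lambda>k. norm (f k x))"
      using f_summable f_nonneg by simp
    have "norm (LINT x|lebesgue. norm (f k x)) \<le> 2 ^ ?m * unit_ball_vol ?d * inverse (real (Suc k)) ^ 2" for k
      using f_integral f_nonneg by simp
    thus "summable (\<lambda>k. LINT x|lebesgue. norm (f k x))"
      by (intro summable_comparison_test'[OF summable2])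
  qed
  thus ?thesis
  proof (rule Bochner_Integration.integrable_bound)
    show "(decay ?m 1 :: real ^ 'n \<Rightarrow> real) \<in> borel_measurable lebesgue"
      by (intro smooth_measurable smooth_decay) simp
    have "norm (decay ?m 1 x) \<le> norm (\<Sum>k. f k x)" for x :: "real ^ 'n"
    proof -
      \<comment> \<open>The point lies in the ball of radius k + 1, and k + 1 \<le> 1 + |x|, so this
        single term of the series already dominates.\<close>
      define k where "k = nat \<lfloor>norm x\<rfloor>"
      have "real k = of_int \<lfloor>norm x\<rfloor>" by (simp add: k_def)
      hence k: "real k \<le> norm x" "norm x < real (Suc k)" by (simp, simp, linarith)
      have "decay ?m 1 x \<le> f k x"
        using k decay_1_le[of "real (Suc k)" x ?m] by (simp add: f_def)
      also have "\<dots> = (\<Sum>j\<in>{k}. f j x)" by simp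
      also have "\<dots> \<le> (\<Sum>j. f j x)"
        using f_summable f_nonneg by (intro sum_le_suminf) auto
      finally show ?thesis using decay_pos[of 1 ?m x] by (simp only: real_norm_def) linarith
    qed
    thus "AE x in lebesgue. norm (decay ?m 1 (x :: real ^ 'n)) \<le> norm (\<Sum>k. f k x)"
      by simp
  qed
qed

lemma decay_le_decay_1:
  assumes "0 < \<delta>" "\<delta> \<le> 1"
  shows "decay m \<delta> x \<le> inverse \<delta> ^ m * decay m 1 x"
  using mult_right_mono[OF growth_le[OF assms, of m x] less_imp_le[OF decay_pos[of 1 m x]]]
  by (simp add: growth_times_decay_1)

text \<open>The square of \<open>decay\<close> is at most \<open>decay\<close>, which is at most
  \<open>inverse \<delta> ^ m\<close> times the integrable function
  \<open>decay m 1\<close>.\<close>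

lemma decay_L2:
  assumes "0 < \<delta>" "\<delta> \<le> 1"
  shows "(\<lambda>x :: real ^ 'n::finite. complex_of_real (decay (CARD('n) + 1) \<delta> x)) \<in> L2"
proof -
  let ?m = "CARD('n) + 1"
  have m: "(decay ?m \<delta> :: real ^ 'n \<Rightarrow> real) \<in> borel_measurable lebesgue"
    using assms by (intro smooth_measurable smooth_decay) simp
  have "integrable lebesgue (\<lambda>x :: real ^ 'n. (decay ?m \<delta> x)\<^sup>2)"
  proof (rule Bochner_Integration.integrable_bound)
    show "integrable lebesgue (\<lambda>x :: real ^ 'n. inverse \<delta> ^ ?m * decay ?m 1 x)"
      by (intro integrable_mult_right integrable_decay_1)
    have "(decay ?m \<delta> x)\<^sup>2 \<le> inverse \<delta> ^ ?m * decay ?m 1 x" for x :: "real ^ 'n"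
    proof -
      have "(decay ?m \<delta> x)\<^sup>2 \<le> decay ?m \<delta> x * 1"
        unfolding power2_eq_square using decay_pos[of \<delta> ?m x] decay_le_1[of \<delta> ?m x] assms
        by (intro mult_left_mono) auto
      thus ?thesis using decay_le_decay_1[OF assms, of ?m x] by simp
    qed
    thus "AE x in lebesgue. norm ((decay ?m \<delta> (x :: real ^ 'n))\<^sup>2) \<le> norm (inverse \<delta> ^ ?m * decay ?m 1 x)"
      by (simp add: order_trans[OF _ abs_ge_self])
  qed (use m in simp)
  thus ?thesis using m by (simp add: L2_def borel_measurable_of_real)
qed

lemma decay_tendsto: "(\<lambda>n. decay m (inverse (real (Suc n))) x) \<longlonglongrightarrow> 1"
proof -
  have "(\<lambda>n. inverse (1 + inverse (real (Suc n)) * (x \<bullet> x)) ^ m) \<longlonglongrightarrow> inverse (1 + 0 * (x \<bullet> x)) ^ m"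
    by (intro tendsto_intros LIMSEQ_inverse_real_of_nat) auto
  thus ?thesis by (simp add: decay_alt)
qed

section \<open>Energy estimates\<close>

text \<open>The quadratic form is nonnegative at s a + b and at s a - b; dividing by s bounds the
  mixed term with both signs.\<close>

lemma psd_AM_GM:
  fixes A :: "real ^ 'n ^ 'n"
  assumes sym: "transpose A = A" and psd: "\<And>v. 0 \<le> v \<bullet> (A *v v)" and "s > 0"
  shows "2 * \<bar>a \<bullet> (A *v b)\<bar> \<le> s * (a \<bullet> (A *v a)) + inverse s * (b \<bullet> (A *v b))"
proof -
  have c: "b \<bullet> (A *v a) = a \<bullet> (A *v b)"
    by (metis sym dot_lmul_matrix inner_commute transpose_matrix_vector)
  have i: "inverse s * s = 1" using assms(3) by simp
  have "0 \<le> inverse s * ((s *\<^sub>R a + t *\<^sub>R b) \<bullet> (A *v (s *\<^sub>R a + t *\<^sub>R b)))" for t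
    using psd assms(3) by simp
  also have "inverse s * ((s *\<^sub>R a + t *\<^sub>R b) \<bullet> (A *v (s *\<^sub>R a + t *\<^sub>R b)))
      = (inverse s * s) * s * (a \<bullet> (A *v a)) + (inverse s * s) * (2 * t * (a \<bullet> (A *v b)))
        + inverse s * t\<^sup>2 * (b \<bullet> (A *v b))" for t
    by (simp add: matrix_vector_right_distrib matrix_vector_mult_scaleR inner_add_left inner_add_right c
        power2_eq_square algebra_simps)
  finally have *: "0 \<le> s * (a \<bullet> (A *v a)) + 2 * t * (a \<bullet> (A *v b)) + inverse s * t\<^sup>2 * (b \<bullet> (A *v b))" for t
    unfolding i by simp
  show ?thesis using *[of 1] *[of "-1"] by (simp add: abs_if)
qed

text \<open>Vectors are functions of the index because the weak derivatives at a point arise as such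
  a family.\<close>

definition sesq :: "real ^ 'n ^ 'n \<Rightarrow> ('n::finite \<Rightarrow> complex) \<Rightarrow> ('n \<Rightarrow> complex) \<Rightarrow> complex" where
  "sesq A a b = (\<Sum>i\<in>UNIV. \<Sum>j\<in>UNIV. cnj (a i) * (complex_of_real (A $ i $ j) * b j))"

definition re_vec :: "('n::finite \<Rightarrow> complex) \<Rightarrow> real ^ 'n" where
  "re_vec a = (\<chi> i. Re (a i))"

definition im_vec :: "('n::finite \<Rightarrow> complex) \<Rightarrow> real ^ 'n" where
  "im_vec a = (\<chi> i. Im (a i))"

text \<open>\<open>A\<close> is real, so only products of two real or of two imaginary parts
  contribute, and real linear algebra suffices.\<close>

lemma Re_sesq: "Re (sesq A a b) = re_vec a \<bullet> (A *v re_vec b) + im_vec a \<bullet> (A *v im_vec b)"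
  by (simp add: sesq_def re_vec_def im_vec_def inner_vec_def matrix_vector_mult_def sum_distrib_left
      sum.distrib[symmetric] algebra_simps)

text \<open>Applied to \<open>C x\<close> this is the coefficient matrix of h + \<epsilon> l, so
  that both forms are treated as one.\<close>

definition regularized :: "real \<Rightarrow> real ^ 'n ^ 'n \<Rightarrow> real ^ 'n ^ 'n" where
  "regularized \<epsilon> A = A + \<epsilon> *\<^sub>R mat 1"

lemma regularized_nth: "regularized \<epsilon> A $ i $ j = A $ i $ j + (if i = j then \<epsilon> else 0)"
  by (simp add: regularized_def mat_def)

lemma sesq_regularized:
  "sesq (regularized \<epsilon> A) a b = sesq A a b + of_real \<epsilon> * (\<Sum>i\<in>UNIV. cnj (a i) * b i)"
proof -
  have "(\<Sum>j\<in>UNIV. cnj (a i) * (complex_of_real (regularized \<epsilon> A $ i $ j) * b j))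
      = (\<Sum>j\<in>UNIV. cnj (a i) * (complex_of_real (A $ i $ j) * b j)) + of_real \<epsilon> * (cnj (a i) * b i)" for i
  proof -
    have "cnj (a i) * (complex_of_real (regularized \<epsilon> A $ i $ j) * b j)
        = cnj (a i) * (complex_of_real (A $ i $ j) * b j) + (if j = i then of_real \<epsilon> * (cnj (a i) * b i) else 0)" for j
      by (auto simp: regularized_nth algebra_simps)
    thus ?thesis by (simp add: sum.distrib)
  qed
  thus ?thesis by (simp add: sesq_def sum.distrib sum_distrib_left)
qed

lemma regularized_quadratic:
  fixes A :: "real ^ 'n::finite ^ 'n"
  shows "v \<bullet> (regularized \<epsilon> A *v v) = v \<bullet> (A *v v) + \<epsilon> * (norm v)\<^sup>2"
proof -
  have "(\<epsilon> *\<^sub>R mat 1 :: real ^ 'n ^ 'n) *v v = \<epsilon> *\<^sub>R v"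
    by (metis matrix_vector_mul_lid scaleR_matrix_vector_assoc)
  thus ?thesis
    by (simp add: regularized_def matrix_vector_mult_add_rdistrib inner_add_right power2_norm_eq_inner)
qed

lemma transpose_regularized: "transpose A = A \<Longrightarrow> transpose (regularized \<epsilon> A) = regularized \<epsilon> A"
  by (auto simp: vec_eq_iff transpose_def regularized_nth)

lemma quadratic_bound:
  fixes A :: "real ^ 'n::finite ^ 'n"
  assumes "\<And>i j. \<bar>A $ i $ j\<bar> \<le> K"
  shows "v \<bullet> (A *v v) \<le> K * (real CARD('n))\<^sup>2 * (norm v)\<^sup>2"
proof -
  have "v \<bullet> (A *v v) = (\<Sum>i\<in>UNIV. \<Sum>j\<in>UNIV. v $ i * (A $ i $ j * v $ j))"
    by (simp add: inner_vec_def matrix_vector_mult_def sum_distrib_left)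
  also have "\<dots> \<le> (\<Sum>i\<in>(UNIV::'n set). \<Sum>j\<in>(UNIV::'n set). norm v * (K * norm v))"
  proof (intro sum_mono)
    fix i j
    have "v $ i * (A $ i $ j * v $ j) \<le> \<bar>v $ i\<bar> * (\<bar>A $ i $ j\<bar> * \<bar>v $ j\<bar>)"
      by (metis abs_ge_self abs_mult)
    also have "\<dots> \<le> norm v * (K * norm v)"
      using assms[of i j] component_le_norm_cart[of v i] component_le_norm_cart[of v j]
      by (intro mult_mono mult_nonneg_nonneg) (auto intro: order_trans[OF abs_ge_zero])
    finally show "v $ i * (A $ i $ j * v $ j) \<le> norm v * (K * norm v)" .
  qed
  finally show ?thesis by (simp add: power2_eq_square mult_ac)
qed

text \<open>The lower bound is nonnegativity rather than coercivity, so one constant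
  \<open>L\<close> serves for all \<epsilon> in (0, 1] and the estimates survive the limit.\<close>

definition elliptic_bound :: "real \<Rightarrow> real ^ 'n::finite ^ 'n \<Rightarrow> bool" where
  "elliptic_bound L A \<longleftrightarrow>
     transpose A = A \<and> (\<forall>v. 0 \<le> v \<bullet> (A *v v)) \<and> (\<forall>v. v \<bullet> (A *v v) \<le> L * (norm v)\<^sup>2)"

lemma Linfty_bound:
  fixes C :: "(real ^ 'n::finite) \<Rightarrow> real ^ 'n ^ 'n"
  assumes "\<And>i j. (\<lambda>x. C x $ i $ j) \<in> Linfty"
  obtains K where "K \<ge> 0" "AE x in lebesgue. \<forall>i j. \<bar>C x $ i $ j\<bar> \<le> K"
proof -
  have "\<forall>i j. \<exists>K. AE x in lebesgue. norm (C x $ i $ j) \<le> K"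
    using assms by (auto simp: Linfty_def)
  then obtain k where k: "AE x in lebesgue. norm (C x $ i $ j) \<le> k i j" for i j
    by metis
  define K where "K = (\<Sum>i\<in>UNIV. \<Sum>j\<in>UNIV. \<bar>k i j\<bar>)"
  have "k i j \<le> K" for i j
  proof -
    have "k i j \<le> \<bar>k i j\<bar>" by simp
    also have "\<dots> \<le> (\<Sum>j\<in>UNIV. \<bar>k i j\<bar>)" by (intro member_le_sum) auto
    also have "\<dots> \<le> K" unfolding K_def
      by (rule member_le_sum[of i UNIV "\<lambda>i. \<Sum>j\<in>UNIV. \<bar>k i j\<bar>"]) (auto intro: sum_nonneg)
    finally show ?thesis .
  qed
  hence "AE x in lebesgue. \<bar>C x $ i $ j\<bar> \<le> K" for i j
    using k[of i j] by (auto elim!: eventually_mono intro: order_trans)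
  hence "AE x in lebesgue. \<forall>i\<in>UNIV. \<forall>j\<in>UNIV. \<bar>C x $ i $ j\<bar> \<le> K"
    by (intro AE_finite_allI) auto
  moreover have "K \<ge> 0" unfolding K_def by (intro sum_nonneg) auto
  ultimately show ?thesis using that by simp
qed

lemma elliptic_bound_regularized:
  fixes C :: "(real ^ 'n::finite) \<Rightarrow> real ^ 'n ^ 'n"
  assumes C: "\<And>i j. (\<lambda>x. C x $ i $ j) \<in> Linfty"
    and psd: "AE x in lebesgue. transpose (C x) = C x \<and> (\<forall>v. v \<bullet> (C x *v v) \<ge> 0)"
  obtains L where "L \<ge> 0"
    "\<And>\<epsilon>. 0 < \<epsilon> \<Longrightarrow> \<epsilon> \<le> 1 \<Longrightarrow> AE x in lebesgue. elliptic_bound L (regularized \<epsilon> (C x))"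
proof -
  obtain K where K: "K \<ge> 0" "AE x in lebesgue. \<forall>i j. \<bar>C x $ i $ j\<bar> \<le> K"
    using Linfty_bound[OF C] by blast
  \<comment> \<open>The squared dimension counts the matrix entries; the summand 1 absorbs
    \<epsilon> \<le> 1.\<close>
  let ?L = "K * (real CARD('n))\<^sup>2 + 1"
  show ?thesis
  proof (rule that[of ?L])
    show "?L \<ge> 0" using K by simp
    fix \<epsilon> :: real assume \<epsilon>: "0 < \<epsilon>" "\<epsilon> \<le> 1"
    show "AE x in lebesgue. elliptic_bound ?L (regularized \<epsilon> (C x))"
      using K(2) psd
    proof eventually_elim
      case (elim x)
      have "v \<bullet> (regularized \<epsilon> (C x) *v v) \<le> ?L * (norm v)\<^sup>2" for v
      proof -
        have "\<epsilon> * (norm v)\<^sup>2 \<le> 1 * (norm v)\<^sup>2"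
          using \<epsilon> by (intro mult_right_mono) auto
        thus ?thesis
          using quadratic_bound[of "C x" K v] elim(1) unfolding regularized_quadratic distrib_right
          by (intro add_mono) auto
      qed
      thus ?case using elim(2) \<epsilon>
        unfolding elliptic_bound_def by (simp add: regularized_quadratic transpose_regularized)
    qed
  qed
qed

section \<open>The regularized form as an integral and its energy estimates\<close>

lemma sesq_form:
  assumes C: "\<And>i j. (\<lambda>x. C x $ i $ j) \<in> Linfty" and "u \<in> W12" "v \<in> W12"
  shows "integrable lebesgue (\<lambda>x. sesq (regularized \<epsilon> (C x)) (\<lambda>i. weak_deriv i v x) (\<lambda>i. weak_deriv i u x))"
    and "h_form C v u + complex_of_real \<epsilon> * l_form v u =
      (LINT x|lebesgue. sesq (regularized \<epsilon> (C x)) (\<lambda>i. weak_deriv i v x) (\<lambda>i. weak_deriv i u x))"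
proof -
  let ?h = "\<lambda>i j x. cnj (weak_deriv i v x) * (complex_of_real (C x $ i $ j) * weak_deriv j u x)"
  let ?l = "\<lambda>i x. cnj (weak_deriv i v x) * weak_deriv i u x"
  have "(\<lambda>x. complex_of_real (C x $ i $ j) * weak_deriv j u x) \<in> L2" for i j
  proof -
    from C[of i j] obtain K where "(\<lambda>x. C x $ i $ j) \<in> borel_measurable lebesgue"
      "AE x in lebesgue. norm (C x $ i $ j) \<le> K"
      by (auto simp: Linfty_def)
    thus ?thesis
      by (intro L2_bounded_mult[where K = K] weak_deriv_L2 assms) (simp_all add: borel_measurable_of_real)
  qed
  hence h: "integrable lebesgue (?h i j)" for i j
    by (intro L2_mult_integrable L2_cnj weak_deriv_L2 assms)
  have l: "integrable lebesgue (?l i)" for i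
    by (intro L2_mult_integrable L2_cnj weak_deriv_L2 assms)
  have *: "(\<lambda>x. sesq (regularized \<epsilon> (C x)) (\<lambda>i. weak_deriv i v x) (\<lambda>i. weak_deriv i u x))
      = (\<lambda>x. (\<Sum>i\<in>UNIV. \<Sum>j\<in>UNIV. ?h i j x) + of_real \<epsilon> * (\<Sum>i\<in>UNIV. ?l i x))"
    by (rule ext, subst sesq_regularized) (simp only: sesq_def)
  have ih: "integrable lebesgue (\<lambda>x. \<Sum>i\<in>UNIV. \<Sum>j\<in>UNIV. ?h i j x)"
    by (intro Bochner_Integration.integrable_sum h)
  have il: "integrable lebesgue (\<lambda>x. of_real \<epsilon> * (\<Sum>i\<in>UNIV. ?l i x))"
    by (intro integrable_mult_right Bochner_Integration.integrable_sum l)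
  show "integrable lebesgue (\<lambda>x. sesq (regularized \<epsilon> (C x)) (\<lambda>i. weak_deriv i v x) (\<lambda>i. weak_deriv i u x))"
    unfolding * using ih il by (rule Bochner_Integration.integrable_add)
  have "(LINT x|lebesgue. (\<Sum>i\<in>UNIV. \<Sum>j\<in>UNIV. ?h i j x) + of_real \<epsilon> * (\<Sum>i\<in>UNIV. ?l i x))
      = (\<Sum>i\<in>UNIV. \<Sum>j\<in>UNIV. LINT x|lebesgue. ?h i j x) + of_real \<epsilon> * (\<Sum>i\<in>UNIV. LINT x|lebesgue. ?l i x)"
    using h l ih il by (simp add: Bochner_Integration.integral_sum)
  thus "h_form C v u + complex_of_real \<epsilon> * l_form v u =
      (LINT x|lebesgue. sesq (regularized \<epsilon> (C x)) (\<lambda>i. weak_deriv i v x) (\<lambda>i. weak_deriv i u x))"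
    unfolding * by (simp add: h_form_def l_form_def pairing_def)
qed

text \<open>The tested equation is put into the form of real integrals so that pointwise
  inequalities can be inserted under the integral sign.\<close>

lemma H_eps_equation:
  assumes C: "\<And>i j. (\<lambda>x. C x $ i $ j) \<in> Linfty" and u: "(u, f) \<in> H_eps C \<epsilon>" and v: "v \<in> W12"
  shows "integrable lebesgue (\<lambda>x. Re (sesq (regularized \<epsilon> (C x)) (\<lambda>i. weak_deriv i v x) (\<lambda>i. weak_deriv i u x)))"
    and "integrable lebesgue (\<lambda>x. Re (cnj (v x) * f x))"
    and "(LINT x|lebesgue. Re (sesq (regularized \<epsilon> (C x)) (\<lambda>i. weak_deriv i v x) (\<lambda>i. weak_deriv i u x)))
      = (LINT x|lebesgue. Re (cnj (v x) * f x))"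
proof -
  have u': "u \<in> W12" "f \<in> L2" "h_form C v u + complex_of_real \<epsilon> * l_form v u = pairing v f"
    using u v by (auto simp: H_eps_def form_operator_def)
  note s = sesq_form[OF C u'(1) v, of \<epsilon>]
  have i: "integrable lebesgue (\<lambda>x. cnj (v x) * f x)"
    by (intro L2_mult_integrable L2_cnj W12_L2 v u')
  show "integrable lebesgue (\<lambda>x. Re (sesq (regularized \<epsilon> (C x)) (\<lambda>i. weak_deriv i v x) (\<lambda>i. weak_deriv i u x)))"
    "integrable lebesgue (\<lambda>x. Re (cnj (v x) * f x))"
    by (rule integrable_Re[OF s(1)], rule integrable_Re[OF i])
  have "Re (LINT x|lebesgue. sesq (regularized \<epsilon> (C x)) (\<lambda>i. weak_deriv i v x) (\<lambda>i. weak_deriv i u x))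
      = Re (LINT x|lebesgue. cnj (v x) * f x)"
    using s(2) u'(3) by (simp add: pairing_def)
  thus "(LINT x|lebesgue. Re (sesq (regularized \<epsilon> (C x)) (\<lambda>i. weak_deriv i v x) (\<lambda>i. weak_deriv i u x)))
      = (LINT x|lebesgue. Re (cnj (v x) * f x))"
    by (simp only: integral_Re[OF s(1)] integral_Re[OF i])
qed

text \<open>Here \<open>z\<close> and \<open>b\<close> stand for the solution and its gradient,
  \<open>w\<close> for the weight with logarithmic gradient \<open>p\<close>, and \<open>a\<close>
  for the gradient of \<open>w z\<close>. The cross term is absorbed by half of
  \<open>Re (sesq A b b)\<close> and by L M |z|^2 / 2; \<kappa> = 1 + L M pays for the latter and
  for the part |z|^2 in the bound of the product of \<open>g\<close> and \<open>z\<close>. The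
  bracket on the right is the difference of the two sides of the tested equation and integrates to
  zero.\<close>

lemma energy_pointwise:
  assumes A: "elliptic_bound L A" and "w \<ge> 0" and p: "(norm p)\<^sup>2 \<le> M"
    and a: "\<And>i. a i = of_real w * b i + of_real (w * p $ i) * z" and "\<kappa> = 1 + L * M" "L \<ge> 0"
  shows "w * Re (sesq A b b) \<le> 2 * (Re (sesq A a b) - Re (cnj (of_real w * z) * (of_real g - of_real \<kappa> * z))) + 2 * (w * g\<^sup>2)"
proof -
  let ?Q = "Re (sesq A b b)"
  have A': "transpose A = A" "\<And>v. 0 \<le> v \<bullet> (A *v v)" "\<And>v. v \<bullet> (A *v v) \<le> L * (norm v)\<^sup>2"
    using A by (auto simp: elliptic_bound_def)
  have "re_vec a = w *\<^sub>R (re_vec b + Re z *\<^sub>R p)" "im_vec a = w *\<^sub>R (im_vec b + Im z *\<^sub>R p)"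
    by (auto simp: re_vec_def im_vec_def a vec_eq_iff algebra_simps)
  hence e: "Re (sesq A a b)
      = w * (?Q + (Re z *\<^sub>R p) \<bullet> (A *v re_vec b) + (Im z *\<^sub>R p) \<bullet> (A *v im_vec b))"
    by (simp add: Re_sesq inner_add_left algebra_simps)
  have "p \<bullet> (A *v p) \<le> L * M"
    using A'(3)[of p] mult_left_mono[OF p \<open>L \<ge> 0\<close>] by linarith
  hence pM: "t\<^sup>2 * (p \<bullet> (A *v p)) \<le> t\<^sup>2 * (L * M)" for t
    by (intro mult_left_mono) auto
  have "0 \<le> M" using p zero_le_power2[of "norm p"] by linarith
  hence LM: "0 \<le> t\<^sup>2 * (L * M)" for t using \<open>L \<ge> 0\<close> by simp
  have s: "- (2 * ((t *\<^sub>R p) \<bullet> (A *v c))) \<le> t\<^sup>2 * (L * M) + c \<bullet> (A *v c)" for t c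
  proof -
    have "(t *\<^sub>R p) \<bullet> (A *v (t *\<^sub>R p)) = t\<^sup>2 * (p \<bullet> (A *v p))"
      by (simp add: matrix_vector_mult_scaleR power2_eq_square)
    thus ?thesis
      using psd_AM_GM[OF A'(1,2) zero_less_one, of "t *\<^sub>R p" c, unfolded inverse_1 mult_1] pM[of t]
      by linarith
  qed
  have g: "g * Re z \<le> (Re z)\<^sup>2 + g\<^sup>2"
    using mult_le_sum_squares[of g "Re z"] by simp
  have k: "\<kappa> * ((Re z)\<^sup>2 + (Im z)\<^sup>2)
      = (Re z)\<^sup>2 + (Im z)\<^sup>2 + (Re z)\<^sup>2 * (L * M) + (Im z)\<^sup>2 * (L * M)"
    unfolding assms(5) by (simp add: algebra_simps)
  \<comment> \<open>Stated for abstract reals to spare linear arithmetic the matrix terms.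
    \<open>X\<close> and \<open>Y\<close> become the energy densities of the real and imaginary
    parts, \<open>a\<close> and \<open>b\<close> the cross terms, \<open>h\<close> the product of
    \<open>g\<close> and \<open>Re z\<close>, \<open>r\<close> and \<open>i\<close> the squared
    parts of \<open>z\<close>, \<open>rl\<close> and \<open>il\<close> these squares times
    \<open>L * M\<close>, and \<open>k\<close> the square of \<open>g\<close>.\<close>
  have arith: "X + Y \<le> 2 * (X + Y + a + b - (h - (r + i + rl + il)) + k)"
    if "- (2 * a) \<le> rl + X" "- (2 * b) \<le> il + Y" "h \<le> r + k" "0 \<le> i" "0 \<le> rl" "0 \<le> il"
    for X Y a b h r i rl il k :: real
  proof -
    have "0 \<le> X + Y + 2 * a + 2 * b - 2 * h + 2 * r + 2 * i + 2 * rl + 2 * il + 2 * k"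
      using that by linarith
    thus ?thesis by (simp add: algebra_simps)
  qed
  have "?Q \<le> 2 * (?Q + (Re z *\<^sub>R p) \<bullet> (A *v re_vec b) + (Im z *\<^sub>R p) \<bullet> (A *v im_vec b)
      - (g * Re z - \<kappa> * ((Re z)\<^sup>2 + (Im z)\<^sup>2)) + g\<^sup>2)"
    unfolding k Re_sesq by (intro arith s g zero_le_power2 LM)
  hence "w * ?Q \<le> w * (2 * (?Q + (Re z *\<^sub>R p) \<bullet> (A *v re_vec b) + (Im z *\<^sub>R p) \<bullet> (A *v im_vec b)
      - (g * Re z - \<kappa> * ((Re z)\<^sup>2 + (Im z)\<^sup>2)) + g\<^sup>2))"
    using \<open>w \<ge> 0\<close> by (rule mult_left_mono)
  also have "\<dots> = 2 * (Re (sesq A a b) - w * (g * Re z - \<kappa> * ((Re z)\<^sup>2 + (Im z)\<^sup>2))) + 2 * (w * g\<^sup>2)"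
    unfolding e by (simp add: algebra_simps)
  also have "w * (g * Re z - \<kappa> * ((Re z)\<^sup>2 + (Im z)\<^sup>2)) = Re (cnj (of_real w * z) * (of_real g - of_real \<kappa> * z))"
    by (simp add: power2_eq_square algebra_simps)
  finally show ?thesis .
qed

text \<open>In the application \<open>w * g\<close> is the cut-off, \<open>q\<close> its logarithmic
  gradient and \<open>a\<close> its gradient. Weighting Cauchy-Schwarz with 1 / s turns the bound M
  s^2 for |q|^2 into a factor s, and the energy appears with the weight \<open>w\<close> for which
  it has been bounded.\<close>

lemma flux_pointwise:
  assumes A: "elliptic_bound L A" and "w \<ge> 0" and q: "(norm q)\<^sup>2 \<le> M * s\<^sup>2" and "s > 0" "L \<ge> 0"
    and a: "\<And>i. a i = of_real (w * g * q $ i)"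
  shows "2 * \<bar>Re (sesq A a b)\<bar> \<le> s * (w * Re (sesq A b b) + L * M * (w * g\<^sup>2))"
proof -
  have A': "transpose A = A" "\<And>v. 0 \<le> v \<bullet> (A *v v)" "\<And>v. v \<bullet> (A *v v) \<le> L * (norm v)\<^sup>2"
    using A by (auto simp: elliptic_bound_def)
  have "re_vec a = w *\<^sub>R (g *\<^sub>R q)" "im_vec a = 0"
    by (auto simp: re_vec_def im_vec_def a vec_eq_iff)
  hence "2 * \<bar>Re (sesq A a b)\<bar> = w * (2 * \<bar>(g *\<^sub>R q) \<bullet> (A *v re_vec b)\<bar>)"
    using \<open>w \<ge> 0\<close> by (simp add: Re_sesq abs_mult)
  also have "\<dots> \<le> w * (inverse s * ((g *\<^sub>R q) \<bullet> (A *v (g *\<^sub>R q))) + s * (re_vec b \<bullet> (A *v re_vec b)))"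
    using psd_AM_GM[OF A'(1,2), of "inverse s" "g *\<^sub>R q" "re_vec b"] \<open>s > 0\<close> \<open>w \<ge> 0\<close>
    by (intro mult_left_mono) auto
  also have "\<dots> \<le> w * (s * (L * M * g\<^sup>2) + s * Re (sesq A b b))"
  proof (intro mult_left_mono add_mono \<open>w \<ge> 0\<close>)
    have "q \<bullet> (A *v q) \<le> L * (M * s\<^sup>2)"
      using A'(3)[of q] mult_left_mono[OF q \<open>L \<ge> 0\<close>] by linarith
    hence "inverse s * (g\<^sup>2 * (q \<bullet> (A *v q))) \<le> inverse s * (g\<^sup>2 * (L * (M * s\<^sup>2)))"
      using \<open>s > 0\<close> by (intro mult_left_mono) auto
    thus "inverse s * ((g *\<^sub>R q) \<bullet> (A *v (g *\<^sub>R q))) \<le> s * (L * M * g\<^sup>2)"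
      using \<open>s > 0\<close> by (simp add: matrix_vector_mult_scaleR power2_eq_square mult_ac)
    show "re_vec b \<bullet> (A *v re_vec b) \<le> Re (sesq A b b)"
      using A'(2)[of "im_vec b"] by (simp add: Re_sesq)
  qed (use \<open>s > 0\<close> in auto)
  finally show ?thesis by (simp add: algebra_simps)
qed

text \<open>Testing with the weighted solution bounds the energy; testing with the cut-off then
  expresses the mass defect as a flux controlled by that energy. The right-hand side is free of
  \<epsilon> and vanishes with \<delta>.\<close>

lemma resolvent_mass_estimate:
  fixes C :: "(real ^ 'n::finite) \<Rightarrow> real ^ 'n ^ 'n" and m :: nat
  defines "m \<equiv> CARD('n) + 1"
  assumes C: "\<And>i j. (\<lambda>x. C x $ i $ j) \<in> Linfty"
    and L: "L \<ge> 0" "AE x in lebesgue. elliptic_bound L (regularized \<epsilon> (C x))"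
    and \<delta>: "0 < \<delta>" "\<delta> \<le> 1" and \<kappa>: "\<kappa> = 1 + L * (real m)\<^sup>2"
    and u: "(u, \<lambda>x. of_real (decay m 1 x) + (- of_real \<kappa>) * u x) \<in> H_eps C \<epsilon>"
  shows "\<bar>\<kappa> * Re (pairing (\<lambda>x. of_real (decay m \<delta> x)) u) - (LINT x|lebesgue. decay m \<delta> x * decay m 1 (x :: real ^ 'n))\<bar>
           \<le> sqrt \<delta> * \<kappa> * (LINT x|lebesgue. decay m 1 (x :: real ^ 'n))"
proof -
  let ?G = "decay m 1 :: real ^ 'n \<Rightarrow> real"
  let ?d = "decay m \<delta> :: real ^ 'n \<Rightarrow> real"
  let ?w = "growth m \<delta> :: real ^ 'n \<Rightarrow> real"
  let ?D = "\<lambda>u x i. weak_deriv i u x"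
  let ?A = "\<lambda>x. regularized \<epsilon> (C x)"
  let ?f = "\<lambda>x. of_real (?G x) + (- of_real \<kappa>) * u x"
  let ?Q = "\<lambda>x. Re (sesq (?A x) (?D u x) (?D u x))"
  have \<delta>0: "\<delta> \<ge> 0" using \<delta> by simp
  have uW: "u \<in> W12" using u by (simp add: H_eps_def form_operator_def)
  have iG: "integrable lebesgue ?G" unfolding m_def by (rule integrable_decay_1)
  have w: "0 \<le> ?w x" "?w x \<le> inverse \<delta> ^ m" for x
    using growth_pos[OF \<delta>0, of m x] growth_le[OF \<delta>, of m x] by auto
  have wG: "?w x * ?G x = ?d x" for x by (rule growth_times_decay_1)
  \<comment> \<open>The product is \<open>?d x * ?G x\<close> with \<open>?d x \<le> 1\<close>,
    which bounds the source term of the energy estimate uniformly in \<delta>.\<close>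
  have wG2: "?w x * (?G x)\<^sup>2 \<le> ?G x" for x
    using mult_right_mono[OF decay_le_1[OF \<delta>0, of m x], of "?G x"] decay_pos[of 1 m x]
    by (simp add: wG[symmetric] power2_eq_square mult_ac)

  have p: "(norm (growth_log_grad m \<delta> x))\<^sup>2 \<le> (real m)\<^sup>2" for x :: "real ^ 'n"
    by (rule growth_log_grad_bound[OF \<delta>0 \<delta>(2)])
  have p1: "\<bar>growth_log_grad m \<delta> x $ i\<bar> \<le> real m" for x :: "real ^ 'n" and i
    using component_le_norm_cart[of "growth_log_grad m \<delta> x" i] power2_le_imp_le[OF p[of x]] by simp
  \<comment> \<open>This bound and the next one depend on \<delta> and are qualitative: they place
    \<open>?v\<close> in \<open>W12\<close>, with a common constant for the weight and its
    gradient.\<close>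
  have bw: "\<bar>?w x\<bar> \<le> inverse \<delta> ^ m * (real m + 1)" for x
  proof -
    have "?w x * 1 \<le> inverse \<delta> ^ m * (real m + 1)"
      using w[of x] \<delta> by (intro mult_mono) auto
    thus ?thesis using w by simp
  qed
  have bp: "\<bar>partial_deriv i ?w x\<bar> \<le> inverse \<delta> ^ m * (real m + 1)" for i x
  proof -
    have "?w x * \<bar>growth_log_grad m \<delta> x $ i\<bar> \<le> inverse \<delta> ^ m * (real m + 1)"
      using w[of x] p1[of x i] \<delta> by (intro mult_mono) auto
    thus ?thesis using w by (simp add: partial_deriv_growth[OF \<delta>0] abs_mult)
  qed
  let ?v = "\<lambda>x. of_real (?w x) * u x"
  have v: "?v \<in> W12" and Dv: "\<And>i. AE x in lebesgue. ?D ?v x i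
      = of_real (?w x) * ?D u x i + of_real (partial_deriv i ?w x) * u x"
    using W12_mult[OF uW smooth_growth[OF \<delta>0] bw bp] by auto
  note v_eq = H_eps_equation[OF C u v]

  have iQ: "integrable lebesgue ?Q"
    using sesq_form(1)[OF C uW uW] by (rule integrable_Re)
  have iwQ: "integrable lebesgue (\<lambda>x. ?w x * ?Q x)"
  proof (rule Bochner_Integration.integrable_bound)
    show "integrable lebesgue (\<lambda>x. inverse \<delta> ^ m * ?Q x)"
      using iQ by (rule integrable_mult_right)
    show "(\<lambda>x. ?w x * ?Q x) \<in> borel_measurable lebesgue"
      using borel_measurable_integrable[OF iQ] smooth_measurable[OF smooth_growth[OF \<delta>0, of m]]
      by (rule borel_measurable_times[rotated])
    show "AE x in lebesgue. norm (?w x * ?Q x) \<le> norm (inverse \<delta> ^ m * ?Q x)"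
      using w \<delta> by (intro AE_I2) (auto simp: abs_mult intro!: mult_right_mono)
  qed
  let ?B = "\<lambda>x. 2 * (Re (sesq (?A x) (?D ?v x) (?D u x)) - Re (cnj (?v x) * ?f x)) + 2 * ?G x"
  have iB: "integrable lebesgue ?B"
    by (intro Bochner_Integration.integrable_add integrable_mult_right
        Bochner_Integration.integrable_diff v_eq(1,2) iG)
  have "AE x in lebesgue. \<forall>i\<in>UNIV. ?D ?v x i
      = of_real (?w x) * ?D u x i + of_real (partial_deriv i ?w x) * u x"
    using Dv by (intro AE_finite_allI) auto
  hence "AE x in lebesgue. ?w x * ?Q x \<le> ?B x"
    using L(2)
  proof eventually_elim
    case (elim x)
    have "?w x * ?Q x \<le> 2 * (Re (sesq (?A x) (?D ?v x) (?D u x))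
        - Re (cnj (of_real (?w x) * u x) * (of_real (?G x) - of_real \<kappa> * u x))) + 2 * (?w x * (?G x)\<^sup>2)"
      using elim by (intro energy_pointwise[OF elim(2) w(1) p[of x] _ \<kappa> L(1)])
        (simp add: partial_deriv_growth[OF \<delta>0])
    moreover have "of_real (?G x) - of_real \<kappa> * u x = ?f x" by simp
    ultimately show ?case using wG2[of x] by (simp only:)
  qed
  hence "(LINT x|lebesgue. ?w x * ?Q x) \<le> (LINT x|lebesgue. ?B x)"
    by (rule integral_mono_AE[OF iwQ iB])
  also have "\<dots> = 2 * ((LINT x|lebesgue. Re (sesq (?A x) (?D ?v x) (?D u x)))
      - (LINT x|lebesgue. Re (cnj (?v x) * ?f x))) + 2 * (LINT x|lebesgue. ?G x)"
    by (subst Bochner_Integration.integral_add)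
      (simp_all only: integral_mult_right_zero Bochner_Integration.integral_diff[OF v_eq(1,2)]
        integrable_mult_right Bochner_Integration.integrable_diff v_eq(1,2) iG)
  \<comment> \<open>By the equation tested with \<open>?v\<close> the two integrals in the bracket
    cancel, and the source term remains.\<close>
  finally have energy: "(LINT x|lebesgue. ?w x * ?Q x) \<le> 2 * (LINT x|lebesgue. ?G x)"
    unfolding v_eq(3) by simp

  have q: "(norm (decay_log_grad m \<delta> x))\<^sup>2 \<le> (real m)\<^sup>2 * (sqrt \<delta>)\<^sup>2" for x :: "real ^ 'n"
    using decay_log_grad_bound[OF \<delta>0] \<delta>0 by simp
  have q1: "\<bar>decay_log_grad m \<delta> x $ i\<bar> \<le> real m" for x :: "real ^ 'n" and i
  proof -
    have "(real m)\<^sup>2 * \<delta> \<le> (real m)\<^sup>2 * 1" using \<delta> by (intro mult_left_mono) auto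
    hence "(norm (decay_log_grad m \<delta> x))\<^sup>2 \<le> (real m)\<^sup>2"
      using decay_log_grad_bound[OF \<delta>0, of m x] by linarith
    thus ?thesis
      using component_le_norm_cart[of "decay_log_grad m \<delta> x" i] power2_le_imp_le by fastforce
  qed
  let ?V = "\<lambda>x. complex_of_real (?d x)"
  have dL2: "?V \<in> L2" unfolding m_def by (rule decay_L2[OF \<delta>])
  \<comment> \<open>The logarithmic gradient is measurable as a quotient of smooth
    functions.\<close>
  have md: "(\<lambda>x :: real ^ 'n. complex_of_real (decay_log_grad m \<delta> x $ i)) \<in> borel_measurable lebesgue" for i
  proof -
    have "(\<lambda>x. partial_deriv i ?d x / ?d x) \<in> borel_measurable lebesgue"
      by (intro borel_measurable_divide smooth_measurable smooth_partial_deriv smooth_decay \<delta>0)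
    moreover have "partial_deriv i ?d x / ?d x = decay_log_grad m \<delta> x $ i" for x
      using decay_pos[OF \<delta>0, of m x] by (simp add: partial_deriv_decay[OF \<delta>0])
    ultimately show ?thesis by (simp add: borel_measurable_of_real)
  qed
  have dV: "(\<lambda>x. complex_of_real (partial_deriv i ?d x)) \<in> L2" for i
  proof -
    have "(\<lambda>x. complex_of_real (decay_log_grad m \<delta> x $ i) * ?V x) \<in> L2"
      using q1 by (intro L2_bounded_mult[where K = "real m"] dL2 md) auto
    thus ?thesis by (simp add: partial_deriv_decay[OF \<delta>0] mult.commute)
  qed
  have V: "?V \<in> W12" and DV: "\<And>i. AE x in lebesgue. ?D ?V x i = of_real (partial_deriv i ?d x)"
    using W12_smooth[OF smooth_decay[OF \<delta>0] dL2 dV] by auto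
  note V_eq = H_eps_equation[OF C u V]
  have "AE x in lebesgue. \<forall>i\<in>UNIV. ?D ?V x i = of_real (partial_deriv i ?d x)"
    using DV by (intro AE_finite_allI) auto
  \<comment> \<open>The pointwise flux bound with s = sqrt \<delta>, since the cut-off is the weight
    times \<open>?G\<close>.\<close>
  hence "AE x in lebesgue. \<bar>Re (sesq (?A x) (?D ?V x) (?D u x))\<bar>
      \<le> sqrt \<delta> / 2 * (?w x * ?Q x + L * (real m)\<^sup>2 * ?G x)"
    using L(2)
  proof eventually_elim
    case (elim x)
    have "2 * \<bar>Re (sesq (?A x) (?D ?V x) (?D u x))\<bar>
        \<le> sqrt \<delta> * (?w x * ?Q x + L * (real m)\<^sup>2 * (?w x * (?G x)\<^sup>2))"
      using elim by (intro flux_pointwise[OF elim(2) w(1) q[of x] _ L(1)])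
        (simp_all add: partial_deriv_decay[OF \<delta>0] wG \<delta>)
    also have "\<dots> \<le> sqrt \<delta> * (?w x * ?Q x + L * (real m)\<^sup>2 * ?G x)"
      using wG2[of x] L(1) \<delta>0 by (intro mult_left_mono add_left_mono) auto
    finally show ?case by simp
  qed
  hence "(LINT x|lebesgue. \<bar>Re (sesq (?A x) (?D ?V x) (?D u x))\<bar>)
      \<le> (LINT x|lebesgue. sqrt \<delta> / 2 * (?w x * ?Q x + L * (real m)\<^sup>2 * ?G x))"
    by (intro integral_mono_AE integrable_abs V_eq(1) integrable_mult_right
        Bochner_Integration.integrable_add iwQ iG)
  also have "\<dots> = sqrt \<delta> / 2 * ((LINT x|lebesgue. ?w x * ?Q x) + L * (real m)\<^sup>2 * (LINT x|lebesgue. ?G x))"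
    using iwQ iG by simp
  \<comment> \<open>The second summand is doubled so that the constants combine to 2
    \<kappa>.\<close>
  also have "\<dots> \<le> sqrt \<delta> / 2 * (2 * (LINT x|lebesgue. ?G x) + 2 * (L * (real m)\<^sup>2) * (LINT x|lebesgue. ?G x))"
  proof (intro mult_left_mono add_mono energy mult_right_mono)
    show "0 \<le> (LINT x|lebesgue. ?G x)"
      by (intro integral_nonneg_AE AE_I2 decay_nonneg) simp
  qed (use L(1) \<delta>0 in auto)
  also have "\<dots> = sqrt \<delta> * \<kappa> * (LINT x|lebesgue. ?G x)"
    by (simp add: \<kappa> algebra_simps)
  finally have flux: "(LINT x|lebesgue. \<bar>Re (sesq (?A x) (?D ?V x) (?D u x))\<bar>) \<le> sqrt \<delta> * \<kappa> * (LINT x|lebesgue. ?G x)" .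

  have iVu: "integrable lebesgue (\<lambda>x. cnj (?V x) * u x)"
    by (intro L2_mult_integrable L2_cnj dL2 W12_L2 uW)
  have iVG: "integrable lebesgue (\<lambda>x. ?d x * ?G x)"
  proof (rule Bochner_Integration.integrable_bound[OF iG])
    show "(\<lambda>x. ?d x * ?G x) \<in> borel_measurable lebesgue"
      using \<delta>0 by (intro borel_measurable_times smooth_measurable smooth_decay) auto
    show "AE x in lebesgue. norm (?d x * ?G x) \<le> norm (?G x)"
    proof (rule AE_I2)
      fix x
      have "norm (?d x) \<le> 1"
        using decay_le_1[OF \<delta>0, of m x] decay_nonneg[OF \<delta>0, of m x] by simp
      thus "norm (?d x * ?G x) \<le> norm (?G x)"
        using mult_right_mono[of "norm (?d x)" 1 "norm (?G x)"] by (simp add: abs_mult)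
    qed
  qed
  have "Re (cnj (?V x) * ?f x) = ?d x * ?G x - \<kappa> * Re (cnj (?V x) * u x)" for x
    by (simp add: algebra_simps)
  hence "(LINT x|lebesgue. Re (cnj (?V x) * ?f x)) = (LINT x|lebesgue. ?d x * ?G x) - \<kappa> * Re (pairing ?V u)"
    using iVG integrable_Re[OF iVu]
    by (simp only: Bochner_Integration.integral_diff integrable_mult_right integral_mult_right_zero
        integral_Re[OF iVu] pairing_def)
  \<comment> \<open>By the equation tested with the cut-off, the mass defect is minus the
    flux.\<close>
  hence "\<bar>\<kappa> * Re (pairing ?V u) - (LINT x|lebesgue. ?d x * ?G x)\<bar>
      = \<bar>LINT x|lebesgue. Re (sesq (?A x) (?D ?V x) (?D u x))\<bar>"
    unfolding V_eq(3) by simp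
  also have "\<dots> \<le> (LINT x|lebesgue. \<bar>Re (sesq (?A x) (?D ?V x) (?D u x))\<bar>)"
    by (rule integral_abs_bound)
  finally show ?thesis using flux by simp
qed

section \<open>Pairings and contraction semigroups\<close>

lemma L2_norm_nonneg: "L2_norm f \<ge> 0"
  by (simp add: L2_norm_def integral_nonneg_AE)

lemma L2_norm_sq: "(L2_norm f)\<^sup>2 = (LINT x|lebesgue. (cmod (f x))\<^sup>2)"
  by (simp add: L2_norm_def integral_nonneg_AE)

text \<open>For positive \<open>a\<close> and \<open>b\<close> the value t = b / a gives the bound;
  the degenerate cases need other choices of \<open>t\<close>.\<close>

lemma nonneg_quadratic_imp:
  fixes a b X :: real
  assumes "0 \<le> a" "0 \<le> b" "\<And>t. 0 \<le> t\<^sup>2 * a\<^sup>2 - 2 * t * X + b\<^sup>2"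
  shows "X \<le> a * b"
proof (cases "a = 0")
  case True
  show ?thesis
  proof (rule ccontr)
    assume "\<not> X \<le> a * b"
    hence "X > 0" using True by simp
    \<comment> \<open>For \<open>a = 0\<close> the polynomial is affine in \<open>t\<close>, and
      this \<open>t\<close> makes it negative.\<close>
    hence "0 \<le> - 2 * (b\<^sup>2 + 1) + b\<^sup>2"
      using assms(3)[of "(b\<^sup>2 + 1) / X"] True by simp
    thus False using zero_le_power2[of b] by (simp add: algebra_simps)
  qed
next
  case False
  hence a: "a > 0" using assms(1) by simp
  have "0 \<le> (b / a)\<^sup>2 * a\<^sup>2 - 2 * (b / a) * X + b\<^sup>2"
    by (rule assms(3))
  also have "(b / a)\<^sup>2 * a\<^sup>2 = b\<^sup>2"
    using a by (simp add: power_divide)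
  finally have "b * X \<le> b * (a * b)"
    using a by (simp add: field_simps power2_eq_square)
  show ?thesis
  proof (cases "b = 0")
    case True
    show ?thesis
    proof (rule ccontr)
      assume "\<not> X \<le> a * b"
      hence X: "X > 0" using True by simp
      \<comment> \<open>For \<open>b = 0\<close> the choice b / a gives no information, so the
        minimizer X / a^2 takes its place.\<close>
      have "0 \<le> (X / a\<^sup>2)\<^sup>2 * a\<^sup>2 - 2 * (X / a\<^sup>2) * X + b\<^sup>2"
        by (rule assms(3))
      also have "\<dots> = - (X\<^sup>2 / a\<^sup>2)"
        using a True by (simp add: power2_eq_square)
      finally show False using X a by (simp add: field_simps)
    qed
  next
    case False
    thus ?thesis using \<open>b * X \<le> b * (a * b)\<close> assms(2) by simp
  qed
qed

lemma pairing_integrable: "f \<in> L2 \<Longrightarrow> g \<in> L2 \<Longrightarrow> integrable lebesgue (\<lambda>x. cnj (f x) * g x)"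
  by (intro L2_mult_integrable L2_cnj)

text \<open>The nonnegative quadratic is the integral of (t |f| - |g|)^2; working with moduli avoids
  complex phases.\<close>

lemma pairing_bound:
  assumes "f \<in> L2" "g \<in> L2"
  shows "cmod (pairing f g) \<le> L2_norm f * L2_norm g"
proof -
  let ?X = "LINT x|lebesgue. cmod (f x) * cmod (g x)"
  have i: "integrable lebesgue (\<lambda>x. cmod (f x) * cmod (g x))"
    using integrable_norm[OF pairing_integrable[OF assms]] by (simp add: norm_mult)
  have "cmod (pairing f g) \<le> (LINT x|lebesgue. cmod (cnj (f x) * g x))"
    unfolding pairing_def by (rule integral_norm_bound)
  also have "\<dots> = ?X" by (simp add: norm_mult)
  also have "?X \<le> L2_norm f * L2_norm g"
  proof (rule nonneg_quadratic_imp)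
    fix t :: real
    have "0 \<le> (LINT x|lebesgue. (t * cmod (f x) - cmod (g x))\<^sup>2)"
      by (intro integral_nonneg_AE) simp
    also have "(\<lambda>x. (t * cmod (f x) - cmod (g x))\<^sup>2)
        = (\<lambda>x. t\<^sup>2 * (cmod (f x))\<^sup>2 - 2 * t * (cmod (f x) * cmod (g x)) + (cmod (g x))\<^sup>2)"
      by (simp add: power2_diff power_mult_distrib algebra_simps)
    also have "(LINT x|lebesgue. t\<^sup>2 * (cmod (f x))\<^sup>2 - 2 * t * (cmod (f x) * cmod (g x)) + (cmod (g x))\<^sup>2)
        = t\<^sup>2 * (L2_norm f)\<^sup>2 - 2 * t * ?X + (L2_norm g)\<^sup>2"
      unfolding L2_norm_sq
      using i L2_integrable_square[OF assms(1)] L2_integrable_square[OF assms(2)] by simp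
    finally show "0 \<le> t\<^sup>2 * (L2_norm f)\<^sup>2 - 2 * t * ?X + (L2_norm g)\<^sup>2" .
  qed (rule L2_norm_nonneg)+
  finally show ?thesis .
qed

lemma pairing_cong:
  assumes "f \<in> L2" "g \<in> L2" "g' \<in> L2" "ae_eq g g'"
  shows "pairing f g = pairing f g'"
  unfolding pairing_def
proof (rule integral_cong_AE)
  show "(\<lambda>x. cnj (f x) * g x) \<in> borel_measurable lebesgue" "(\<lambda>x. cnj (f x) * g' x) \<in> borel_measurable lebesgue"
    using pairing_integrable assms by (auto intro: borel_measurable_integrable)
  show "AE x in lebesgue. cnj (f x) * g x = cnj (f x) * g' x"
    using assms(4) by eventually_elim simp
qed

lemma pairing_lincomb:
  assumes "v \<in> L2" "f \<in> L2" "g \<in> L2"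
  shows "pairing v (\<lambda>x. a * f x + b * g x) = a * pairing v f + b * pairing v g"
proof -
  have "(\<lambda>x. cnj (v x) * (a * f x + b * g x)) = (\<lambda>x. a * (cnj (v x) * f x) + b * (cnj (v x) * g x))"
    by (simp add: algebra_simps)
  thus ?thesis
    unfolding pairing_def using pairing_integrable[OF assms(1,2)] pairing_integrable[OF assms(1,3)]
    by (simp only:) simp
qed

lemma L2_lincomb: "f \<in> L2 \<Longrightarrow> g \<in> L2 \<Longrightarrow> (\<lambda>x. a * f x + b * g x) \<in> L2"
  by (intro L2_add L2_cmult)

section \<open>Semigroups observed through pairings\<close>

locale L2_contraction_semigroup =
  fixes S :: "real \<Rightarrow> ('n::finite) cfun \<Rightarrow> 'n cfun"
  assumes contraction_semigroup: "contraction_semigroup L2 L2_norm S"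
    and strongly_continuous: "\<And>f. f \<in> L2 \<Longrightarrow> ((\<lambda>t. L2_norm (\<lambda>x. S t f x - f x)) \<longlongrightarrow> 0) (at_right 0)"
begin

lemma S_L2: "t \<ge> 0 \<Longrightarrow> f \<in> L2 \<Longrightarrow> S t f \<in> L2"
  using contraction_semigroup by (simp add: contraction_semigroup_def linear_contraction_def)

lemma S_contraction: "t \<ge> 0 \<Longrightarrow> f \<in> L2 \<Longrightarrow> L2_norm (S t f) \<le> L2_norm f"
  using contraction_semigroup by (simp add: contraction_semigroup_def linear_contraction_def)

lemma S_zero: "f \<in> L2 \<Longrightarrow> ae_eq (S 0 f) f"
  using contraction_semigroup by (simp add: contraction_semigroup_def)

lemma S_add: "s \<ge> 0 \<Longrightarrow> t \<ge> 0 \<Longrightarrow> f \<in> L2 \<Longrightarrow> ae_eq (S (s + t) f) (S s (S t f))"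
  using contraction_semigroup by (simp add: contraction_semigroup_def)

lemma S_lincomb:
  assumes t: "t \<ge> 0" and f: "f \<in> L2" and g: "g \<in> L2"
  shows "ae_eq (S t (\<lambda>x. a * f x + b * g x)) (\<lambda>x. a * S t f x + b * S t g x)"
proof -
  have add: "ae_eq (S t (\<lambda>x. p x + q x)) (\<lambda>x. S t p x + S t q x)" if "p \<in> L2" "q \<in> L2" for p q
    using contraction_semigroup t that by (simp add: contraction_semigroup_def linear_contraction_def)
  have scale: "ae_eq (S t (\<lambda>x. c * p x)) (\<lambda>x. c * S t p x)" if "p \<in> L2" for p c
    using contraction_semigroup t that by (simp add: contraction_semigroup_def linear_contraction_def)
  show ?thesis
    using add[OF L2_cmult[OF f, of a] L2_cmult[OF g, of b]] scale[OF f, of a] scale[OF g, of b]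
    by eventually_elim simp
qed

text \<open>The operators are determined only up to null sets; pairing with a fixed vector turns
  such identities into equations between numbers.\<close>

lemma pairing_S_lincomb:
  assumes "t \<ge> 0" "v \<in> L2" "f \<in> L2" "g \<in> L2"
  shows "pairing v (S t (\<lambda>x. a * f x + b * g x)) = a * pairing v (S t f) + b * pairing v (S t g)"
  using pairing_cong[OF assms(2) S_L2[OF assms(1) L2_lincomb[OF assms(3,4)]]
      L2_lincomb[OF S_L2[OF assms(1,3)] S_L2[OF assms(1,4)]] S_lincomb[OF assms(1,3,4)], of a b]
    pairing_lincomb[OF assms(2) S_L2[OF assms(1,3)] S_L2[OF assms(1,4)], of a b]
  by simp

lemma pairing_S_add:
  assumes "s \<ge> 0" "t \<ge> 0" "v \<in> L2" "f \<in> L2"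
  shows "pairing v (S (s + t) f) = pairing v (S s (S t f))"
  using assms by (intro pairing_cong S_L2 S_add) auto

lemma pairing_S_bound:
  assumes "t \<ge> 0" "v \<in> L2" "f \<in> L2"
  shows "cmod (pairing v (S t f)) \<le> L2_norm v * L2_norm f"
  using pairing_bound[OF assms(2) S_L2[OF assms(1,3)]]
    mult_left_mono[OF S_contraction[OF assms(1,3)] L2_norm_nonneg[of v]] by linarith

lemma pairing_S_increment:
  assumes "s \<ge> 0" "h \<ge> 0" "v \<in> L2" "f \<in> L2"
  shows "pairing v (S (s + h) f) - pairing v (S s f) = pairing v (S s (\<lambda>x. S h f x - f x))"
  using pairing_S_lincomb[OF assms(1,3) S_L2[OF assms(2,4)] assms(4), of 1 "-1"]
    pairing_S_add[OF assms] by simp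

definition modulus :: "'n cfun \<Rightarrow> real \<Rightarrow> real" where
  "modulus f h = L2_norm (\<lambda>x. S h f x - f x)"

text \<open>The increment is S at the earlier time applied to S_h f - f with h = |t - s|, and S is
  contractive.\<close>

lemma pairing_S_modulus:
  assumes "s \<ge> 0" "t \<ge> 0" "v \<in> L2" "f \<in> L2"
  shows "cmod (pairing v (S t f) - pairing v (S s f)) \<le> L2_norm v * modulus f \<bar>t - s\<bar>"
proof -
  have *: "cmod (pairing v (S (r + h) f) - pairing v (S r f)) \<le> L2_norm v * modulus f h"
    if "r \<ge> 0" "h \<ge> 0" for r h
    unfolding pairing_S_increment[OF that assms(3,4)] modulus_def
    by (intro pairing_S_bound L2_diff S_L2 that assms)
  show ?thesis
  proof (cases "s \<le> t")
    case True
    thus ?thesis using *[of s "t - s"] assms by simp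
  next
    case False
    thus ?thesis using *[of t "s - t"] assms by (simp add: norm_minus_commute)
  qed
qed

text \<open>It transfers limits from the right at time 0 to two-sided limits at any time
  \<open>s\<close>.\<close>

lemma filterlim_abs_diff_at_right: "filterlim (\<lambda>t. \<bar>t - s\<bar>) (at_right 0) (at s within A)" for s :: real
proof -
  have "((\<lambda>t. \<bar>t - s\<bar>) \<longlongrightarrow> \<bar>s - s\<bar>) (at s within A)"
    by (intro tendsto_intros)
  thus ?thesis
    by (simp add: filterlim_at eventually_at_filter)
qed

lemma pairing_S_continuous:
  assumes "v \<in> L2" "f \<in> L2"
  shows "continuous_on {0..} (\<lambda>t. pairing v (S t f))"
  unfolding continuous_on_def
proof
  fix s :: real assume s: "s \<in> {0..}"
  have "((\<lambda>t. pairing v (S t f) - pairing v (S s f)) \<longlongrightarrow> 0) (at s within {0..})"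
  proof (rule Lim_null_comparison)
    show "\<forall>\<^sub>F t in at s within {0..}. norm (pairing v (S t f) - pairing v (S s f)) \<le> L2_norm v * modulus f \<bar>t - s\<bar>"
      using s pairing_S_modulus[OF _ _ assms] by (auto simp: eventually_at_filter)
    have "((\<lambda>t. modulus f \<bar>t - s\<bar>) \<longlongrightarrow> 0) (at s within {0..})"
      unfolding modulus_def
      by (rule filterlim_compose[OF strongly_continuous[OF assms(2)] filterlim_abs_diff_at_right])
    thus "((\<lambda>t. L2_norm v * modulus f \<bar>t - s\<bar>) \<longlongrightarrow> 0) (at s within {0..})"
      by (rule tendsto_mult_right_zero)
  qed
  thus "((\<lambda>t. pairing v (S t f)) \<longlongrightarrow> pairing v (S s f)) (at s within {0..})"
    by (simp add: LIM_zero_iff)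
qed

text \<open>The generator supplies a right derivative at time 0, yet left quotients at
  \<open>s\<close> are covered too: starting at r = min s t with step h = |t - s|, the quotient is
  the pairing of \<open>v\<close> with S_r k + S_r g, where k is the remainder in the generator
  limit, and replacing S_r g by S_s g costs at most the norm of \<open>v\<close> times
  \<open>modulus g h\<close>.\<close>

lemma has_real_derivative_pairing_S:
  assumes s: "s > 0" and v: "v \<in> L2" and gen: "(u, g) \<in> generator S"
  shows "((\<lambda>t. Re (pairing v (S t u))) has_real_derivative Re (pairing v (S s g))) (at s)"
proof -
  have u: "u \<in> L2" and g: "g \<in> L2"
    and lim: "((\<lambda>t. L2_norm (\<lambda>x. (S t u x - u x) / complex_of_real t - g x)) \<longlongrightarrow> 0) (at_right 0)"
    using gen by (auto simp: generator_def)
  let ?k = "\<lambda>h x. (S h u x - u x) / complex_of_real h - g x"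
  have k: "?k h \<in> L2" if "h \<ge> 0" for h
    using L2_lincomb[OF L2_diff[OF S_L2[OF that u] u] g, of "inverse (complex_of_real h)" "-1"]
    by (simp add: divide_inverse mult.commute)
  have incr: "pairing v (S (r + h) u) - pairing v (S r u)
      = complex_of_real h * (pairing v (S r (?k h)) + pairing v (S r g))" if "r \<ge> 0" "h > 0" for r h
  proof -
    have "(\<lambda>x. S h u x - u x) = (\<lambda>x. complex_of_real h * ?k h x + complex_of_real h * g x)"
      using that by (auto simp: field_simps)
    thus ?thesis
      using pairing_S_increment[of r h v u] pairing_S_lincomb[of r v "?k h" g "complex_of_real h" "complex_of_real h"]
        that u v g k[of h] by (simp add: distrib_left)
  qed
  let ?b = "\<lambda>h. L2_norm v * (L2_norm (?k h) + modulus g h)"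
  have diff: "\<bar>(Re (pairing v (S t u)) - Re (pairing v (S s u))) / (t - s) - Re (pairing v (S s g))\<bar> \<le> ?b \<bar>t - s\<bar>"
    if t: "t > 0" "t \<noteq> s" for t
  proof -
    define r h where "r = min s t" and "h = \<bar>t - s\<bar>"
    have rh: "r \<ge> 0" "h > 0" using s t by (auto simp: r_def h_def)
    have "Re (pairing v (S (r + h) u)) - Re (pairing v (S r u))
        = h * (Re (pairing v (S r (?k h))) + Re (pairing v (S r g)))"
      using arg_cong[OF incr[OF rh], of Re] by simp
    moreover have "(Re (pairing v (S t u)) - Re (pairing v (S s u))) / (t - s)
        = (Re (pairing v (S (r + h) u)) - Re (pairing v (S r u))) / h"
    proof (cases "s < t")
      case True
      thus ?thesis by (simp add: r_def h_def)
    next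
      case False
      hence "r = t" "h = s - t" using t by (auto simp: r_def h_def)
      thus ?thesis using t minus_divide_divide[of "Re (pairing v (S t u)) - Re (pairing v (S s u))" "t - s"]
        by simp
    qed
    ultimately have "(Re (pairing v (S t u)) - Re (pairing v (S s u))) / (t - s)
        = Re (pairing v (S r (?k h))) + Re (pairing v (S r g))"
      using rh by simp
    moreover have "\<bar>Re (pairing v (S r (?k h)))\<bar> \<le> L2_norm v * L2_norm (?k h)"
      using abs_Re_le_cmod[of "pairing v (S r (?k h))"] pairing_S_bound[OF rh(1) v k[of h]] rh by linarith
    moreover have "\<bar>Re (pairing v (S r g)) - Re (pairing v (S s g))\<bar> \<le> L2_norm v * modulus g h"
    proof (cases "r = s")
      case True
      thus ?thesis by (simp add: L2_norm_nonneg modulus_def)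
    next
      case False
      hence "h = \<bar>r - s\<bar>" by (auto simp: r_def h_def min_def)
      thus ?thesis
        using abs_Re_le_cmod[of "pairing v (S r g) - pairing v (S s g)"]
          pairing_S_modulus[of s r v g] s rh v g by simp
    qed
    ultimately show ?thesis
      unfolding h_def[symmetric] distrib_left by linarith
  qed
  have "((\<lambda>t. (Re (pairing v (S t u)) - Re (pairing v (S s u))) / (t - s) - Re (pairing v (S s g))) \<longlongrightarrow> 0) (at s)"
  proof (rule Lim_null_comparison)
    have "\<forall>\<^sub>F t in at s. t \<in> {0<..}"
      using s by (intro eventually_at_in_open') auto
    moreover have "\<forall>\<^sub>F t in at s. t \<noteq> s"
      by (simp add: eventually_at_filter)
    ultimately show "\<forall>\<^sub>F t in at s. norm ((Re (pairing v (S t u)) - Re (pairing v (S s u))) / (t - s)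
        - Re (pairing v (S s g))) \<le> ?b \<bar>t - s\<bar>"
      by eventually_elim (use diff in auto)
    have "((\<lambda>h. ?b h) \<longlongrightarrow> L2_norm v * (0 + 0)) (at_right 0)"
      unfolding modulus_def by (intro tendsto_intros lim strongly_continuous g)
    hence "((\<lambda>h. ?b h) \<longlongrightarrow> 0) (at_right 0)" by simp
    thus "((\<lambda>t. ?b \<bar>t - s\<bar>) \<longlongrightarrow> 0) (at s)"
      by (rule filterlim_compose[OF _ filterlim_abs_diff_at_right])
  qed
  thus ?thesis
    by (simp add: has_field_derivative_iff LIM_zero_iff)
qed

end

section \<open>Conservation of mass\<close>

text \<open>Testing with \<open>h = G w\<close> gives \<open>\<integral> |w|\<^sup>2 G \<le> \<integral> |w| G \<le> \<integral> (|w|\<^sup>2 + 1) / 2 G\<close>, hence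
  \<open>\<integral> |w - 1|\<^sup>2 G = \<integral> |w|\<^sup>2 G - \<integral> G \<le> 0\<close>.\<close>

lemma eq_1_if_contractive_functional:
  assumes w: "w \<in> Linfty" and G: "integrable lebesgue G" "\<And>x. G x > 0"
    and contr: "\<And>h. h \<in> L1 \<Longrightarrow> cmod (pairing w h) \<le> L1_norm h"
    and eq: "Re (pairing w (\<lambda>x. complex_of_real (G x))) = (LINT x|lebesgue. G x)"
  shows "AE x in lebesgue. w x = 1"
proof -
  from w obtain K where m: "w \<in> borel_measurable lebesgue" and K: "AE x in lebesgue. cmod (w x) \<le> K"
    by (auto simp: Linfty_def)
  have mG: "G \<in> borel_measurable lebesgue" using G(1) by (rule borel_measurable_integrable)
  have G0: "G x \<ge> 0" for x using G(2)[of x] by simp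
  have i1: "integrable lebesgue (\<lambda>x. cmod (w x) * G x)"
  proof (rule Bochner_Integration.integrable_bound)
    show "integrable lebesgue (\<lambda>x. K * G x)" using G(1) by (rule integrable_mult_right)
    show "(\<lambda>x. cmod (w x) * G x) \<in> borel_measurable lebesgue" using m mG by simp
    show "AE x in lebesgue. norm (cmod (w x) * G x) \<le> norm (K * G x)"
      using K by eventually_elim (use G0 in \<open>auto simp: abs_mult intro!: mult_right_mono\<close>)
  qed
  have i2: "integrable lebesgue (\<lambda>x. (cmod (w x))\<^sup>2 * G x)"
  proof (rule Bochner_Integration.integrable_bound)
    show "integrable lebesgue (\<lambda>x. K\<^sup>2 * G x)" using G(1) by (rule integrable_mult_right)
    show "(\<lambda>x. (cmod (w x))\<^sup>2 * G x) \<in> borel_measurable lebesgue" using m mG by simp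
    show "AE x in lebesgue. norm ((cmod (w x))\<^sup>2 * G x) \<le> norm (K\<^sup>2 * G x)"
      using K by eventually_elim (use G0 in \<open>auto simp: abs_mult intro!: mult_right_mono power_mono\<close>)
  qed
  have ic: "integrable lebesgue (\<lambda>x. cnj (w x) * complex_of_real (G x))"
  proof (rule Bochner_Integration.integrable_bound[OF i1])
    show "(\<lambda>x. cnj (w x) * complex_of_real (G x)) \<in> borel_measurable lebesgue"
      using measurable_compose[OF m borel_measurable_cnj] mG by (simp add: borel_measurable_of_real)
  qed (simp add: norm_mult)
  let ?X = "LINT x|lebesgue. (cmod (w x))\<^sup>2 * G x" and ?I = "LINT x|lebesgue. G x"
  let ?h = "\<lambda>x. complex_of_real (G x) * w x"
  have "?h \<in> L1"
    unfolding L1_def mem_Collect_eq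
  proof (rule Bochner_Integration.integrable_bound[OF i1])
    show "?h \<in> borel_measurable lebesgue" using m mG by (simp add: borel_measurable_of_real)
  qed (simp add: norm_mult mult.commute)
  hence "cmod (pairing w ?h) \<le> L1_norm ?h" by (rule contr)
  moreover have pw: "pairing w ?h = complex_of_real ?X"
  proof -
    have "cnj (w x) * ?h x = complex_of_real ((cmod (w x))\<^sup>2 * G x)" for x
      by (simp only: of_real_mult complex_norm_square mult_ac)
    thus ?thesis unfolding pairing_def by (simp only: integral_complex_of_real)
  qed
  moreover have "L1_norm ?h = (LINT x|lebesgue. cmod (w x) * G x)"
    using G0 by (simp add: L1_norm_def norm_mult mult.commute)
  moreover have "(LINT x|lebesgue. cmod (w x) * G x) \<le> (LINT x|lebesgue. ((cmod (w x))\<^sup>2 * G x + G x) / 2)"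
  proof (rule integral_mono[OF i1])
    show "integrable lebesgue (\<lambda>x. ((cmod (w x))\<^sup>2 * G x + G x) / 2)"
      using i2 G(1) by simp
    fix x
    have "cmod (w x) \<le> ((cmod (w x))\<^sup>2 + 1) / 2"
      using sum_squares_bound[of "cmod (w x)" 1] by simp
    from mult_right_mono[OF this G0[of x]]
    show "cmod (w x) * G x \<le> ((cmod (w x))\<^sup>2 * G x + G x) / 2" by (simp add: algebra_simps)
  qed
  moreover have "(LINT x|lebesgue. ((cmod (w x))\<^sup>2 * G x + G x) / 2) = ?X / 2 + ?I / 2"
    using i2 G(1) by (simp add: add_divide_distrib)
  moreover have "?X \<le> cmod (pairing w ?h)" unfolding pw by (simp only: norm_of_real abs_ge_self)
  ultimately have X: "?X \<le> ?I" by linarith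
  have sq: "(cmod (w x - 1))\<^sup>2 * G x
      = (cmod (w x))\<^sup>2 * G x - 2 * Re (cnj (w x) * complex_of_real (G x)) + G x" for x
  proof -
    have e: "(cmod (w x - 1))\<^sup>2 = (cmod (w x))\<^sup>2 - 2 * Re (w x) + 1"
      unfolding cmod_power2 by (simp add: power2_eq_square algebra_simps)
    show ?thesis unfolding e by (simp add: algebra_simps)
  qed
  have iR: "integrable lebesgue (\<lambda>x. Re (cnj (w x) * complex_of_real (G x)))"
    using ic by (rule integrable_Re)
  have R: "(LINT x|lebesgue. Re (cnj (w x) * complex_of_real (G x))) = ?I"
    using eq unfolding pairing_def integral_Re[OF ic] .
  have isq: "integrable lebesgue (\<lambda>x. (cmod (w x - 1))\<^sup>2 * G x)"
    unfolding sq by (intro Bochner_Integration.integrable_add Bochner_Integration.integrable_diff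
        integrable_mult_right i2 iR G(1))
  have "(LINT x|lebesgue. (cmod (w x - 1))\<^sup>2 * G x) = ?X - 2 * ?I + ?I"
    unfolding sq
    by (simp only: Bochner_Integration.integral_add Bochner_Integration.integral_diff
        integrable_mult_right integral_mult_right_zero Bochner_Integration.integrable_diff i2 iR G(1) R)
  moreover have "0 \<le> (LINT x|lebesgue. (cmod (w x - 1))\<^sup>2 * G x)"
    using G0 by (intro integral_nonneg_AE AE_I2) simp
  ultimately have "(LINT x|lebesgue. (cmod (w x - 1))\<^sup>2 * G x) = 0"
    using X by linarith
  hence "AE x in lebesgue. (cmod (w x - 1))\<^sup>2 * G x = 0"
    using integral_nonneg_eq_0_iff_AE[OF isq] G0 by simp
  thus ?thesis
  proof eventually_elim
    case (elim x)
    thus ?case using G(2)[of x] by simp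
  qed
qed

text \<open>The ellipticity constant, and with it \<kappa>, is independent of \<epsilon>. All
  estimates therefore concern the resolvent at the same point - \<kappa>, where strong convergence
  yields convergence of the pairings.\<close>

lemma viscosity_resolvent_mass:
  fixes C :: "(real ^ 'n::finite) \<Rightarrow> real ^ 'n ^ 'n" and m :: nat
  defines "m \<equiv> CARD('n) + 1"
  assumes C: "\<And>i j. (\<lambda>x. C x $ i $ j) \<in> Linfty"
    and psd: "AE x in lebesgue. transpose (C x) = C x \<and> (\<forall>v. v \<bullet> (C x *v v) \<ge> 0)"
    and H0: "viscosity_operator C H0"
  obtains \<kappa> u where "\<kappa> > 0" "u \<in> L2"
    "(u, \<lambda>x. of_real (decay m 1 x) + (- of_real \<kappa>) * u x) \<in> H0"
    "\<And>\<delta>. 0 < \<delta> \<Longrightarrow> \<delta> \<le> 1 \<Longrightarrow>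
      \<bar>\<kappa> * Re (pairing (\<lambda>x. of_real (decay m \<delta> x)) u) - (LINT x|lebesgue. decay m \<delta> x * decay m 1 (x :: real ^ 'n))\<bar>
        \<le> sqrt \<delta> * \<kappa> * (LINT x|lebesgue. decay m 1 (x :: real ^ 'n))"
proof -
  let ?G = "\<lambda>x :: real ^ 'n. complex_of_real (decay m 1 x)"
  obtain L where L: "L \<ge> 0" "\<And>\<epsilon>. 0 < \<epsilon> \<Longrightarrow> \<epsilon> \<le> 1 \<Longrightarrow> AE x in lebesgue. elliptic_bound L (regularized \<epsilon> (C x))"
    by (rule elliptic_bound_regularized[OF C psd], rule that)
  define \<kappa> where "\<kappa> = 1 + L * (real m)\<^sup>2"
  have \<kappa>: "\<kappa> > 0" using L(1) by (simp add: \<kappa>_def add_pos_nonneg)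
  have G: "?G \<in> L2" unfolding m_def by (rule decay_L2) auto
  have sa: "adjoint H0 = H0" and lim: "strong_resolvent_limit (H_eps C) H0"
    using H0 by (auto simp: viscosity_operator_def self_adjoint_def)
  have "- complex_of_real \<kappa> \<notin> \<real>\<^sub>\<ge>\<^sub>0" using \<kappa> by (simp add: complex_nonneg_Reals_iff)
  then obtain R R0 where R: "\<forall>\<epsilon>\<in>{0<..1}. is_resolvent (H_eps C \<epsilon>) (- complex_of_real \<kappa>) (R \<epsilon>)"
      and R0: "is_resolvent H0 (- complex_of_real \<kappa>) R0"
      and R_lim: "\<forall>f\<in>L2. ((\<lambda>\<epsilon>. L2_norm (\<lambda>x. R \<epsilon> f x - R0 f x)) \<longlongrightarrow> 0) (at_right 0)"
    using lim unfolding strong_resolvent_limit_def by blast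
  have R0': "(R0 ?G, \<lambda>x. ?G x + (- complex_of_real \<kappa>) * R0 ?G x) \<in> H0"
    using R0 G by (auto simp: is_resolvent_def)
  \<comment> \<open>Self-adjointness gives square-integrability, since pairs in the graph of an
    adjoint have components in \<open>L2\<close> by definition.\<close>
  hence "(R0 ?G, \<lambda>x. ?G x + (- complex_of_real \<kappa>) * R0 ?G x) \<in> adjoint H0" by (simp only: sa)
  hence R0L2: "R0 ?G \<in> L2" by (simp add: adjoint_def)
  have R': "(R \<epsilon> ?G, \<lambda>x. ?G x + (- complex_of_real \<kappa>) * R \<epsilon> ?G x) \<in> H_eps C \<epsilon>" if "0 < \<epsilon>" "\<epsilon> \<le> 1" for \<epsilon>
    using R G that by (auto simp: is_resolvent_def)
  have RL2: "R \<epsilon> ?G \<in> L2" if "0 < \<epsilon>" "\<epsilon> \<le> 1" for \<epsilon>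
    using R'[OF that] W12_L2 by (auto simp: H_eps_def form_operator_def)
  show ?thesis
  proof (rule that[OF \<kappa> R0L2 R0'])
    fix \<delta> :: real assume \<delta>: "0 < \<delta>" "\<delta> \<le> 1"
    let ?V = "\<lambda>x :: real ^ 'n. complex_of_real (decay m \<delta> x)"
    let ?c = "LINT x|lebesgue. decay m \<delta> x * decay m 1 (x :: real ^ 'n)"
    have V: "?V \<in> L2" unfolding m_def by (rule decay_L2[OF \<delta>])
    have ev: "\<forall>\<^sub>F \<epsilon> in at_right 0. 0 < \<epsilon> \<and> \<epsilon> \<le> (1::real)"
      unfolding eventually_at_right_field by (intro exI[of _ 1]) auto
    have "((\<lambda>\<epsilon>. pairing ?V (R \<epsilon> ?G) - pairing ?V (R0 ?G)) \<longlongrightarrow> 0) (at_right 0)"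
    proof (rule Lim_null_comparison)
      show "\<forall>\<^sub>F \<epsilon> in at_right 0. norm (pairing ?V (R \<epsilon> ?G) - pairing ?V (R0 ?G))
          \<le> L2_norm ?V * L2_norm (\<lambda>x. R \<epsilon> ?G x - R0 ?G x)"
        using ev
      proof eventually_elim
        case (elim \<epsilon>)
        have "pairing ?V (R \<epsilon> ?G) - pairing ?V (R0 ?G) = pairing ?V (\<lambda>x. R \<epsilon> ?G x - R0 ?G x)"
          using pairing_lincomb[OF V RL2[of \<epsilon>] R0L2, of 1 "-1"] elim by simp
        thus ?case using pairing_bound[OF V L2_diff[OF RL2[of \<epsilon>] R0L2]] elim by simp
      qed
      show "((\<lambda>\<epsilon>. L2_norm ?V * L2_norm (\<lambda>x. R \<epsilon> ?G x - R0 ?G x)) \<longlongrightarrow> 0) (at_right 0)"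
        using R_lim G by (intro tendsto_mult_right_zero) blast
    qed
    hence "((\<lambda>\<epsilon>. pairing ?V (R \<epsilon> ?G)) \<longlongrightarrow> pairing ?V (R0 ?G)) (at_right 0)"
      by (simp add: LIM_zero_iff)
    hence "((\<lambda>\<epsilon>. \<bar>\<kappa> * Re (pairing ?V (R \<epsilon> ?G)) - ?c\<bar>) \<longlongrightarrow> \<bar>\<kappa> * Re (pairing ?V (R0 ?G)) - ?c\<bar>) (at_right 0)"
      by (intro tendsto_intros)
    thus "\<bar>\<kappa> * Re (pairing ?V (R0 ?G)) - ?c\<bar> \<le> sqrt \<delta> * \<kappa> * (LINT x|lebesgue. decay m 1 (x :: real ^ 'n))"
    proof (rule tendsto_upperbound)
      show "\<forall>\<^sub>F \<epsilon> in at_right 0. \<bar>\<kappa> * Re (pairing ?V (R \<epsilon> ?G)) - ?c\<bar>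
          \<le> sqrt \<delta> * \<kappa> * (LINT x|lebesgue. decay m 1 (x :: real ^ 'n))"
        using ev
      proof eventually_elim
        case (elim \<epsilon>)
        show ?case
          unfolding m_def
          by (rule resolvent_mass_estimate[OF C L(1) L(2)[of \<epsilon>] \<delta> _ R'[of \<epsilon>, unfolded m_def]])
            (use elim in \<open>auto simp: \<kappa>_def m_def\<close>)
      qed
    qed simp
  qed
qed

text \<open>Contractivity keeps the mass of S_s G at most I. The deficits, weighted with exp (-
  \<kappa> s), have an integral bounded by the limit of the mass defects I / \<kappa> - (\<psi>, u),
  which is 0 by \<open>mass\<close>.\<close>

lemma (in L2_contraction_semigroup) mass_conserved_AE:
  fixes G :: "real ^ 'n \<Rightarrow> real" and \<psi> :: "nat \<Rightarrow> real ^ 'n \<Rightarrow> real"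
  defines "I \<equiv> LINT x|lebesgue. G x"
  assumes G: "integrable lebesgue G" "\<And>x. G x \<ge> 0" "(\<lambda>x. complex_of_real (G x)) \<in> L2"
    and \<psi>: "\<And>n. (\<lambda>x. complex_of_real (\<psi> n x)) \<in> L2" "\<And>n x. 0 \<le> \<psi> n x" "\<And>n x. \<psi> n x \<le> 1"
      "\<And>x. (\<lambda>n. \<psi> n x) \<longlonglongrightarrow> 1"
    and \<kappa>: "\<kappa> > 0" and u: "u \<in> L2"
    and gen: "(u, \<lambda>x. - (complex_of_real (G x) + (- of_real \<kappa>) * u x)) \<in> generator S"
    and mass: "(\<lambda>n. \<kappa> * Re (pairing (\<lambda>x. complex_of_real (\<psi> n x)) u)) \<longlonglongrightarrow> I"
    and S1: "L1_extension S S1"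
  shows "AE s in lborel. 0 < s \<longrightarrow> Re (LINT x|lebesgue. S1 s (\<lambda>x. complex_of_real (G x)) x) = I"
proof -
  let ?G = "\<lambda>x. complex_of_real (G x)" and ?\<psi> = "\<lambda>n x. complex_of_real (\<psi> n x)"
  define M where "M s = Re (LINT x|lebesgue. S1 s ?G x)" for s
  define Mn where "Mn n s = Re (pairing (?\<psi> n) (S s ?G))" for n s
  \<comment> \<open>The exponential is the integrating factor for F' = \<kappa> F - (\<psi>, S_s G),
    and I / \<kappa> is the stationary solution when the last pairing is constantly I.\<close>
  define \<Phi> where "\<Phi> n s = exp (- \<kappa> * s) * (Re (pairing (?\<psi> n) (S s u)) - I / \<kappa>)" for n s
  have GL1: "?G \<in> L1" using G(1) by (simp add: L1_def)
  have S1G: "S1 s ?G \<in> L1" "L1_norm (S1 s ?G) \<le> I" "ae_eq (S1 s ?G) (S s ?G)" if "s \<ge> 0" for s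
  proof -
    have "L1_norm ?G = I" using G(2) by (simp add: L1_norm_def I_def)
    thus "S1 s ?G \<in> L1" "L1_norm (S1 s ?G) \<le> I" "ae_eq (S1 s ?G) (S s ?G)"
      using S1 GL1 G(3) that
      by (auto simp: L1_extension_def contraction_semigroup_def linear_contraction_def)
  qed
  have iS1: "integrable lebesgue (S1 s ?G)" if "s \<ge> 0" for s
    using S1G(1)[OF that] by (simp add: L1_def)
  have m\<psi>: "(\<lambda>x. cnj (?\<psi> n x)) \<in> borel_measurable lebesgue" for n
    using L2_cnj[OF \<psi>(1)] by (rule L2_measurable)
  have mS1: "(\<lambda>x. cnj (?\<psi> n x) * S1 s ?G x) \<in> borel_measurable lebesgue" if "s \<ge> 0" for n s
    by (rule borel_measurable_times[OF m\<psi> borel_measurable_integrable[OF iS1[OF that]]])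
  have \<psi>S1: "norm (cnj (?\<psi> n x) * S1 s ?G x) \<le> norm (S1 s ?G x)" for n s x
    using mult_right_mono[of "norm (\<psi> n x)" 1 "norm (S1 s ?G x)"] \<psi>(2,3)[of n x] by (simp add: norm_mult)
  have pair: "pairing (?\<psi> n) (S s ?G) = (LINT x|lebesgue. cnj (?\<psi> n x) * S1 s ?G x)" if "s \<ge> 0" for n s
    unfolding pairing_def
  proof (rule integral_cong_AE)
    show "(\<lambda>x. cnj (?\<psi> n x) * S s ?G x) \<in> borel_measurable lebesgue"
      by (intro borel_measurable_integrable pairing_integrable \<psi> S_L2 G that)
    show "AE x in lebesgue. cnj (?\<psi> n x) * S s ?G x = cnj (?\<psi> n x) * S1 s ?G x"
      using S1G(3)[OF that] by eventually_elim simp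
  qed (rule mS1[OF that])
  \<comment> \<open>As 0 \<le> \<psi> \<le> 1, this is the L1 contraction bound; it is the source of
    the monotonicity of \<Phi>.\<close>
  have Mn_le: "Mn n s \<le> I" if "s \<ge> 0" for n s
  proof -
    have "integrable lebesgue (\<lambda>x. cnj (?\<psi> n x) * S1 s ?G x)"
      using mS1[OF that] \<psi>S1 by (intro Bochner_Integration.integrable_bound[OF iS1[OF that]]) auto
    hence i: "integrable lebesgue (\<lambda>x. norm (cnj (?\<psi> n x) * S1 s ?G x))"
      by (rule integrable_norm)
    have "Mn n s \<le> cmod (LINT x|lebesgue. cnj (?\<psi> n x) * S1 s ?G x)"
      unfolding Mn_def pair[OF that] by (rule complex_Re_le_cmod)
    also have "\<dots> \<le> (LINT x|lebesgue. norm (cnj (?\<psi> n x) * S1 s ?G x))"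
      by (rule integral_norm_bound)
    also have "\<dots> \<le> L1_norm (S1 s ?G)"
      unfolding L1_norm_def by (rule integral_mono[OF i integrable_norm[OF iS1[OF that]] \<psi>S1])
    finally show ?thesis using S1G(2)[OF that] by simp
  qed
  have Mn_lim: "(\<lambda>n. Mn n s) \<longlonglongrightarrow> M s" if "s \<ge> 0" for s
  proof -
    have "(\<lambda>n. LINT x|lebesgue. cnj (?\<psi> n x) * S1 s ?G x) \<longlonglongrightarrow> (LINT x|lebesgue. S1 s ?G x)"
    proof (rule integral_dominated_convergence)
      show "integrable lebesgue (\<lambda>x. norm (S1 s ?G x))" by (intro integrable_norm iS1 that)
      show "AE x in lebesgue. norm (cnj (?\<psi> n x) * S1 s ?G x) \<le> norm (S1 s ?G x)" for n
        using \<psi>S1 by simp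
      have "(\<lambda>n. cnj (?\<psi> n x) * S1 s ?G x) \<longlonglongrightarrow> cnj (complex_of_real 1) * S1 s ?G x" for x
        by (intro tendsto_intros \<psi>(4))
      thus "AE x in lebesgue. (\<lambda>n. cnj (?\<psi> n x) * S1 s ?G x) \<longlonglongrightarrow> S1 s ?G x" by simp
    qed (rule borel_measurable_integrable[OF iS1[OF that]], rule mS1[OF that])
    thus ?thesis unfolding Mn_def M_def pair[OF that] by (rule tendsto_Re)
  qed
  have \<Phi>_deriv: "(\<Phi> n has_real_derivative exp (- \<kappa> * s) * (I - Mn n s)) (at s)" if "s > 0" for n s
  proof -
    let ?F = "Re (pairing (?\<psi> n) (S s u))"
    have "(\<lambda>x. - (?G x + (- of_real \<kappa>) * u x)) = (\<lambda>x. (-1) * ?G x + of_real \<kappa> * u x)"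
      by simp
    hence "pairing (?\<psi> n) (S s (\<lambda>x. - (?G x + (- of_real \<kappa>) * u x)))
        = (-1) * pairing (?\<psi> n) (S s ?G) + of_real \<kappa> * pairing (?\<psi> n) (S s u)"
      using pairing_S_lincomb[of s "?\<psi> n" ?G u "-1" "of_real \<kappa>"] that \<psi>(1) G(3) u by simp
    hence "Re (pairing (?\<psi> n) (S s (\<lambda>x. - (?G x + (- of_real \<kappa>) * u x)))) = \<kappa> * ?F - Mn n s"
      by (simp add: Mn_def)
    with has_real_derivative_pairing_S[OF that \<psi>(1) gen, of n]
    have d: "((\<lambda>t. Re (pairing (?\<psi> n) (S t u))) has_real_derivative \<kappa> * ?F - Mn n s) (at s)"
      by simp
    have product_deriv: "((\<lambda>t. exp (- \<kappa> * t) * (F t - c)) has_real_derivative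
        exp (- \<kappa> * s) * F' + (- \<kappa> * exp (- \<kappa> * s)) * (F s - c)) (at s)"
      if "(F has_real_derivative F') (at s)" for F F' c
      using that by (auto intro!: derivative_eq_intros)
    have "exp (- \<kappa> * s) * (\<kappa> * ?F - Mn n s) + (- \<kappa> * exp (- \<kappa> * s)) * (?F - I / \<kappa>)
        = exp (- \<kappa> * s) * (I - Mn n s)"
      using \<kappa> by (simp add: field_simps)
    moreover have "(\<Phi> n has_real_derivative
        exp (- \<kappa> * s) * (\<kappa> * ?F - Mn n s) + (- \<kappa> * exp (- \<kappa> * s)) * (?F - I / \<kappa>)) (at s)"
      unfolding \<Phi>_def by (rule product_deriv[OF d])
    ultimately show ?thesis by simp
  qed
  have \<Phi>_mono: "\<Phi> n a \<le> \<Phi> n b" if "0 < a" "a \<le> b" for n a b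
  proof (rule DERIV_nonneg_imp_nondecreasing[OF that(2)])
    fix s assume "a \<le> s" "s \<le> b"
    hence s: "s > 0" using that by simp
    thus "\<exists>y. (\<Phi> n has_real_derivative y) (at s) \<and> 0 \<le> y"
      using \<Phi>_deriv[OF s, of n] Mn_le[of s n] by (intro exI conjI) auto
  qed
  \<comment> \<open>\<Phi> is nondecreasing and tends to 0 at infinity, because L2 contractivity
    bounds the pairing while the exponential decays.\<close>
  have \<Phi>_le_0: "\<Phi> n b \<le> 0" if "b > 0" for n b
  proof (rule tendsto_lowerbound)
    let ?B = "L2_norm (?\<psi> n) * L2_norm u + \<bar>I / \<kappa>\<bar>"
    show "(\<Phi> n \<longlongrightarrow> 0) at_top"
    proof (rule Lim_null_comparison)
      show "\<forall>\<^sub>F t in at_top. norm (\<Phi> n t) \<le> exp (- \<kappa> * t) * ?B"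
        using eventually_ge_at_top[of 0]
      proof eventually_elim
        case (elim t)
        have "\<bar>Re (pairing (?\<psi> n) (S t u)) - I / \<kappa>\<bar> \<le> ?B"
          using abs_Re_le_cmod[of "pairing (?\<psi> n) (S t u)"] pairing_S_bound[OF elim \<psi>(1) u, of n] by linarith
        thus ?case unfolding \<Phi>_def by (simp add: abs_mult mult_left_mono)
      qed
      have "((\<lambda>t. exp (- \<kappa> * t)) \<longlongrightarrow> 0) at_top"
        using \<kappa> by real_asymp
      thus "((\<lambda>t. exp (- \<kappa> * t) * ?B) \<longlongrightarrow> 0) at_top"
        by (rule tendsto_mult_left_zero)
    qed
    show "\<forall>\<^sub>F t in at_top. \<Phi> n b \<le> \<Phi> n t"
      using eventually_ge_at_top[of b] by eventually_elim (use \<Phi>_mono that in auto)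
  qed simp
  have \<Phi>_0: "\<Phi> n 0 = Re (pairing (?\<psi> n) u) - I / \<kappa>" for n
    using pairing_cong[OF \<psi>(1) S_L2[of 0, OF _ u] u S_zero[OF u]] by (simp add: \<Phi>_def)
  \<comment> \<open>Differentiability has been shown at positive times; continuity from the right
    carries the monotonicity down to time 0.\<close>
  have \<Phi>_ge_0: "\<Phi> n 0 \<le> \<Phi> n a" if "a > 0" for n a
  proof (rule tendsto_upperbound)
    have "continuous_on {0..} (\<Phi> n)"
      unfolding \<Phi>_def[abs_def] by (intro continuous_intros pairing_S_continuous \<psi>(1) u)
    hence "(\<Phi> n \<longlongrightarrow> \<Phi> n 0) (at 0 within {0..})"
      by (simp add: continuous_on_def)
    thus "(\<Phi> n \<longlongrightarrow> \<Phi> n 0) (at_right 0)"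
      by (rule tendsto_within_subset) auto
    show "\<forall>\<^sub>F t in at_right 0. \<Phi> n t \<le> \<Phi> n a"
      unfolding eventually_at_right_field using that \<Phi>_mono by (intro exI[of _ a]) auto
  qed simp
  \<comment> \<open>This is minus the value of \<Phi> at 0, a bound for every later increment of
    \<Phi>.\<close>
  define \<eta> where "\<eta> n = I / \<kappa> - Re (pairing (?\<psi> n) u)" for n
  have \<eta>: "\<eta> \<longlonglongrightarrow> 0"
  proof -
    have "(\<lambda>n. I / \<kappa> - (\<kappa> * Re (pairing (?\<psi> n) u)) / \<kappa>) \<longlonglongrightarrow> I / \<kappa> - I / \<kappa>"
      using \<kappa> by (intro tendsto_intros mass) simp
    thus ?thesis using \<kappa> by (simp add: \<eta>_def[abs_def])
  qed
  \<comment> \<open>The increment of \<Phi> over [a, b] is at most \<eta>, which tends to 0, so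
    Fatou's lemma makes the limit of the nonnegative integrands vanish almost everywhere.\<close>
  have main: "AE s in lborel. s \<in> {a..b} \<longrightarrow> M s = I" if ab: "0 < a" "a \<le> b" for a b
  proof -
    \<comment> \<open>The indicator makes the integrand Borel on the whole line, although the
      pairings are controlled for nonnegative times only.\<close>
    define f where "f n s = indicator {0<..} s *\<^sub>R (exp (- \<kappa> * s) * (I - Mn n s))" for n s
    let ?f = "\<lambda>n s. ennreal (f n s) * indicator {a..b} s"
    have mf: "f n \<in> borel_measurable borel" for n
    proof -
      have "continuous_on {0<..} (\<lambda>s. Re (pairing (?\<psi> n) (S s ?G)))"
        by (intro continuous_intros continuous_on_subset[OF pairing_S_continuous[OF \<psi>(1) G(3)]]) auto
      hence "continuous_on {0<..} (\<lambda>s. exp (- \<kappa> * s) * (I - Mn n s))"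
        unfolding Mn_def
        by (intro continuous_on_mult continuous_on_diff continuous_on_const) (auto intro!: continuous_intros)
      thus ?thesis
        unfolding f_def[abs_def] by (rule borel_measurable_continuous_on_indicator[rotated]) simp
    qed
    have int: "(\<integral>\<^sup>+ s. ?f n s \<partial>lborel) \<le> ennreal (\<eta> n)" for n
    proof -
      have "(\<integral>\<^sup>+ s. ?f n s \<partial>lborel) = \<Phi> n b - \<Phi> n a"
      proof (rule nn_integral_FTC_Icc)
        fix s assume s: "s \<in> {a..b}"
        show "(\<Phi> n has_real_derivative f n s) (at s)"
          using \<Phi>_deriv[of s n] s ab by (simp add: f_def)
        show "0 \<le> f n s"
          using Mn_le[of s n] s ab by (simp add: f_def)
      qed (use mf ab in auto)
      also have "\<dots> \<le> ennreal (\<eta> n)"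
        using \<Phi>_le_0[of b n] \<Phi>_ge_0[OF ab(1), of n] ab unfolding \<Phi>_0 \<eta>_def
        by (intro ennreal_leI) simp
      finally show ?thesis .
    qed
    have mf': "?f n \<in> borel_measurable lborel" for n
      using mf[of n] by simp
    have "(\<integral>\<^sup>+ s. liminf (\<lambda>n. ?f n s) \<partial>lborel) \<le> liminf (\<lambda>n. \<integral>\<^sup>+ s. ?f n s \<partial>lborel)"
      by (rule nn_integral_liminf[OF mf'])
    also have "\<dots> \<le> liminf (\<lambda>n. ennreal (\<eta> n))"
      by (intro Liminf_mono always_eventually allI int)
    also have "\<dots> = 0"
    proof (rule lim_imp_Liminf)
      show "(\<lambda>n. ennreal (\<eta> n)) \<longlonglongrightarrow> 0"
        using tendsto_ennrealI[OF \<eta>] by simp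
    qed simp
    finally have "(\<integral>\<^sup>+ s. liminf (\<lambda>n. ?f n s) \<partial>lborel) = 0" by simp
    moreover have "(\<lambda>s. liminf (\<lambda>n. ?f n s)) \<in> borel_measurable lborel"
      by (rule borel_measurable_liminf[OF mf'])
    ultimately have "AE s in lborel. liminf (\<lambda>n. ?f n s) = 0"
      by (simp add: nn_integral_0_iff_AE)
    thus ?thesis
    proof eventually_elim
      case (elim s)
      show ?case
      proof
        assume s: "s \<in> {a..b}"
        hence s0: "s > 0" using ab by simp
        have "(\<lambda>n. exp (- \<kappa> * s) * (I - Mn n s)) \<longlonglongrightarrow> exp (- \<kappa> * s) * (I - M s)"
          using s0 by (intro tendsto_intros Mn_lim) simp
        hence "(\<lambda>n. ennreal (exp (- \<kappa> * s) * (I - Mn n s))) \<longlonglongrightarrow> ennreal (exp (- \<kappa> * s) * (I - M s))"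
          by (rule tendsto_ennrealI)
        moreover have "?f n s = ennreal (exp (- \<kappa> * s) * (I - Mn n s))" for n
          using s s0 by (simp add: f_def)
        ultimately have "liminf (\<lambda>n. ?f n s) = ennreal (exp (- \<kappa> * s) * (I - M s))"
          by (simp add: lim_imp_Liminf)
        hence "exp (- \<kappa> * s) * (I - M s) \<le> 0"
          using elim by (simp add: ennreal_eq_0_iff)
        hence "I \<le> M s" by (simp add: mult_le_0_iff)
        moreover have "M s \<le> I"
          using s0 Mn_le[of s] by (intro tendsto_upperbound[OF Mn_lim[of s]]) auto
        ultimately show "M s = I" by simp
      qed
    qed
  qed
  \<comment> \<open>Countably many compact intervals exhaust the positive half-line.\<close>
  have "AE s in lborel. \<forall>k::nat. s \<in> {inverse (real (Suc k))..real (Suc k)} \<longrightarrow> M s = I"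
  proof (subst AE_all_countable, rule allI, rule main)
    fix k
    have "inverse (real (Suc k)) \<le> 1" by (simp add: inverse_le_1_iff)
    thus "inverse (real (Suc k)) \<le> real (Suc k)" by simp
  qed simp
  thus ?thesis
  proof eventually_elim
    case (elim s)
    show ?case
    proof
      assume "0 < s"
      obtain k1 where k1: "inverse (real (Suc k1)) < s" using reals_Archimedean[OF \<open>0 < s\<close>] by blast
      obtain k2 where k2: "s < real k2" using reals_Archimedean2[of s] by blast
      let ?k = "max k1 k2"
      have "inverse (real (Suc ?k)) \<le> inverse (real (Suc k1))"
        by (intro le_imp_inverse_le) auto
      moreover have "real k2 \<le> real (Suc ?k)" by simp
      ultimately have "inverse (real (Suc ?k)) \<le> s" "s \<le> real (Suc ?k)"
        using k1 k2 by linarith+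
      hence "s \<in> {inverse (real (Suc ?k))..real (Suc ?k)}"
        unfolding atLeastAtMost_iff by blast
      hence "M s = I" using elim by blast
      thus "Re (LINT x|lebesgue. S1 s ?G x) = I" by (simp add: M_def)
    qed
  qed
qed

text \<open>The bad times form a null set, and so does their image under s to t - s, whereas the
  interval from 0 to t has positive measure.\<close>

lemma AE_exists_sum_decomposition:
  fixes t :: real
  assumes "AE s in lborel. 0 < s \<longrightarrow> P s" "t > 0"
  obtains r s where "0 < r" "0 < s" "P r" "P s" "r + s = t"
proof -
  have "AE s in lborel. 0 < - s \<longrightarrow> P (- s)"
    by (rule AE_distrD[of uminus lborel borel "\<lambda>s. 0 < s \<longrightarrow> P s"])
      (use assms(1) in \<open>simp_all only: lborel_distr_uminus\<close>, simp)
  \<comment> \<open>The form - (- t + s) of t - s lets reflection and translation invariance be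
    applied one after the other.\<close>
  hence "AE s in lborel. 0 < - (- t + s) \<longrightarrow> P (- (- t + s))"
    by (intro AE_distrD[of "(+) (- t)" lborel borel "\<lambda>s. 0 < - s \<longrightarrow> P (- s)"])
      (simp_all only: lborel_distr_plus, simp)
  with assms(1) have ae: "AE s in lborel. (0 < s \<longrightarrow> P s) \<and> (0 < - (- t + s) \<longrightarrow> P (- (- t + s)))"
    by eventually_elim simp
  have "\<exists>s. 0 < s \<and> s < t \<and> P s \<and> P (t - s)"
  proof (rule ccontr)
    assume "\<not> ?thesis"
    hence no: "\<not> (P s \<and> P (- (- t + s)))" if "0 < s" "s < t" for s using that by auto
    from ae have "AE s in lborel. s \<notin> {0<..<t}"
      by eventually_elim (use no in auto)
    hence "{0<..<t} \<in> null_sets lborel"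
      by (subst AE_iff_null_sets) auto
    thus False using assms(2) by (simp add: null_sets_def)
  qed
  then obtain s where "0 < s" "s < t" "P s" "P (t - s)" by blast
  thus ?thesis using that[of s "t - s"] by simp
qed

theorem proposition3p6:
  fixes C :: "(real ^ 'n::finite) \<Rightarrow> real ^ 'n ^ 'n"
    and H0 :: "'n graph"
    and S Sinf :: "real \<Rightarrow> 'n cfun \<Rightarrow> 'n cfun"
  assumes "\<And>i j. (\<lambda>x. C x $ i $ j) \<in> Linfty"
    and "AE x in lebesgue. transpose (C x) = C x \<and> (\<forall>v. v \<bullet> (C x *v v) \<ge> 0)"
    and "viscosity_operator C H0"
    and "exp_semigroup H0 S"
    and "Linfty_extension S Sinf"
  shows "\<forall>t>0. AE x in lebesgue. Sinf t (\<lambda>_. 1) x = 1"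
proof -
  let ?m = "CARD('n) + 1"
  let ?G = "\<lambda>x :: real ^ 'n. complex_of_real (decay ?m 1 x)"
  let ?I = "LINT x|lebesgue. decay ?m 1 (x :: real ^ 'n)"
  let ?\<delta> = "\<lambda>n. inverse (real (Suc n))"
  let ?\<psi> = "\<lambda>n. decay ?m (?\<delta> n) :: real ^ 'n \<Rightarrow> real"
  let ?one = "\<lambda>_ :: real ^ 'n. 1 :: complex"
  interpret L2_contraction_semigroup S
    using assms(4) by unfold_locales (auto simp: exp_semigroup_def)
  obtain S1 where S1: "L1_extension S S1"
      and dual: "\<forall>t\<ge>0. \<forall>f\<in>Linfty. Sinf t f \<in> Linfty \<and> (\<forall>g\<in>L1. pairing (Sinf t f) g = pairing f (S1 t g))"
    using assms(5) unfolding Linfty_extension_def by blast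
  have S1c: "contraction_semigroup L1 L1_norm S1" using S1 by (simp add: L1_extension_def)
  obtain \<kappa> u where \<kappa>: "\<kappa> > 0" and u: "u \<in> L2"
      and uH: "(u, \<lambda>x. ?G x + (- of_real \<kappa>) * u x) \<in> H0"
      and est: "\<And>\<delta>. 0 < \<delta> \<Longrightarrow> \<delta> \<le> 1 \<Longrightarrow>
        \<bar>\<kappa> * Re (pairing (\<lambda>x. of_real (decay ?m \<delta> x)) u) - (LINT x|lebesgue. decay ?m \<delta> x * decay ?m 1 (x :: real ^ 'n))\<bar>
        \<le> sqrt \<delta> * \<kappa> * ?I"
    by (rule viscosity_resolvent_mass[OF assms(1,2,3)], rule that)
  have gen: "(u, \<lambda>x. - (?G x + (- of_real \<kappa>) * u x)) \<in> generator S"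
  proof -
    have "generator S = {(u, \<lambda>x. - f x) |u f. (u, f) \<in> H0}"
      using assms(4) by (simp add: exp_semigroup_def)
    moreover have "\<exists>u' f. (u, \<lambda>x. - (?G x + (- of_real \<kappa>) * u x)) = (u', \<lambda>x. - f x) \<and> (u', f) \<in> H0"
      by (rule exI[of _ u], rule exI[of _ "\<lambda>x. ?G x + (- of_real \<kappa>) * u x"]) (rule conjI[OF refl uH])
    ultimately show ?thesis by (simp only: mem_Collect_eq)
  qed
  have \<delta>: "0 < ?\<delta> n" "?\<delta> n \<le> 1" for n by (simp_all add: inverse_le_1_iff)
  have \<psi>_bounds: "0 \<le> ?\<psi> n x" "?\<psi> n x \<le> 1" for n x
    by (intro decay_nonneg decay_le_1 less_imp_le[OF \<delta>(1)])+
  have iG: "integrable lebesgue (decay ?m 1 :: real ^ 'n \<Rightarrow> real)" by (rule integrable_decay_1)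
  have m\<delta>: "(decay ?m \<delta> :: real ^ 'n \<Rightarrow> real) \<in> borel_measurable lebesgue" if "\<delta> \<ge> 0" for \<delta>
    by (intro smooth_measurable smooth_decay that)
  \<comment> \<open>The pairing of the cut-off with \<open>decay ?m 1\<close> converges by dominated
    convergence, and the resolvent estimate has error of order sqrt \<delta>.\<close>
  have mass: "(\<lambda>n. \<kappa> * Re (pairing (\<lambda>x. complex_of_real (?\<psi> n x)) u)) \<longlonglongrightarrow> ?I"
  proof -
    let ?c = "\<lambda>n. LINT x|lebesgue. ?\<psi> n x * decay ?m 1 x"
    have "?c \<longlonglongrightarrow> ?I"
    proof (rule integral_dominated_convergence[OF _ _ iG])
      show "(\<lambda>x. ?\<psi> n x * decay ?m 1 x) \<in> borel_measurable lebesgue" for n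
        by (intro borel_measurable_times m\<delta> less_imp_le[OF \<delta>(1)]) simp
      show "AE x in lebesgue. norm (?\<psi> n x * decay ?m 1 x) \<le> decay ?m 1 x" for n
      proof (rule AE_I2)
        fix x :: "real ^ 'n"
        show "norm (?\<psi> n x * decay ?m 1 x) \<le> decay ?m 1 x"
          using mult_right_mono[OF \<psi>_bounds(2)[of n x] decay_nonneg[of 1 ?m x]] \<psi>_bounds(1)[of n x]
            decay_nonneg[of 1 ?m x] by (simp only: real_norm_def abs_mult abs_of_nonneg) simp
      qed
      have "(\<lambda>n. ?\<psi> n x * decay ?m 1 x) \<longlonglongrightarrow> 1 * decay ?m 1 x" for x
        by (intro tendsto_mult decay_tendsto tendsto_const)
      thus "AE x in lebesgue. (\<lambda>n. ?\<psi> n x * decay ?m 1 x) \<longlonglongrightarrow> decay ?m 1 x" by simp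
    qed (intro m\<delta>, simp)
    moreover have "(\<lambda>n. \<kappa> * Re (pairing (\<lambda>x. complex_of_real (?\<psi> n x)) u) - ?c n) \<longlonglongrightarrow> 0"
    proof (rule Lim_null_comparison)
      show "\<forall>\<^sub>F n in sequentially. norm (\<kappa> * Re (pairing (\<lambda>x. complex_of_real (?\<psi> n x)) u) - ?c n)
          \<le> sqrt (?\<delta> n) * \<kappa> * ?I"
        using est[OF \<delta>] by simp
      have "(\<lambda>n. sqrt (?\<delta> n) * \<kappa> * ?I) \<longlonglongrightarrow> sqrt 0 * \<kappa> * ?I"
        by (intro tendsto_intros LIMSEQ_inverse_real_of_nat)
      thus "(\<lambda>n. sqrt (?\<delta> n) * \<kappa> * ?I) \<longlonglongrightarrow> 0" by simp
    qed
    ultimately have "(\<lambda>n. ?c n + (\<kappa> * Re (pairing (\<lambda>x. complex_of_real (?\<psi> n x)) u) - ?c n)) \<longlonglongrightarrow> ?I + 0"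
      by (rule tendsto_add)
    thus ?thesis by simp
  qed
  have conserved: "AE s in lborel. 0 < s \<longrightarrow> Re (LINT x|lebesgue. S1 s ?G x) = ?I"
    by (rule mass_conserved_AE[OF iG decay_nonneg decay_L2 decay_L2 \<psi>_bounds decay_tendsto \<kappa> u gen mass S1])
      (use \<delta> in auto)
  have one: "?one \<in> Linfty" by (auto simp: Linfty_def)
  have S1_L1: "S1 t h \<in> L1" "L1_norm (S1 t h) \<le> L1_norm h" if "t \<ge> 0" "h \<in> L1" for t h
    using S1c that by (auto simp: contraction_semigroup_def linear_contraction_def)
  \<comment> \<open>By duality the image of 1 acts on \<open>h\<close> as the integral of
    \<open>S1 t h\<close>, which L1 contractivity bounds.\<close>
  have contr: "cmod (pairing (Sinf t ?one) h) \<le> L1_norm h" if "t \<ge> 0" "h \<in> L1" for t h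
  proof -
    have "pairing (Sinf t ?one) h = (LINT x|lebesgue. S1 t h x)"
      using dual that one by (simp add: pairing_def)
    also have "cmod \<dots> \<le> L1_norm (S1 t h)"
      unfolding L1_norm_def by (rule integral_norm_bound)
    finally show ?thesis using S1_L1(2)[OF that] by simp
  qed
  \<comment> \<open>A functional of norm at most 1 that attains the integral of a strictly positive
    function is integration itself, so the mass of \<open>?G\<close> alone decides about
    \<open>t\<close>.\<close>
  have eq_1: "AE x in lebesgue. Sinf t ?one x = 1"
    if t: "t \<ge> 0" and "Re (pairing ?one (S1 t ?G)) = ?I" for t
  proof (rule eq_1_if_contractive_functional[OF _ iG])
    show "Sinf t ?one \<in> Linfty" using dual t one by blast
    show "Re (pairing (Sinf t ?one) ?G) = ?I"
      using dual t one iG that(2) by (simp add: L1_def)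
  qed (auto intro: contr t decay_pos)
  \<comment> \<open>Conservation of all integrals, unlike that of the integral of \<open>?G\<close>
    alone, can be composed over two times.\<close>
  define good where "good s \<longleftrightarrow> (\<forall>h\<in>L1. pairing ?one (S1 s h) = pairing ?one h)" for s
  have good: "good s" if s: "s > 0" "Re (LINT x|lebesgue. S1 s ?G x) = ?I" for s
    unfolding good_def
  proof
    fix h :: "'n cfun" assume h: "h \<in> L1"
    have "AE x in lebesgue. Sinf s ?one x = 1"
      using s by (intro eq_1) (simp_all add: pairing_def)
    hence ae: "AE x in lebesgue. cnj (Sinf s ?one x) * h x = cnj (?one x) * h x"
      by eventually_elim simp
    have "(Sinf s ?one) \<in> borel_measurable lebesgue"
      using dual s one by (auto simp: Linfty_def)
    hence m: "(\<lambda>x. cnj (Sinf s ?one x)) \<in> borel_measurable lebesgue"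
      by (rule measurable_compose[OF _ borel_measurable_cnj])
    have mh: "h \<in> borel_measurable lebesgue" using h by (simp add: L1_def borel_measurable_integrable)
    have "pairing (Sinf s ?one) h = pairing ?one h"
      unfolding pairing_def by (rule integral_cong_AE[OF _ _ ae]) (use m mh in simp_all)
    thus "pairing ?one (S1 s h) = pairing ?one h"
      using dual s one h by simp
  qed
  have AE_good: "AE s in lborel. 0 < s \<longrightarrow> good s"
    using conserved by eventually_elim (use good in auto)
  show ?thesis
  proof (intro allI impI)
    fix t :: real assume "t > 0"
    \<comment> \<open>Both S_s and then S_r preserve the integral, so \<open>?G\<close> keeps its
      mass at the arbitrary time \<open>t\<close> as well.\<close>
    obtain r s where rs: "0 < r" "0 < s" "good r" "good s" "r + s = t"
      by (rule AE_exists_sum_decomposition[OF AE_good \<open>t > 0\<close>])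
    have GL1: "?G \<in> L1" using iG by (simp add: L1_def)
    have L1: "S1 s ?G \<in> L1" "S1 r (S1 s ?G) \<in> L1" "S1 t ?G \<in> L1"
      using S1_L1(1) GL1 rs \<open>t > 0\<close> by simp_all
    have "ae_eq (S1 (r + s) ?G) (S1 r (S1 s ?G))"
      using S1c less_imp_le[OF rs(1)] less_imp_le[OF rs(2)] GL1
      unfolding contraction_semigroup_def by blast
    hence "pairing ?one (S1 t ?G) = pairing ?one (S1 r (S1 s ?G))"
      unfolding pairing_def using L1 rs(5)
      by (intro integral_cong_AE) (auto simp: L1_def borel_measurable_integrable)
    also have "\<dots> = pairing ?one ?G"
      using rs(3,4) L1 GL1 by (simp add: good_def)
    finally have "Re (pairing ?one (S1 t ?G)) = ?I"
      by (simp add: pairing_def)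
    thus "AE x in lebesgue. Sinf t ?one x = 1"
      using \<open>t > 0\<close> by (intro eq_1) auto
  qed
qed

end
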